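(* Let $\Omega\subset\mathbb R^2$ be a smooth and simply connected open set of finite area and let $\lambda>0$. Consider the two conditions: (a) there is a non-trivial solution $w$ of \[ -\Delta w=\lambda w\ \text{in }\Omega,\qquad w\equiv\mathrm{const}\ \text{on }\partial\Omega,\qquad \partial_Nw=0\ \text{on }\partial\Omega; \] (b) there is a non-zero solution $\psi$ of \[ \Delta^2\psi+\lambda\Delta\psi=0\ \text{in }\Omega,\qquad \psi=\partial_N\psi=0\ \text{on }\partial\Omega, \] for which $\Delta\psi$ is constant along $\partial\Omega$. A necessary and sufficient condition for either of (a), (b) (and hence both) to be valid is that there exist a non-trivial vector field $u$ for which the Stokes system \[ \Delta u+\lambda u=\nabla p\ \text{in }\Omega,\qquad \nabla\cdot u=0\ \text{in }\Omega,\qquad u=0\ \text{on }\partial\Omega \tag{S} \] holds with pressure $p$ satisfying \[ \partial_Np=0\quad\text{on }\partial\Omega. \tag{N} \] In fact, if (S) holds, then the Neumann boundary condition (N) is equivalent to the condition $p\equiv\mathrm{const}$ in $\Omega$. Finally, this happens if and only if for any $\nu\in(0,+\infty)$ the function \[ v(x,t)=e^{-\nu\lambda t}u(x) \] is a solution of the Navier–Stokes equations \[ \partial_tv+(v\cdot\nabla)v=\nu\Delta v-\nabla p\ \text{in }\Omega,\qquad \nabla\cdot v=0\ \text{in }\Omega,\qquad v=0\ \text{on }\partial\Omega, \] with $\nabla p=0$.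
   Context: $N$ is the outward unit normal to $\partial\Omega$ and $\partial_N$ the normal derivative. Since $\Omega$ is smooth, solutions $u$, $p$, $\psi$ are smooth up to the boundary.
   Formalization: "With ∇p=0" fails for the Navier–Stokes pressure (disc: swirl u=J₁(√λ r)e_θ); instead ∇p only balances the inertial term, ∇p=-(v·∇)v, or p is arbitrary. Solutions have finite energy (w,u∈H¹, ψ∈H², p∈L²), automatic for bounded Ω. *)

theory Defs
  imports "HOL-Analysis.Analysis"
begin

section \<open>Differential operators in the plane\<close>

definition pd :: "2 \<Rightarrow> (real^2 \<Rightarrow> 'b::real_normed_vector) \<Rightarrow> real^2 \<Rightarrow> 'b"
  where "pd i f = (\<lambda>x. frechet_derivative f (at x) (axis i 1))"

definition pds :: "2 list \<Rightarrow> (real^2 \<Rightarrow> 'b::real_normed_vector) \<Rightarrow> real^2 \<Rightarrow> 'b"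
  where "pds is f = foldr pd is f"

definition grad :: "(real^2 \<Rightarrow> real) \<Rightarrow> real^2 \<Rightarrow> real^2"
  where "grad f x = (\<chi> i. pd i f x)"

definition laplacian :: "(real^2 \<Rightarrow> 'b::real_normed_vector) \<Rightarrow> real^2 \<Rightarrow> 'b"
  where "laplacian f x = (\<Sum>i\<in>UNIV. pd i (pd i f) x)"

definition divg :: "(real^2 \<Rightarrow> real^2) \<Rightarrow> real^2 \<Rightarrow> real"
  where "divg u x = (\<Sum>i\<in>UNIV. pd i u x $ i)"

text \<open>The convective derivative, \<open>(v \<cdot> \<nabla>) w\<close>.\<close>
definition convect :: "(real^2 \<Rightarrow> real^2) \<Rightarrow> (real^2 \<Rightarrow> real^2) \<Rightarrow> real^2 \<Rightarrow> real^2"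
  where "convect v w x = (\<Sum>i\<in>UNIV. v x $ i *\<^sub>R pd i w x)"

section \<open>Smoothness, boundary values, and the outward normal\<close>

definition smooth_on :: "(real^2) set \<Rightarrow> (real^2 \<Rightarrow> 'b::real_normed_vector) \<Rightarrow> bool"
  where "smooth_on U f \<longleftrightarrow> (\<forall>is. \<forall>x\<in>U. pds is f differentiable (at x))"

text \<open>Functions are only looked at inside the open set \<open>\<Omega>\<close>; boundary values, also those of
  derivatives, are the limits from inside.\<close>
definition smooth_up_to_boundary :: "(real^2) set \<Rightarrow> (real^2 \<Rightarrow> 'b::real_normed_vector) \<Rightarrow> bool"
  where "smooth_up_to_boundary \<Omega> f \<longleftrightarrow>
    smooth_on \<Omega> f \<and>
    (\<forall>is. \<exists>g. continuous_on (closure \<Omega>) g \<and> (\<forall>x\<in>\<Omega>. g x = pds is f x))"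

definition has_trace ::
    "(real^2) set \<Rightarrow> (real^2 \<Rightarrow> 'b::real_normed_vector) \<Rightarrow> real^2 \<Rightarrow> 'b \<Rightarrow> bool"
  where "has_trace \<Omega> f x b \<longleftrightarrow> (f \<longlongrightarrow> b) (at x within \<Omega>)"

definition defining_function ::
    "(real^2) set \<Rightarrow> real^2 \<Rightarrow> (real^2) set \<Rightarrow> (real^2 \<Rightarrow> real) \<Rightarrow> bool"
  where "defining_function \<Omega> x U \<rho> \<longleftrightarrow>
    open U \<and> x \<in> U \<and> smooth_on U \<rho> \<and> (\<forall>y\<in>U. grad \<rho> y \<noteq> 0) \<and>
    \<Omega> \<inter> U = {y\<in>U. \<rho> y < 0}"

definition smooth_open_set :: "(real^2) set \<Rightarrow> bool"
  where "smooth_open_set \<Omega> \<longleftrightarrow>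
    open \<Omega> \<and> (\<forall>x\<in>frontier \<Omega>. \<exists>U \<rho>. defining_function \<Omega> x U \<rho>)"

text \<open>For \<open>x \<in> frontier \<Omega>\<close> the vector below does not depend on the defining function.\<close>
definition outward_normal :: "(real^2) set \<Rightarrow> real^2 \<Rightarrow> real^2"
  where "outward_normal \<Omega> x =
    (THE n. \<exists>U \<rho>. defining_function \<Omega> x U \<rho> \<and> n = grad \<rho> x /\<^sub>R norm (grad \<rho> x))"

definition has_normal_derivative ::
    "(real^2) set \<Rightarrow> (real^2 \<Rightarrow> real) \<Rightarrow> real^2 \<Rightarrow> real \<Rightarrow> bool"
  where "has_normal_derivative \<Omega> f x d \<longleftrightarrow>
    has_trace \<Omega> (\<lambda>y. grad f y \<bullet> outward_normal \<Omega> x) x d"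

text \<open>Finite Sobolev norm of order \<open>k\<close>. If \<open>\<Omega>\<close> is bounded, every function that is smooth up to the
  boundary has this property for all \<open>k\<close>. An open set of finite area may be unbounded, and there
  the condition selects the usual energy solutions.\<close>
definition finite_energy ::
    "nat \<Rightarrow> (real^2) set \<Rightarrow> (real^2 \<Rightarrow> 'b::real_normed_vector) \<Rightarrow> bool"
  where "finite_energy k \<Omega> f \<longleftrightarrow>
    (\<forall>is. length is \<le> k \<longrightarrow> set_integrable lborel \<Omega> (\<lambda>x. (norm (pds is f x))\<^sup>2))"

definition nontrivial_on :: "(real^2) set \<Rightarrow> (real^2 \<Rightarrow> 'b::real_normed_vector) \<Rightarrow> bool"
  where "nontrivial_on \<Omega> f \<longleftrightarrow> (\<exists>x\<in>\<Omega>. f x \<noteq> 0)"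

definition constant_in :: "(real^2) set \<Rightarrow> (real^2 \<Rightarrow> real) \<Rightarrow> bool"
  where "constant_in \<Omega> f \<longleftrightarrow> (\<exists>c. \<forall>x\<in>\<Omega>. f x = c)"

definition constant_on_boundary :: "(real^2) set \<Rightarrow> (real^2 \<Rightarrow> real) \<Rightarrow> bool"
  where "constant_on_boundary \<Omega> f \<longleftrightarrow> (\<exists>c. \<forall>x\<in>frontier \<Omega>. has_trace \<Omega> f x c)"

section \<open>The boundary value problems\<close>

definition overdetermined_helmholtz :: "(real^2) set \<Rightarrow> real \<Rightarrow> (real^2 \<Rightarrow> real) \<Rightarrow> bool"
  where "overdetermined_helmholtz \<Omega> l w \<longleftrightarrow>
    smooth_up_to_boundary \<Omega> w \<and> finite_energy 1 \<Omega> w \<and>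
    (\<forall>x\<in>\<Omega>. - laplacian w x = l * w x) \<and>
    constant_on_boundary \<Omega> w \<and>
    (\<forall>x\<in>frontier \<Omega>. has_normal_derivative \<Omega> w x 0)"

definition clamped_buckling :: "(real^2) set \<Rightarrow> real \<Rightarrow> (real^2 \<Rightarrow> real) \<Rightarrow> bool"
  where "clamped_buckling \<Omega> l \<psi> \<longleftrightarrow>
    smooth_up_to_boundary \<Omega> \<psi> \<and> finite_energy 2 \<Omega> \<psi> \<and>
    (\<forall>x\<in>\<Omega>. laplacian (laplacian \<psi>) x + l * laplacian \<psi> x = 0) \<and>
    (\<forall>x\<in>frontier \<Omega>. has_trace \<Omega> \<psi> x 0 \<and> has_normal_derivative \<Omega> \<psi> x 0)"

definition stokes_eigenpair ::
    "(real^2) set \<Rightarrow> real \<Rightarrow> (real^2 \<Rightarrow> real^2) \<Rightarrow> (real^2 \<Rightarrow> real) \<Rightarrow> bool"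
  where "stokes_eigenpair \<Omega> l u p \<longleftrightarrow>
    smooth_up_to_boundary \<Omega> u \<and> finite_energy 1 \<Omega> u \<and>
    smooth_up_to_boundary \<Omega> p \<and> finite_energy 0 \<Omega> p \<and>
    (\<forall>x\<in>\<Omega>. laplacian u x + l *\<^sub>R u x = grad p x) \<and>
    (\<forall>x\<in>\<Omega>. divg u x = 0) \<and>
    (\<forall>x\<in>frontier \<Omega>. has_trace \<Omega> u x 0)"

definition neumann_condition :: "(real^2) set \<Rightarrow> (real^2 \<Rightarrow> real) \<Rightarrow> bool"
  where "neumann_condition \<Omega> p \<longleftrightarrow> (\<forall>x\<in>frontier \<Omega>. has_normal_derivative \<Omega> p x 0)"

definition navier_stokes ::
    "(real^2) set \<Rightarrow> real \<Rightarrow> (real \<Rightarrow> real^2 \<Rightarrow> real^2) \<Rightarrow> (real \<Rightarrow> real^2 \<Rightarrow> real) \<Rightarrow> bool"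
  where "navier_stokes \<Omega> \<nu> v q \<longleftrightarrow>
    (\<forall>t\<ge>0.
      smooth_up_to_boundary \<Omega> (v t) \<and> smooth_up_to_boundary \<Omega> (q t) \<and>
      (\<forall>x\<in>\<Omega>. \<exists>v'. ((\<lambda>s. v s x) has_vector_derivative v') (at t within {0..}) \<and>
         v' + convect (v t) (v t) x = \<nu> *\<^sub>R laplacian (v t) x - grad (q t) x) \<and>
      (\<forall>x\<in>\<Omega>. divg (v t) x = 0) \<and>
      (\<forall>x\<in>frontier \<Omega>. has_trace \<Omega> (v t) x 0))"

text \<open>The pressure does nothing but balance the inertial term: no further pressure gradient acts in
  the momentum equation, which then reduces to \<open>\<partial>\<^sub>t v = \<nu> \<Delta> v\<close>. The total pressure gradient itself cannot
  vanish in general: the swirl \<open>J\<^sub>1 (\<surd>\<lambda> r) e\<^sub>\<theta>\<close> in a disc needs a radial one for its centripetal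
  acceleration.\<close>
definition purely_inertial_pressure ::
    "(real^2) set \<Rightarrow> (real \<Rightarrow> real^2 \<Rightarrow> real^2) \<Rightarrow> (real \<Rightarrow> real^2 \<Rightarrow> real) \<Rightarrow> bool"
  where "purely_inertial_pressure \<Omega> v q \<longleftrightarrow>
    (\<forall>t\<ge>0. \<forall>x\<in>\<Omega>. grad (q t) x + convect (v t) (v t) x = 0)"

end

theory Submission
  imports Defs "HOL-Complex_Analysis.Riemann_Mapping"
begin

text \<open>
  The pressure of a Stokes eigenpair is harmonic, so everything depends on a short list of analytic
  facts about a smooth and possibly unbounded domain of finite area; given those, the proposition is
  vector algebra.  Write \<open>\<lambda>\<close> for the eigenvalue \<open>l\<close> and \<open>\<omega> = \<partial>\<^sub>1 u\<^sub>2 - \<partial>\<^sub>2 u\<^sub>1\<close> for the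
  vorticity.  For a field without divergence the Stokes system is the pair of equations
  \<open>\<partial>\<^sub>1 \<omega> = \<partial>\<^sub>2 p - \<lambda> u\<^sub>2\<close> and \<open>\<partial>\<^sub>2 \<omega> = \<lambda> u\<^sub>1 - \<partial>\<^sub>1 p\<close>.  If \<open>p\<close> is constant, \<open>\<omega>\<close> is
  a multiple of the stream function of \<open>u\<close>: it solves the Helmholtz equation, and its gradient
  vanishes on the boundary because \<open>u\<close> does.  Hence \<open>\<omega>\<close> solves problem (a) and \<open>\<omega> - c\<close> solves problem (b),
  where \<open>c\<close> is the boundary value of \<open>\<omega>\<close>.  Conversely the rotated gradient of a solution of (a) or
  of (b) is a Stokes eigenfield with zero pressure.

  Neumann implies constant (\<open>neumann_iff_constant_pressure\<close>): the Caccioppoli inequality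
  (\<open>caccioppoli\<close>) bounds \<open>\<integral> \<eta>\<^sup>2 \<bar>\<nabla>p\<bar>\<^sup>2\<close> by \<open>C R\<^sup>-\<^sup>2 \<integral> p\<^sup>2\<close> for a cutoff \<open>\<eta>\<close> at scale \<open>R\<close>, and \<open>p\<close> is
  square integrable; letting \<open>R\<close> grow gives \<open>\<nabla>p = 0\<close>.  The same inequality makes the harmonic function
  \<open>\<Delta>\<psi> + \<lambda>\<psi>\<close> of problem (b) constant, and in problem (a) it shows that the second derivatives of \<open>w\<close> are
  square integrable.  It rests on a divergence theorem for fields that are tangential to the boundary
  (\<open>divergence_theorem_tangential\<close>): their flux through the boundary is zero, and so is the integral
  of their divergence.

  The boundary value of \<open>\<omega>\<close> is one and the same constant on the whole boundary
  (\<open>constant_boundary_trace\<close>), although the boundary of an unbounded simply connected domain may have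
  infinitely many components.  Since \<open>\<nabla>\<omega>\<close> vanishes on the boundary, \<open>\<omega>\<close> is constant on the boundary
  of each component of the complement, and it extends by these constants to a continuously
  differentiable function on the plane whose gradient is integrable, by the finite area and the finite
  energy.  The components are unbounded because \<open>\<Omega>\<close> is simply connected, so any two of them meet the
  boundary of every large square; if their constants differed, the integral of the gradient over these
  squares would be bounded below and the gradient would not be integrable.

  The Navier-Stokes equations: for constant pressure \<open>(u \<cdot> \<nabla>)u\<close> is the gradient of
  \<open>\<bar>u\<bar>\<^sup>2 / 2 + \<omega>\<^sup>2 / (2 \<lambda>)\<close>, which is therefore, up to the sign and the time factor, an admissible
  pressure.  Conversely, if the equations hold with some pressure, then \<open>(u \<cdot> \<nabla>)u\<close> is a gradient, so its
  curl \<open>u \<cdot> \<nabla>\<omega>\<close> vanishes, which says that \<open>u\<close> is parallel to \<open>\<nabla>p\<close>, say \<open>u = \<alpha>\<nabla>p\<close>.  As \<open>u\<close> and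
  \<open>\<nabla>p\<close> have no divergence, \<open>\<alpha>\<close> is transported along \<open>\<nabla>p\<close>.  Were \<open>\<nabla>p\<close> transversal to the boundary
  somewhere, the boundary condition \<open>\<alpha> = 0\<close> would spread into \<open>\<Omega>\<close> and make \<open>u\<close>, hence
  \<open>\<nabla>p = \<Delta>u + \<lambda>u\<close>, vanish there, a contradiction (\<open>gradient_convection_neumann\<close>).  So the Neumann
  condition holds and \<open>p\<close> is constant.
\<close>

section \<open>Calculus with partial derivatives\<close>

lemma pd_eqI: "(f has_derivative D) (at x) \<Longrightarrow> pd i f x = D (axis i 1)"
  by (metis pd_def frechet_derivative_at)

lemma has_derivative_cong_open:
  assumes "open S" "x \<in> S" "\<And>y. y \<in> S \<Longrightarrow> f y = g y"
  shows "(f has_derivative D) (at x) \<longleftrightarrow> (g has_derivative D) (at x)"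
  using assms by (metis has_derivative_transform_within_open)

text \<open>Functions that agree near a point have the same derivatives there, so the choice operator behind the partial derivative selects the same one.  With this rule an identity that holds in an open set can be differentiated repeatedly.\<close>

lemma pd_cong:
  assumes "open S" "x \<in> S" "\<And>y. y \<in> S \<Longrightarrow> f y = g y"
  shows "pd i f x = pd i g x"
proof -
  have "(\<lambda>D. (f has_derivative D) (at x)) = (\<lambda>D. (g has_derivative D) (at x))"
    using has_derivative_cong_open[OF assms] by auto
  then show ?thesis by (simp add: pd_def frechet_derivative_def)
qed

lemma differentiable_cong_open:
  assumes "open S" "x \<in> S" "\<And>y. y \<in> S \<Longrightarrow> f y = g y"
  shows "f differentiable (at x) \<longleftrightarrow> g differentiable (at x)"
  unfolding differentiable_def using has_derivative_cong_open[OF assms] by simp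

lemma has_derivative_pd:
  assumes "f differentiable (at x)"
  shows "(f has_derivative (\<lambda>h. \<Sum>i\<in>UNIV. (h $ i) *\<^sub>R pd i f x)) (at x)"
proof -
  let ?D = "frechet_derivative f (at x)"
  have D: "(f has_derivative ?D) (at x)"
    using assms frechet_derivative_works by blast
  then have "linear ?D" by (rule has_derivative_linear)
  have "?D h = (\<Sum>i\<in>UNIV. (h $ i) *\<^sub>R pd i f x)" for h :: "real^2"
  proof -
    have "h = (\<Sum>i\<in>UNIV. (h $ i) *\<^sub>R axis i 1)"
      using basis_expansion[of h] by (simp add: scalar_mult_eq_scaleR)
    then have "?D h = ?D (\<Sum>i\<in>UNIV. (h $ i) *\<^sub>R axis i 1)" by simp
    also have "\<dots> = (\<Sum>i\<in>UNIV. (h $ i) *\<^sub>R pd i f x)"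
      using \<open>linear ?D\<close> by (simp add: linear_sum linear_scale pd_def)
    finally show ?thesis .
  qed
  then have "?D = (\<lambda>h. \<Sum>i\<in>UNIV. (h $ i) *\<^sub>R pd i f x)" by auto
  with D show ?thesis by simp
qed

lemma frechet_derivative_works':
  "f differentiable (at x) \<Longrightarrow> (f has_derivative frechet_derivative f (at x)) (at x)"
  using frechet_derivative_works by blast

lemma pd_const [simp]: "pd i (\<lambda>x. c) x = 0"
  by (rule pd_eqI[THEN trans]) (auto intro: has_derivative_const)

lemma pd_add:
  assumes "f differentiable (at x)" "g differentiable (at x)"
  shows "pd i (\<lambda>x. f x + g x) x = pd i f x + pd i g x"
  by (rule pd_eqI[THEN trans, OF has_derivative_add[OF assms[THEN frechet_derivative_works']]])
    (simp add: pd_def)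

lemma pd_diff:
  assumes "f differentiable (at x)" "g differentiable (at x)"
  shows "pd i (\<lambda>x. f x - g x) x = pd i f x - pd i g x"
  by (rule pd_eqI[THEN trans, OF has_derivative_diff[OF assms[THEN frechet_derivative_works']]])
    (simp add: pd_def)

lemma pd_minus:
  assumes "f differentiable (at x)"
  shows "pd i (\<lambda>x. - f x) x = - pd i f x"
  by (rule pd_eqI[THEN trans, OF has_derivative_minus[OF assms[THEN frechet_derivative_works']]])
    (simp add: pd_def)

lemma pd_mult:
  fixes f g :: "real^2 \<Rightarrow> real"
  assumes "f differentiable (at x)" "g differentiable (at x)"
  shows "pd i (\<lambda>x. f x * g x) x = f x * pd i g x + pd i f x * g x"
  by (rule pd_eqI[THEN trans, OF has_derivative_mult[OF assms[THEN frechet_derivative_works']]])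
    (simp add: pd_def)

lemma pd_cmult:
  fixes f :: "real^2 \<Rightarrow> real"
  assumes "f differentiable (at x)"
  shows "pd i (\<lambda>x. c * f x) x = c * pd i f x"
  by (subst pd_mult) (auto simp: assms)

lemma pd_scaleR:
  assumes "f differentiable (at x)"
  shows "pd i (\<lambda>x. c *\<^sub>R f x) x = c *\<^sub>R pd i f x"
  by (rule pd_eqI[THEN trans, OF has_derivative_scaleR_right[OF assms[THEN frechet_derivative_works']]])
    (simp add: pd_def)

lemma pd_nth:
  fixes f :: "real^2 \<Rightarrow> real^'n"
  assumes "f differentiable (at x)"
  shows "pd i (\<lambda>x. f x $ k) x = pd i f x $ k"
  by (rule pd_eqI[THEN trans,
        OF bounded_linear.has_derivative[OF bounded_linear_vec_nth assms[THEN frechet_derivative_works']]])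
    (simp add: pd_def)

lemma differentiable_nth:
  fixes f :: "real^2 \<Rightarrow> real^'n"
  assumes "f differentiable (at x)"
  shows "(\<lambda>x. f x $ k) differentiable (at x)"
  using bounded_linear.has_derivative[OF bounded_linear_vec_nth assms[THEN frechet_derivative_works']]
  unfolding differentiable_def by blast

lemma differentiable_vec:
  fixes f :: "'n::finite \<Rightarrow> real^2 \<Rightarrow> real"
  assumes "\<And>k. f k differentiable (at x)"
  shows "(\<lambda>x. \<chi> k. f k x) differentiable (at x)"
proof -
  have "((\<lambda>x. \<chi> k. f k x) has_derivative (\<lambda>h. \<chi> k. frechet_derivative (f k) (at x) h)) (at x)"
    unfolding has_derivative_componentwise_within[of "\<lambda>x. \<chi> k. f k x"]
    using frechet_derivative_works'[OF assms]
    by (auto simp: Basis_vec_def inner_axis)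
  then show ?thesis unfolding differentiable_def by blast
qed

lemma pd_vec:
  fixes f :: "'n::finite \<Rightarrow> real^2 \<Rightarrow> real"
  assumes "\<And>k. f k differentiable (at x)"
  shows "pd i (\<lambda>x. \<chi> k. f k x) x = (\<chi> k. pd i (f k) x)"
  using pd_nth[OF differentiable_vec[of f x, OF assms]] by (simp add: vec_eq_iff)

lemma pd_compose:
  fixes f :: "real^2 \<Rightarrow> real"
  assumes "f differentiable (at x)" "(\<phi> has_real_derivative d) (at (f x))"
  shows "pd i (\<lambda>x. \<phi> (f x)) x = d * pd i f x"
    and "(\<lambda>x. \<phi> (f x)) differentiable (at x)"
proof -
  have "((\<lambda>x. \<phi> (f x)) has_derivative (\<lambda>h. d * frechet_derivative f (at x) h)) (at x)"
    using has_derivative_compose[OF frechet_derivative_works'[OF assms(1)], of \<phi> "\<lambda>h. d * h"] assms(2)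
    by (simp add: has_field_derivative_def)
  then show "pd i (\<lambda>x. \<phi> (f x)) x = d * pd i f x" "(\<lambda>x. \<phi> (f x)) differentiable (at x)"
    using pd_eqI pd_def by (metis, metis differentiable_def)
qed

lemma pd_coordinate: "pd i (\<lambda>x. x $ j) x = (if i = j then 1 else 0)"
  by (rule pd_eqI[THEN trans, OF bounded_linear_imp_has_derivative[OF bounded_linear_vec_nth]])
    (simp add: axis_def)

lemma differentiable_coordinate: "(\<lambda>x::real^2. x $ j) differentiable (at x)"
  using bounded_linear_imp_has_derivative[OF bounded_linear_vec_nth] unfolding differentiable_def by blast

section \<open>Continuously differentiable functions\<close>

text \<open>Unlike smoothness up to the boundary, this notion also covers the cutoff functions, which are only once differentiable.\<close>

definition C1_on :: "(real^2) set \<Rightarrow> (real^2 \<Rightarrow> real) \<Rightarrow> bool"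
  where "C1_on U f \<longleftrightarrow> (\<forall>x\<in>U. f differentiable (at x)) \<and> (\<forall>i. continuous_on U (pd i f))"

lemma C1_onD:
  assumes "C1_on U f"
  shows "x \<in> U \<Longrightarrow> f differentiable (at x)" "continuous_on U (pd i f)" "continuous_on U f"
  using assms unfolding C1_on_def
  by (auto intro!: continuous_at_imp_continuous_on differentiable_imp_continuous_within)

lemma C1_onI:
  assumes "\<And>x. x \<in> U \<Longrightarrow> f differentiable (at x)"
    and "\<And>i. continuous_on U (g i)" "\<And>i x. x \<in> U \<Longrightarrow> pd i f x = g i x"
  shows "C1_on U f"
  using assms continuous_on_eq[of U "g i" "pd i f" for i] unfolding C1_on_def by metis

lemma C1_on_subset: "C1_on U f \<Longrightarrow> V \<subseteq> U \<Longrightarrow> C1_on V f"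
  unfolding C1_on_def by (meson continuous_on_subset subsetD)

lemma C1_on_cong:
  assumes "open U" "\<And>x. x \<in> U \<Longrightarrow> f x = g x"
  shows "C1_on U f \<longleftrightarrow> C1_on U g"
proof -
  have "pd i f x = pd i g x" if "x \<in> U" for i x
    using pd_cong[of U x f g i] assms that by blast
  moreover have "f differentiable (at x) \<longleftrightarrow> g differentiable (at x)" if "x \<in> U" for x
    using differentiable_cong_open[of U x f g] assms that by blast
  ultimately show ?thesis
    unfolding C1_on_def by (metis continuous_on_cong)
qed

lemma C1_on_Un:
  assumes "open U" "open V" "C1_on U f" "C1_on V f"
  shows "C1_on (U \<union> V) f"
  using assms unfolding C1_on_def by (auto intro: continuous_on_open_Un)

lemma C1_on_const [simp]: "C1_on U (\<lambda>x. c)"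
  by (rule C1_onI[where g = "\<lambda>i x. 0"]) auto

lemma C1_on_coordinate: "C1_on U (\<lambda>x. x $ j)"
  by (rule C1_onI[where g = "\<lambda>i x. if i = j then 1 else 0"])
    (auto simp: pd_coordinate differentiable_coordinate)

lemma C1_on_add:
  assumes f: "C1_on U f" and g: "C1_on U g"
  shows "C1_on U (\<lambda>x. f x + g x)"
  by (rule C1_onI[where g = "\<lambda>i x. pd i f x + pd i g x"])
    (auto simp: pd_add C1_onD(1)[OF f] C1_onD(1)[OF g]
      intro!: continuous_on_add C1_onD(2)[OF f] C1_onD(2)[OF g])

lemma C1_on_diff:
  assumes f: "C1_on U f" and g: "C1_on U g"
  shows "C1_on U (\<lambda>x. f x - g x)"
  by (rule C1_onI[where g = "\<lambda>i x. pd i f x - pd i g x"])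
    (auto simp: pd_diff C1_onD(1)[OF f] C1_onD(1)[OF g]
      intro!: continuous_on_diff C1_onD(2)[OF f] C1_onD(2)[OF g])

lemma C1_on_mult:
  assumes f: "C1_on U f" and g: "C1_on U g"
  shows "C1_on U (\<lambda>x. f x * g x)"
  by (rule C1_onI[where g = "\<lambda>i x. f x * pd i g x + pd i f x * g x"])
    (auto simp: pd_mult C1_onD(1)[OF f] C1_onD(1)[OF g]
      intro!: continuous_on_add continuous_on_mult C1_onD(2-3)[OF f] C1_onD(2-3)[OF g])

lemma C1_on_sum:
  assumes "finite I" "\<And>i. i \<in> I \<Longrightarrow> C1_on U (f i)"
  shows "C1_on U (\<lambda>x. \<Sum>i\<in>I. f i x)"
  using assms by (induction I rule: finite_induct) (auto intro!: C1_on_add)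

lemma C1_on_compose:
  assumes f: "C1_on U f" and "\<And>x. x \<in> U \<Longrightarrow> (\<phi> has_real_derivative \<phi>' (f x)) (at (f x))"
    and "continuous_on (f ` U) \<phi>'"
  shows "C1_on U (\<lambda>x. \<phi> (f x))"
  by (rule C1_onI[where g = "\<lambda>i x. \<phi>' (f x) * pd i f x"])
    (auto simp: pd_compose[OF C1_onD(1)[OF f] assms(2)]
      intro!: continuous_on_mult C1_onD(2-3)[OF f] continuous_on_compose2[OF assms(3)])

lemma C1_on_power2: "C1_on U f \<Longrightarrow> C1_on U (\<lambda>x. (f x)\<^sup>2)"
  unfolding power2_eq_square by (rule C1_on_mult)

section \<open>Symmetry of the mixed second derivatives\<close>

lemma real_MVT_line:
  fixes f :: "real^2 \<Rightarrow> real"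
  assumes "\<And>t. 0 \<le> t \<Longrightarrow> t \<le> h \<Longrightarrow> f differentiable (at (y + t *\<^sub>R axis i 1))" "h > 0"
  obtains t where "0 < t" "t < h" "f (y + h *\<^sub>R axis i 1) - f y = h * pd i f (y + t *\<^sub>R axis i 1)"
proof -
  have "((\<lambda>t. f (y + t *\<^sub>R axis i 1)) has_real_derivative pd i f (y + t *\<^sub>R axis i 1)) (at t)"
    if "0 \<le> t" "t \<le> h" for t
  proof -
    let ?p = "y + t *\<^sub>R axis i 1"
    have "((\<lambda>t. y + t *\<^sub>R axis i (1::real)) has_derivative (\<lambda>s. s *\<^sub>R axis i 1)) (at t)"
      by (auto intro!: derivative_eq_intros)
    from has_derivative_compose[OF this frechet_derivative_works'[OF assms(1)[OF that]]]
    have "((\<lambda>t. f (y + t *\<^sub>R axis i 1)) has_derivative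
        (\<lambda>s. frechet_derivative f (at ?p) (s *\<^sub>R axis i 1))) (at t)" .
    moreover have "linear (frechet_derivative f (at ?p))"
      using frechet_derivative_works'[OF assms(1)[OF that]] has_derivative_linear by blast
    ultimately show ?thesis
      by (simp add: has_field_derivative_def linear_scale pd_def mult.commute[of _ "frechet_derivative f (at ?p) (axis i 1)"])
  qed
  from MVT2[of 0 h, OF \<open>h > 0\<close> this] that show thesis by auto
qed

text \<open>Both mixed derivatives are limits of the second difference of \<open>f\<close> over a small square: applying the mean value theorem once in each direction, in either order, exhibits this difference, divided by the area of the square, as a value of each of them near \<open>x\<close>.\<close>

lemma pd_commute:
  fixes f :: "real^2 \<Rightarrow> real"
  assumes "open U" "x \<in> U" "C1_on U f" "C1_on U (pd i f)" "C1_on U (pd j f)"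
  shows "pd i (pd j f) x = pd j (pd i f) x"
proof -
  \<comment> \<open>the second difference is taken over a square with sides \<open>e / 2\<close>, which lies in the disc of radius \<open>e\<close>\<close>
  have key: "\<exists>p\<in>cball x e. \<exists>q\<in>cball x e. pd i (pd j f) p = pd j (pd i f) q" if "e > 0" "cball x e \<subseteq> U" for e
  proof -
    define h where "h = e / 2"
    have h: "h > 0" using that by (simp add: h_def)
    have inU: "x + s *\<^sub>R axis i 1 + t *\<^sub>R axis j 1 \<in> cball x e" if "0 \<le> s" "s \<le> h" "0 \<le> t" "t \<le> h" for s t i j
    proof -
      have "norm (s *\<^sub>R axis i 1 + t *\<^sub>R axis j (1::real)) \<le> s + t"
        using norm_triangle_ineq[of "s *\<^sub>R axis i 1" "t *\<^sub>R axis j (1::real)"] that by simp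
      also have "\<dots> \<le> e" using that by (simp add: h_def)
      finally show ?thesis by (subst mem_cball, subst dist_commute) (simp add: dist_norm add.assoc)
    qed
    have *: "\<exists>p\<in>cball x e. f (x + h *\<^sub>R axis i 1 + h *\<^sub>R axis j 1) - f (x + h *\<^sub>R axis i 1)
        - f (x + h *\<^sub>R axis j 1) + f x = h * h * pd j (pd i f) p"
      if fi: "C1_on U f" "C1_on U (pd i f)" for i j
    proof -
      let ?g = "\<lambda>y. f (y + h *\<^sub>R axis j 1) - f y"
      have sh: "((\<lambda>y. y + h *\<^sub>R axis j 1) has_derivative (\<lambda>k. k)) (at y)" for y :: "real^2"
        by (auto intro!: derivative_eq_intros)
      have D: "((\<lambda>y. f (y + h *\<^sub>R axis j 1)) has_derivative frechet_derivative f (at (y + h *\<^sub>R axis j 1))) (at y)"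
        if "f differentiable (at (y + h *\<^sub>R axis j 1))" for y
        using has_derivative_compose[OF sh frechet_derivative_works'[OF that]] .
      have fd: "f differentiable (at (x + t *\<^sub>R axis i 1))"
        "f differentiable (at (x + t *\<^sub>R axis i 1 + h *\<^sub>R axis j 1))" if "0 \<le> t" "t \<le> h" for t
        using C1_onD(1)[OF fi(1)] inU[of t 0 i j] inU[of t h i j] that h \<open>cball x e \<subseteq> U\<close> by auto
      have gd: "?g differentiable (at (x + t *\<^sub>R axis i 1))"
        "pd i ?g (x + t *\<^sub>R axis i 1) = pd i f (x + t *\<^sub>R axis i 1 + h *\<^sub>R axis j 1) - pd i f (x + t *\<^sub>R axis i 1)"
        if "0 \<le> t" "t \<le> h" for t
      proof -
        note DD = has_derivative_diff[OF D[OF fd(2)[OF that]] frechet_derivative_works'[OF fd(1)[OF that]]]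
        show "?g differentiable (at (x + t *\<^sub>R axis i 1))"
          using DD unfolding differentiable_def by blast
        show "pd i ?g (x + t *\<^sub>R axis i 1) = pd i f (x + t *\<^sub>R axis i 1 + h *\<^sub>R axis j 1) - pd i f (x + t *\<^sub>R axis i 1)"
          using pd_eqI[OF DD, of i] by (simp add: pd_def)
      qed
      obtain t where t: "0 < t" "t < h" "?g (x + h *\<^sub>R axis i 1) - ?g x = h * pd i ?g (x + t *\<^sub>R axis i 1)"
        by (rule real_MVT_line[of h ?g x i]) (use gd h in auto)
      have "pd i f differentiable (at (x + t *\<^sub>R axis i 1 + s *\<^sub>R axis j 1))" if "0 \<le> s" "s \<le> h" for s
        using C1_onD(1)[OF fi(2)] inU[of t s i j] t that \<open>cball x e \<subseteq> U\<close> by auto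
      then obtain s where s: "0 < s" "s < h" "pd i f (x + t *\<^sub>R axis i 1 + h *\<^sub>R axis j 1) - pd i f (x + t *\<^sub>R axis i 1)
          = h * pd j (pd i f) (x + t *\<^sub>R axis i 1 + s *\<^sub>R axis j 1)"
        using real_MVT_line[of h "pd i f" "x + t *\<^sub>R axis i 1" j] h by blast
      show ?thesis
        using t s gd(2)[of t] inU[of t s i j]
        by (intro bexI[of _ "x + t *\<^sub>R axis i 1 + s *\<^sub>R axis j 1"]) (auto simp: algebra_simps)
    qed
    obtain p q where "p \<in> cball x e" "q \<in> cball x e" and
      p: "f (x + h *\<^sub>R axis i 1 + h *\<^sub>R axis j 1) - f (x + h *\<^sub>R axis i 1)
        - f (x + h *\<^sub>R axis j 1) + f x = h * h * pd j (pd i f) p" and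
      q: "f (x + h *\<^sub>R axis j 1 + h *\<^sub>R axis i 1) - f (x + h *\<^sub>R axis j 1)
        - f (x + h *\<^sub>R axis i 1) + f x = h * h * pd i (pd j f) q"
      using *[OF assms(3,4), of j] *[OF assms(3,5), of i] by blast
    have "h * h * pd j (pd i f) p = h * h * pd i (pd j f) q"
      using p q by (simp add: algebra_simps)
    with h \<open>p \<in> _\<close> \<open>q \<in> _\<close> show ?thesis by (intro bexI[of _ q] bexI[of _ p]) auto
  qed
  obtain r where r: "r > 0" "cball x r \<subseteq> U" using assms(1,2) open_contains_cball by blast
  define e where "e n = r / Suc n" for n
  have e: "e n > 0" "e n \<le> r" for n using r by (auto simp: e_def field_simps)
  have "\<exists>p q. p \<in> cball x (e n) \<and> q \<in> cball x (e n) \<and> pd i (pd j f) p = pd j (pd i f) q" for n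
    using key[OF e(1)[of n]] e(2)[of n] r(2) by (meson cball_subset_cball_iff subset_cball subset_trans)
  then obtain p q where pq: "\<And>n. p n \<in> cball x (e n)" "\<And>n. q n \<in> cball x (e n)"
    "\<And>n. pd i (pd j f) (p n) = pd j (pd i f) (q n)" by metis
  have e0: "e \<longlonglongrightarrow> 0"
    using LIMSEQ_Suc[OF lim_const_over_n[of r]] by (simp add: e_def[abs_def])
  have lim: "z \<longlonglongrightarrow> x" if "\<And>n. z n \<in> cball x (e n)" for z
    using that by (intro metric_tendsto_imp_tendsto[OF e0]) (auto simp: dist_commute e(1) less_imp_le)
  have "(\<lambda>n. pd i (pd j f) (p n)) \<longlonglongrightarrow> pd i (pd j f) x"
    using assms(1,2) C1_onD(2)[OF assms(5), of i] lim[OF pq(1)] continuous_on_eq_continuous_at isCont_tendsto_compose by blast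
  moreover have "(\<lambda>n. pd j (pd i f) (q n)) \<longlonglongrightarrow> pd j (pd i f) x"
    using assms(1,2) C1_onD(2)[OF assms(4), of j] lim[OF pq(2)] continuous_on_eq_continuous_at isCont_tendsto_compose by blast
  ultimately show ?thesis using pq(3) LIMSEQ_unique by auto
qed

section \<open>Functions that are smooth up to the boundary\<close>

definition has_extension :: "(real^2) set \<Rightarrow> (real^2 \<Rightarrow> 'b::real_normed_vector) \<Rightarrow> bool"
  where "has_extension \<Omega> f \<longleftrightarrow> (\<exists>g. continuous_on (closure \<Omega>) g \<and> (\<forall>x\<in>\<Omega>. g x = f x))"

text \<open>Boundary values are values of this function.  It depends only on the values of \<open>f\<close> inside \<open>\<Omega>\<close>, and on the closure of an open set it is unique.\<close>

definition extension :: "(real^2) set \<Rightarrow> (real^2 \<Rightarrow> 'b::real_normed_vector) \<Rightarrow> real^2 \<Rightarrow> 'b"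
  where "extension \<Omega> f = (SOME g. continuous_on (closure \<Omega>) g \<and> (\<forall>x\<in>\<Omega>. g x = f x))"

lemma extension:
  assumes "has_extension \<Omega> f"
  shows "continuous_on (closure \<Omega>) (extension \<Omega> f)" "x \<in> \<Omega> \<Longrightarrow> extension \<Omega> f x = f x"
  using someI_ex[OF assms[unfolded has_extension_def]] unfolding extension_def by auto

lemma frontier_open_limit:
  fixes \<Omega> :: "(real^2) set"
  assumes "open \<Omega>" "x \<in> frontier \<Omega>"
  shows "x \<notin> \<Omega>" "x \<in> closure \<Omega>" "at x within \<Omega> \<noteq> bot"
  using assms frontier_disjoint_eq[of \<Omega>]
  by (auto simp: frontier_def interior_open closure_def trivial_limit_within)

lemma has_trace_extension:
  assumes "has_extension \<Omega> f" "x \<in> closure \<Omega>"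
  shows "has_trace \<Omega> f x (extension \<Omega> f x)"
proof -
  have "(extension \<Omega> f \<longlongrightarrow> extension \<Omega> f x) (at x within \<Omega>)"
    using extension(1)[OF assms(1)] assms(2) closure_subset
    by (meson continuous_on_def tendsto_within_subset)
  then show ?thesis unfolding has_trace_def
    by (rule Lim_transform_eventually)
      (auto simp: eventually_at_filter extension(2)[OF assms(1)])
qed

lemma has_trace_unique:
  assumes "open \<Omega>" "x \<in> frontier \<Omega>" "has_trace \<Omega> f x a" "has_trace \<Omega> f x b"
  shows "a = b"
  using assms tendsto_unique frontier_open_limit(3) unfolding has_trace_def by blast

lemma has_trace_iff_extension:
  assumes "open \<Omega>" "has_extension \<Omega> f" "x \<in> frontier \<Omega>"
  shows "has_trace \<Omega> f x a \<longleftrightarrow> extension \<Omega> f x = a"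
  using has_trace_unique[OF assms(1,3)] has_trace_extension[OF assms(2)] frontier_open_limit(2)[OF assms(1,3)]
  by blast

lemma has_extension_cong:
  assumes "\<And>x. x \<in> \<Omega> \<Longrightarrow> f x = g x"
  shows "has_extension \<Omega> f \<longleftrightarrow> has_extension \<Omega> g"
  using assms unfolding has_extension_def by simp

lemma has_extension_congI:
  assumes "has_extension \<Omega> g" "\<And>x. x \<in> \<Omega> \<Longrightarrow> f x = g x"
  shows "has_extension \<Omega> f"
  using has_extension_cong[of \<Omega> f g] assms by simp

lemma differentiable_congI:
  assumes "open S" "x \<in> S" "g differentiable (at x)" "\<And>y. y \<in> S \<Longrightarrow> f y = g y"
  shows "f differentiable (at x)"
  using differentiable_cong_open[of S x f g] assms by simp

lemma has_extension_const: "has_extension \<Omega> (\<lambda>x. c)"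
  unfolding has_extension_def by (auto intro!: exI[of _ "\<lambda>x. c"])

lemma has_extension_add:
  assumes "has_extension \<Omega> f" "has_extension \<Omega> g"
  shows "has_extension \<Omega> (\<lambda>x. f x + g x)"
proof -
  obtain f' g' where "continuous_on (closure \<Omega>) f'" "\<forall>x\<in>\<Omega>. f' x = f x"
    "continuous_on (closure \<Omega>) g'" "\<forall>x\<in>\<Omega>. g' x = g x"
    using assms unfolding has_extension_def by blast
  then show ?thesis
    unfolding has_extension_def by (intro exI[of _ "\<lambda>x. f' x + g' x"]) (auto intro!: continuous_intros)
qed

lemma has_extension_mult:
  fixes f g :: "real^2 \<Rightarrow> real"
  assumes "has_extension \<Omega> f" "has_extension \<Omega> g"
  shows "has_extension \<Omega> (\<lambda>x. f x * g x)"
proof -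
  obtain f' g' where "continuous_on (closure \<Omega>) f'" "\<forall>x\<in>\<Omega>. f' x = f x"
    "continuous_on (closure \<Omega>) g'" "\<forall>x\<in>\<Omega>. g' x = g x"
    using assms unfolding has_extension_def by blast
  then show ?thesis
    unfolding has_extension_def by (intro exI[of _ "\<lambda>x. f' x * g' x"]) (auto intro!: continuous_intros)
qed

lemma pds_Nil [simp]: "pds [] f = f"
  by (simp add: pds_def)

lemma pds_Cons: "pds (i # is) f = pd i (pds is f)"
  by (simp add: pds_def)

lemma pds_snoc: "pds (is @ [i]) f = pds is (pd i f)"
  by (simp add: pds_def)

lemma pds_cong:
  assumes "open U" "\<And>y. y \<in> U \<Longrightarrow> f y = g y" "x \<in> U"
  shows "pds is f x = pds is g x"
  using assms(3)
proof (induction "is" arbitrary: x)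
  case Nil then show ?case using assms(2) by simp
next
  case (Cons i "is")
  then show ?case unfolding pds_Cons by (intro pd_cong[OF assms(1)])
qed

abbreviation "sub \<equiv> smooth_up_to_boundary"

lemma sub_iff:
  "sub \<Omega> f \<longleftrightarrow> (\<forall>is. (\<forall>x\<in>\<Omega>. pds is f differentiable (at x)) \<and> has_extension \<Omega> (pds is f))"
  unfolding smooth_up_to_boundary_def smooth_on_def has_extension_def by blast

lemma sub_pd: "sub \<Omega> f \<Longrightarrow> sub \<Omega> (pd i f)"
  unfolding sub_iff by (metis pds_snoc)

lemma sub_differentiable: "sub \<Omega> f \<Longrightarrow> x \<in> \<Omega> \<Longrightarrow> f differentiable (at x)"
  unfolding sub_iff by (metis pds_Nil)

lemma sub_extension: "sub \<Omega> f \<Longrightarrow> has_extension \<Omega> f"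
  unfolding sub_iff by (metis pds_Nil)

lemma sub_continuous: "sub \<Omega> f \<Longrightarrow> continuous_on \<Omega> f"
  by (auto intro!: continuous_at_imp_continuous_on differentiable_imp_continuous_within sub_differentiable)

lemma sub_C1_on: "sub \<Omega> f \<Longrightarrow> C1_on \<Omega> f"
  unfolding C1_on_def by (auto intro: sub_differentiable sub_continuous sub_pd)

text \<open>Iterated derivatives are taken inside the open set, so that an identity of derivatives in \<open>\<Omega>\<close> can be differentiated again.\<close>

lemma pds_add:
  assumes "open \<Omega>" "sub \<Omega> f" "sub \<Omega> g" "x \<in> \<Omega>"
  shows "pds is (\<lambda>x. f x + g x) x = pds is f x + pds is g x"
  using assms(4)
proof (induction "is" arbitrary: x)
  case Nil then show ?case by simp
next
  case (Cons i "is")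
  have "pds (i # is) (\<lambda>x. f x + g x) x = pd i (\<lambda>x. pds is f x + pds is g x) x"
    unfolding pds_Cons using Cons by (intro pd_cong[OF assms(1)])
  also have "\<dots> = pds (i # is) f x + pds (i # is) g x"
    unfolding pds_Cons using assms(2,3) Cons.prems by (intro pd_add) (auto simp: sub_iff)
  finally show ?case .
qed

lemma sub_add:
  assumes "open \<Omega>" "sub \<Omega> f" "sub \<Omega> g"
  shows "sub \<Omega> (\<lambda>x. f x + g x)"
  unfolding sub_iff
proof (intro allI conjI ballI)
  fix "is" x assume "x \<in> \<Omega>"
  show "pds is (\<lambda>x. f x + g x) differentiable (at x)"
    by (rule differentiable_congI[OF assms(1) \<open>x \<in> \<Omega>\<close> _ pds_add[OF assms]])
      (use assms(2,3) \<open>x \<in> \<Omega>\<close> in \<open>auto simp: sub_iff\<close>)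
next
  fix "is"
  show "has_extension \<Omega> (pds is (\<lambda>x. f x + g x))"
    by (rule has_extension_congI[OF _ pds_add[OF assms]])
      (use assms(2,3) in \<open>auto simp: sub_iff intro: has_extension_add\<close>)
qed

lemma pds_const: "pds is (\<lambda>x. c) = (if is = [] then (\<lambda>x. c) else (\<lambda>x. 0))"
proof (induction "is")
  case (Cons i "is")
  have "pd i (\<lambda>x. b) = (\<lambda>x. 0)" for b :: 'a by auto
  then show ?case using Cons by (auto simp: pds_Cons)
qed simp

lemma sub_const: "sub \<Omega> (\<lambda>x. c)"
  unfolding sub_iff by (auto simp: pds_const has_extension_const)

text \<open>Induction on the number of derivatives, for all pairs of functions at once: the innermost derivative of a product is a sum of two products of functions of the same kind.\<close>

lemma sub_mult:
  fixes f g :: "real^2 \<Rightarrow> real"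
  assumes "open \<Omega>" "sub \<Omega> f" "sub \<Omega> g"
  shows "sub \<Omega> (\<lambda>x. f x * g x)"
proof -
  define Q where "Q is f \<longleftrightarrow> (\<forall>x\<in>\<Omega>. pds is f differentiable (at x)) \<and> has_extension \<Omega> (pds is f)" for "is" and f :: "real^2 \<Rightarrow> real"
  have Q_cong: "Q is f" if "\<And>x. x \<in> \<Omega> \<Longrightarrow> f x = g x" "Q is g" for "is" f g
  proof -
    have eq: "\<And>x. x \<in> \<Omega> \<Longrightarrow> pds is f x = pds is g x"
      using pds_cong[of \<Omega> f g] assms(1) that(1) by blast
    show ?thesis
      using that(2) differentiable_congI[OF assms(1) _ _ eq] has_extension_congI[OF _ eq]
      unfolding Q_def by simp
  qed
  have "\<forall>f g. sub \<Omega> f \<longrightarrow> sub \<Omega> g \<longrightarrow> (\<forall>is. length is \<le> n \<longrightarrow> Q is (\<lambda>x. f x * g x))" for n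
  proof (induction n)
    case 0
    then show ?case
      by (auto simp: Q_def sub_differentiable sub_extension intro!: has_extension_mult)
  next
    case (Suc n)
    show ?case
    proof (intro allI impI)
      fix f g :: "real^2 \<Rightarrow> real" and "is" :: "2 list"
      assume f: "sub \<Omega> f" and g: "sub \<Omega> g" and len: "length is \<le> Suc n"
      show "Q is (\<lambda>x. f x * g x)"
      proof (cases "is" rule: rev_cases)
        case Nil
        with Suc f g show ?thesis by auto
      next
        case (snoc js j)
        have A: "Q js (\<lambda>x. f x * pd j g x)" "Q js (\<lambda>x. pd j f x * g x)"
          using Suc f g sub_pd[OF f, of j] sub_pd[OF g, of j] len snoc by auto
        \<comment> \<open>the sum of the two terms is treated derivative by derivative\<close>
        have B: "pds ks (\<lambda>x. f x * pd j g x + pd j f x * g x) x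
            = pds ks (\<lambda>x. f x * pd j g x) x + pds ks (\<lambda>x. pd j f x * g x) x"
          if "length ks \<le> n" "x \<in> \<Omega>" for ks x
          using that
        proof (induction ks arbitrary: x)
          case (Cons k ks)
          have "Q ks (\<lambda>x. f x * pd j g x)" "Q ks (\<lambda>x. pd j f x * g x)"
            using Suc f g sub_pd[OF f, of j] sub_pd[OF g, of j] Cons by auto
          then show ?case unfolding pds_Cons using Cons
            by (subst pd_cong[OF assms(1) \<open>x \<in> \<Omega>\<close>, OF Cons.IH]) (auto simp: Q_def pd_add)
        qed simp
        have "Q js (\<lambda>x. f x * pd j g x + pd j f x * g x)"
          unfolding Q_def
        proof (intro conjI ballI)
          have B': "\<And>x. x \<in> \<Omega> \<Longrightarrow> pds js (\<lambda>x. f x * pd j g x + pd j f x * g x) x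
            = pds js (\<lambda>x. f x * pd j g x) x + pds js (\<lambda>x. pd j f x * g x) x"
            using B len snoc by simp
          show "pds js (\<lambda>x. f x * pd j g x + pd j f x * g x) differentiable (at x)" if "x \<in> \<Omega>" for x
            by (rule differentiable_congI[OF assms(1) that _ B']) (use A that in \<open>auto simp: Q_def\<close>)
          show "has_extension \<Omega> (pds js (\<lambda>x. f x * pd j g x + pd j f x * g x))"
            by (rule has_extension_congI[OF _ B']) (use A in \<open>auto simp: Q_def intro: has_extension_add\<close>)
        qed
        then have "Q js (pd j (\<lambda>x. f x * g x))"
          by (rule Q_cong[rotated]) (auto simp: pd_mult sub_differentiable[OF f] sub_differentiable[OF g])
        then show ?thesis by (simp add: Q_def snoc pds_snoc)
      qed
    qed
  qed
  then show ?thesis using assms unfolding sub_iff Q_def by blast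
qed

lemma sub_cmult:
  fixes f :: "real^2 \<Rightarrow> real"
  assumes "open \<Omega>" "sub \<Omega> f"
  shows "sub \<Omega> (\<lambda>x. c * f x)"
  by (rule sub_mult[OF assms(1) sub_const assms(2)])

lemma sub_diff:
  fixes f g :: "real^2 \<Rightarrow> real"
  assumes "open \<Omega>" "sub \<Omega> f" "sub \<Omega> g"
  shows "sub \<Omega> (\<lambda>x. f x - g x)"
  using sub_add[OF assms(1,2) sub_cmult[OF assms(1,3), of "-1"]] by simp

lemma pds_nth:
  fixes u :: "real^2 \<Rightarrow> real^'n"
  assumes "open \<Omega>" "sub \<Omega> u" "x \<in> \<Omega>"
  shows "pds is (\<lambda>x. u x $ k) x = pds is u x $ k"
  using assms(3)
proof (induction "is" arbitrary: x)
  case (Cons i "is")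
  then show ?case unfolding pds_Cons using assms(2)
    by (subst pd_cong[OF assms(1) Cons.prems, OF Cons.IH]) (auto simp: pd_nth sub_iff)
qed simp

lemma sub_nth:
  fixes u :: "real^2 \<Rightarrow> real^'n"
  assumes "open \<Omega>" "sub \<Omega> u"
  shows "sub \<Omega> (\<lambda>x. u x $ k)"
  unfolding sub_iff
proof (intro allI conjI ballI)
  fix "is" x assume "x \<in> \<Omega>"
  show "pds is (\<lambda>x. u x $ k) differentiable (at x)"
    by (rule differentiable_congI[OF assms(1) \<open>x \<in> \<Omega>\<close> _ pds_nth[OF assms]])
      (use assms(2) \<open>x \<in> \<Omega>\<close> in \<open>auto simp: sub_iff intro!: differentiable_nth\<close>)
next
  fix "is"
  have "has_extension \<Omega> (pds is u)" using assms(2) by (auto simp: sub_iff)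
  then obtain g where "continuous_on (closure \<Omega>) g" "\<forall>x\<in>\<Omega>. g x = pds is u x"
    unfolding has_extension_def by blast
  then have "has_extension \<Omega> (\<lambda>x. pds is u x $ k)"
    unfolding has_extension_def by (intro exI[of _ "\<lambda>x. g x $ k"]) (auto intro!: continuous_intros)
  then show "has_extension \<Omega> (pds is (\<lambda>x. u x $ k))"
    by (rule has_extension_congI) (rule pds_nth[OF assms])
qed

lemma pds_vec:
  fixes f :: "'n::finite \<Rightarrow> real^2 \<Rightarrow> real"
  assumes "open \<Omega>" "\<And>k. sub \<Omega> (f k)" "x \<in> \<Omega>"
  shows "pds is (\<lambda>x. \<chi> k. f k x) x = (\<chi> k. pds is (f k) x)"
  using assms(3)
proof (induction "is" arbitrary: x)
  case (Cons i "is")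
  then show ?case unfolding pds_Cons using assms(2)
    by (subst pd_cong[OF assms(1) Cons.prems, OF Cons.IH]) (auto simp: pd_vec sub_iff)
qed simp

lemma sub_vec:
  fixes f :: "'n::finite \<Rightarrow> real^2 \<Rightarrow> real"
  assumes "open \<Omega>" "\<And>k. sub \<Omega> (f k)"
  shows "sub \<Omega> (\<lambda>x. \<chi> k. f k x)"
  unfolding sub_iff
proof (intro allI conjI ballI)
  fix "is" x assume "x \<in> \<Omega>"
  show "pds is (\<lambda>x. \<chi> k. f k x) differentiable (at x)"
    by (rule differentiable_congI[OF assms(1) \<open>x \<in> \<Omega>\<close> _ pds_vec[OF assms]])
      (use assms(2) \<open>x \<in> \<Omega>\<close> in \<open>auto simp: sub_iff intro!: differentiable_vec\<close>)
next
  fix "is"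
  have "\<exists>g. continuous_on (closure \<Omega>) g \<and> (\<forall>x\<in>\<Omega>. g x = pds is (f k) x)" for k
    using assms(2) by (auto simp: sub_iff has_extension_def)
  then obtain g where "\<And>k. continuous_on (closure \<Omega>) (g k)" "\<And>k x. x \<in> \<Omega> \<Longrightarrow> g k x = pds is (f k) x"
    by metis
  then have "has_extension \<Omega> (\<lambda>x. \<chi> k. pds is (f k) x)"
    unfolding has_extension_def by (intro exI[of _ "\<lambda>x. \<chi> k. g k x"]) (auto intro!: continuous_on_vec_lambda)
  then show "has_extension \<Omega> (pds is (\<lambda>x. \<chi> k. f k x))"
    by (rule has_extension_congI) (rule pds_vec[OF assms])
qed


section \<open>Continuously differentiable cutoff functions\<close>

definition ramp :: "real \<Rightarrow> real" where "ramp t = (max 0 t)\<^sup>2"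

lemma ramp_deriv: "(ramp has_real_derivative 2 * max 0 t) (at t)"
proof -
  consider "t > 0" | "t < 0" | "t = 0" by linarith
  then show ?thesis
  proof cases
    case 1
    have "((\<lambda>t. t\<^sup>2) has_real_derivative 2 * max 0 t) (at t)"
      using 1 by (auto intro!: derivative_eq_intros)
    then show ?thesis
      by (rule has_field_derivative_transform_within_open[where S = "{0<..}"])
        (use 1 in \<open>auto simp: ramp_def\<close>)
  next
    case 2
    have "((\<lambda>t. 0) has_real_derivative 2 * max 0 t) (at t)"
      using 2 by (auto intro!: derivative_eq_intros)
    then show ?thesis
      by (rule has_field_derivative_transform_within_open[where S = "{..<0}"])
        (use 2 in \<open>auto simp: ramp_def\<close>)
  next
    case 3
    have "((\<lambda>h. (ramp (0 + h) - ramp 0) / h) \<longlongrightarrow> 0) (at 0)"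
    proof (rule Lim_null_comparison[where g = "\<lambda>h. \<bar>h\<bar>"])
      show "\<forall>\<^sub>F h in at 0. norm ((ramp (0 + h) - ramp 0) / h) \<le> \<bar>h\<bar>"
        by (auto simp: ramp_def eventually_at_filter max_def power2_eq_square abs_mult)
    qed (auto intro!: tendsto_eq_intros)
    then show ?thesis using 3 by (simp add: DERIV_def)
  qed
qed

text \<open>A transition from 0 to 1 on the unit interval; the denominator is positive because at most one of the two ramps vanishes at any point.\<close>

definition step :: "real \<Rightarrow> real" where "step t = ramp t / (ramp t + ramp (1 - t))"

text \<open>The derivative of the transition; as a sum of products of nonnegative terms it is visibly nonnegative, which makes the transition monotone.\<close>

definition step' :: "real \<Rightarrow> real" where
  "step' t = (2 * max 0 t * ramp (1 - t) + ramp t * (2 * max 0 (1 - t))) / (ramp t + ramp (1 - t))\<^sup>2"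

lemma ramp_sum_pos: "ramp t + ramp (1 - t) > 0"
  by (auto simp: ramp_def max_def sum_power2_gt_zero_iff)

lemma step_deriv: "(step has_real_derivative step' t) (at t)"
proof -
  have r: "((\<lambda>t. ramp (1 - t)) has_real_derivative - (2 * max 0 (1 - t))) (at t)"
    by (rule DERIV_chain2[of ramp "2 * max 0 (1 - t)" "\<lambda>t. 1 - t" t "-1", simplified])
      (auto intro!: derivative_eq_intros ramp_deriv)
  show ?thesis
    unfolding step_def[abs_def] step'_def
    by (rule derivative_eq_intros ramp_deriv r refl)+
      (use ramp_sum_pos[of t] in \<open>auto simp: power2_eq_square algebra_simps\<close>)
qed

lemma continuous_on_ramp: "continuous_on UNIV ramp"
  unfolding ramp_def[abs_def] by (intro continuous_intros)

lemma continuous_on_step': "continuous_on UNIV step'"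
  unfolding step'_def[abs_def] using ramp_sum_pos
  by (intro continuous_intros continuous_on_compose2[OF continuous_on_ramp]) (auto simp: less_imp_neq[symmetric])

lemma step_eq: "t \<le> 0 \<Longrightarrow> step t = 0" "t \<ge> 1 \<Longrightarrow> step t = 1"
  by (auto simp: step_def ramp_def)

lemma step_bounds: "0 \<le> step t" "step t \<le> 1"
  using ramp_sum_pos[of t] by (auto simp: step_def ramp_def divide_simps)

lemma step'_eq: "t \<le> 0 \<or> t \<ge> 1 \<Longrightarrow> step' t = 0"
  by (auto simp: step'_def ramp_def)

lemma step'_nonneg: "step' t \<ge> 0"
  unfolding step'_def by (intro divide_nonneg_nonneg add_nonneg_nonneg mult_nonneg_nonneg) (auto simp: ramp_def)

lemma step'_bounded: obtains M where "M > 0" "\<And>t. step' t \<le> M"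
proof -
  have "compact (step' ` {0..1})"
    using compact_continuous_image continuous_on_subset[OF continuous_on_step'] by blast
  then obtain M where M: "\<And>t. t \<in> {0..1} \<Longrightarrow> step' t \<le> M"
    using compact_imp_bounded bounded_has_Sup(1) by (metis cSup_upper bounded_imp_bdd_above image_eqI)
  have "step' t \<le> max 1 M" for t
  proof (cases "t \<in> {0..1}")
    case False then show ?thesis using step'_eq[of t] by auto
  qed (use M in \<open>auto simp: le_max_iff_disj\<close>)
  then show thesis using that[of "max 1 M"] by auto
qed

text \<open>Equal to 1 on the disc of radius \<open>r\<close> and to 0 outside the disc of radius \<open>\<surd>2 r\<close>.  The square of the distance is used because it is smooth at the centre.\<close>

definition bump :: "real^2 \<Rightarrow> real \<Rightarrow> real^2 \<Rightarrow> real"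
  where "bump c r x = step (2 - (norm (x - c))\<^sup>2 / r\<^sup>2)"

lemma norm_sq_eq: "(norm x)\<^sup>2 = (\<Sum>i\<in>UNIV. (x $ i)\<^sup>2)" for x :: "real^2"
  by (simp add: norm_vec_def L2_set_def sum_nonneg)

lemma C1_on_dist_sq:
  shows "C1_on U (\<lambda>x. (norm (x - c))\<^sup>2)" "pd i (\<lambda>x. (norm (x - c))\<^sup>2) x = 2 * (x $ i - c $ i)"
proof -
  have eq: "(\<lambda>x. (norm (x - c))\<^sup>2) = (\<lambda>x. \<Sum>i\<in>UNIV. (x $ i - c $ i)\<^sup>2)"
    by (simp add: norm_sq_eq)
  show "C1_on U (\<lambda>x. (norm (x - c))\<^sup>2)"
    unfolding eq by (intro C1_on_sum C1_on_power2 C1_on_diff C1_on_coordinate C1_on_const) auto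
  have "((\<lambda>x. (norm (x - c))\<^sup>2) has_derivative (\<lambda>h. 2 * ((x - c) \<bullet> h))) (at x)"
    unfolding power2_norm_eq_inner by (auto intro!: derivative_eq_intros simp: inner_commute)
  from pd_eqI[OF this, of i] show "pd i (\<lambda>x. (norm (x - c))\<^sup>2) x = 2 * (x $ i - c $ i)"
    by (simp add: inner_axis)
qed

lemma bump_C1:
  shows "C1_on U (bump c r)"
    and "pd i (bump c r) x = - step' (2 - (norm (x - c))\<^sup>2 / r\<^sup>2) * (2 * (x $ i - c $ i) / r\<^sup>2)"
proof -
  let ?f = "\<lambda>x. 2 - (1 / r\<^sup>2) * (norm (x - c))\<^sup>2"
  have eq: "bump c r = (\<lambda>x. step (?f x))" by (simp add: bump_def fun_eq_iff)
  have f: "C1_on UNIV ?f" by (intro C1_on_diff C1_on_mult C1_on_const C1_on_dist_sq)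
  have *: "C1_on UNIV (bump c r)" unfolding eq
    by (rule C1_on_compose[OF f step_deriv]) (rule continuous_on_subset[OF continuous_on_step'], simp)
  then show "C1_on U (bump c r)" by (rule C1_on_subset) simp
  have "pd i (bump c r) x = step' (?f x) * pd i ?f x"
    unfolding eq by (rule pd_compose[OF C1_onD(1)[OF f] step_deriv]) simp
  also have "pd i ?f x = - (1 / r\<^sup>2) * (2 * (x $ i - c $ i))"
  proof -
    have d: "(\<lambda>x. (norm (x - c))\<^sup>2) differentiable (at x)"
      by (rule C1_onD(1)[OF C1_on_dist_sq(1)[of UNIV c]]) simp
    have "(\<lambda>x. 1 / r\<^sup>2 * (norm (x - c))\<^sup>2) differentiable (at x)"
      by (intro differentiable_mult d) simp
    then show ?thesis
      by (subst pd_diff) (auto simp only: pd_cmult[OF d] C1_on_dist_sq(2) pd_const differentiable_const)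
  qed
  finally show "pd i (bump c r) x = - step' (2 - (norm (x - c))\<^sup>2 / r\<^sup>2) * (2 * (x $ i - c $ i) / r\<^sup>2)"
    by simp
qed

lemma bump_bounds: "0 \<le> bump c r x" "bump c r x \<le> 1"
  by (simp_all add: bump_def step_bounds)

lemma bump_eq_1: "r > 0 \<Longrightarrow> dist c x \<le> r \<Longrightarrow> bump c r x = 1"
  unfolding bump_def by (intro step_eq) (simp add: dist_norm norm_minus_commute power_mono divide_le_eq)

lemma bump_eq_0:
  assumes "r > 0" "dist c x \<ge> 2 * r" shows "bump c r x = 0"
proof -
  have "(2 * r)\<^sup>2 \<le> (norm (x - c))\<^sup>2"
    using assms by (intro power_mono) (auto simp: dist_norm norm_minus_commute)
  then have "2 * r\<^sup>2 \<le> (norm (x - c))\<^sup>2"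
    using zero_le_power2[of r] unfolding power_mult_distrib power2_eq_square by linarith
  then have "2 \<le> (norm (x - c))\<^sup>2 / r\<^sup>2"
    using assms(1) by (simp add: le_divide_eq)
  then show ?thesis unfolding bump_def by (intro step_eq) simp
qed

text \<open>The gradient of a cutoff is inversely proportional to its scale, with a constant that does not depend on the centre; this is what makes the error terms vanish as the scale grows.\<close>

lemma pd_bump_bound:
  obtains M where "M > 0" "\<And>c r i x. r > 0 \<Longrightarrow> \<bar>pd i (bump c r) x\<bar> \<le> M / r"
proof -
  obtain M where M: "M > 0" "\<And>t. step' t \<le> M" using step'_bounded by blast
  have "\<bar>pd i (bump c r) x\<bar> \<le> 4 * M / r" if "r > 0" for c r i x
  proof (cases "norm (x - c) \<le> 2 * r")
    case True
    have "\<bar>x $ i - c $ i\<bar> \<le> 2 * r"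
      using component_le_norm_cart[of "x - c" i] True by simp
    then have "step' (2 - (norm (x - c))\<^sup>2 / r\<^sup>2) * (2 * \<bar>x $ i - c $ i\<bar> / r\<^sup>2) \<le> M * (2 * (2 * r) / r\<^sup>2)"
      using M that by (intro mult_mono divide_right_mono mult_left_mono) auto
    moreover have "\<bar>pd i (bump c r) x\<bar> = step' (2 - (norm (x - c))\<^sup>2 / r\<^sup>2) * (2 * \<bar>x $ i - c $ i\<bar> / r\<^sup>2)"
      unfolding bump_C1(2) abs_mult abs_minus_cancel abs_divide using step'_nonneg by simp
    ultimately show ?thesis
      using that by (simp add: power2_eq_square mult.commute)
  next
    case False
    then have "(2 * r)\<^sup>2 \<le> (norm (x - c))\<^sup>2" using that by (intro power_mono) auto
    then have "2 * r\<^sup>2 \<le> (norm (x - c))\<^sup>2"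
      using zero_le_power2[of r] unfolding power_mult_distrib power2_eq_square by linarith
    then have "2 \<le> (norm (x - c))\<^sup>2 / r\<^sup>2"
      using that by (simp add: le_divide_eq)
    then show ?thesis using step'_eq[of "2 - (norm (x - c))\<^sup>2 / r\<^sup>2"] that M by (simp add: bump_C1(2))
  qed
  then show thesis using that[of "4 * M"] M by auto
qed

section \<open>Functions with bounded support on the plane\<close>

text \<open>The tool for extending by zero: a product with a cutoff is differentiable where both factors are, and vanishes on an open set that covers the rest of the plane.\<close>

lemma C1_on_UNIV_patch:
  assumes "open A" "open B" "A \<union> B = UNIV" "C1_on A g"
    and "\<And>x. x \<in> A \<Longrightarrow> f x = g x" "\<And>x. x \<in> B \<Longrightarrow> f x = 0"
  shows "C1_on UNIV f"
proof -
  have "C1_on A f" using C1_on_cong[of A f g] assms by simp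
  moreover have "C1_on B f" using C1_on_cong[of B f "\<lambda>x. 0"] assms by simp
  ultimately show ?thesis using C1_on_Un[of A B f] assms by simp
qed

lemma pd_eq_0_open:
  assumes "open S" "x \<in> S" "\<And>y. y \<in> S \<Longrightarrow> f y = 0"
  shows "pd i f x = 0"
  using pd_cong[of S x f "\<lambda>x. 0" i] assms by simp

lemma integrable_continuous_bounded_support:
  fixes f :: "real^2 \<Rightarrow> real"
  assumes "continuous_on UNIV f" "\<And>x. norm x > R \<Longrightarrow> f x = 0"
  shows "integrable lborel f"
proof -
  have "integrable lborel (\<lambda>x. indicator (cball 0 R) x *\<^sub>R f x)"
    by (rule borel_integrable_compact) (auto intro: continuous_on_subset[OF assms(1)])
  also have "(\<lambda>x. indicator (cball 0 R) x *\<^sub>R f x) = f"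
    using assms(2) by (auto simp: fun_eq_iff indicator_def)
  finally show ?thesis .
qed

text \<open>The integral of \<open>f\<close> does not change under translation, so the difference quotients of \<open>f\<close> have integral zero; they are bounded with bounded support and converge to the derivative.\<close>

lemma integral_pd_zero:
  assumes f: "C1_on UNIV f" and R: "\<And>x. norm x > R \<Longrightarrow> f x = 0"
  shows "integrable lborel (pd i f)" "integral\<^sup>L lborel (pd i f) = 0"
proof -
  have pd0: "pd i f x = 0" if "norm x > R" for x
  proof (rule pd_eq_0_open[where S = "- cball 0 R"])
  qed (use that R in auto)
  have contpd: "continuous_on UNIV (pd i f)" using C1_onD(2)[OF f] .
  show "integrable lborel (pd i f)"
    by (rule integrable_continuous_bounded_support[OF contpd pd0])
  have "bounded (pd i f ` cball 0 R)"
    by (rule compact_imp_bounded[OF compact_continuous_image]) (auto intro: continuous_on_subset[OF contpd])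
  then obtain M where M: "M > 0" "\<And>x. x \<in> cball 0 R \<Longrightarrow> \<bar>pd i f x\<bar> \<le> M"
    by (auto simp: bounded_pos)
  have M': "\<bar>pd i f x\<bar> \<le> M" for x
    using M pd0[of x] by (cases "norm x \<le> R") auto
  have intf: "integrable lborel f"
    by (rule integrable_continuous_bounded_support[OF C1_onD(3)[OF f] R])
  define t where "t n = 1 / real (Suc n)" for n
  have t: "t n > 0" "t n \<le> 1" for n by (auto simp: t_def)
  define e where "e = axis i (1::real)"
  have e: "norm e = 1" by (simp add: e_def)
  define s where "s n x = (f (t n *\<^sub>R e + x) - f x) / t n" for n x
  have shift: "(\<integral>x. f (c + x) \<partial>lborel) = integral\<^sup>L lborel f" "integrable lborel (\<lambda>x. f (c + x))" for c
  proof -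
    have [measurable]: "f \<in> borel_measurable borel" using intf by auto
    show "(\<integral>x. f (c + x) \<partial>lborel) = integral\<^sup>L lborel f"
      by (subst (2) lborel_distr_plus[of c, symmetric]) (simp add: integral_distr)
    show "integrable lborel (\<lambda>x. f (c + x))"
      using intf by (subst (asm) lborel_distr_plus[of c, symmetric]) (simp add: integrable_distr_eq)
  qed
  have int0: "integral\<^sup>L lborel (s n) = 0" for n
    unfolding s_def using intf shift by simp
  have "(\<lambda>n. integral\<^sup>L lborel (s n)) \<longlonglongrightarrow> integral\<^sup>L lborel (pd i f)"
  proof (rule integral_dominated_convergence[where w = "\<lambda>x. M * indicator (cball 0 (R + 1)) x"])
    show "pd i f \<in> borel_measurable lborel"
      using contpd borel_measurable_continuous_onI by auto
    show "s n \<in> borel_measurable lborel" for n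
    proof -
      have "integrable lborel (s n)" unfolding s_def using shift intf by auto
      then show ?thesis by auto
    qed
    show "integrable lborel (\<lambda>x. M * indicator (cball 0 (R + 1)) x :: real)"
      by (intro integrable_mult_right integrable_real_indicator) (use emeasure_bounded_finite[OF bounded_cball] in \<open>auto simp: less_top\<close>)
    show "AE x in lborel. (\<lambda>n. s n x) \<longlonglongrightarrow> pd i f x"
    proof (rule AE_I2)
      fix x
      have ft: "filterlim t (at 0) sequentially"
        using t(1) LIMSEQ_Suc[OF lim_const_over_n[of "1::real"]]
        by (auto simp: filterlim_at t_def[abs_def] intro!: always_eventually)
      have "((\<lambda>r. f (x + r *\<^sub>R e)) has_real_derivative pd i f x) (at 0)"
      proof -
        have "((\<lambda>r. x + r *\<^sub>R e) has_derivative (\<lambda>s. s *\<^sub>R e)) (at 0)"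
          by (auto intro!: derivative_eq_intros)
        moreover have "f differentiable (at (x + 0 *\<^sub>R e))" using C1_onD(1)[OF f] by simp
        ultimately have "((\<lambda>r. f (x + r *\<^sub>R e)) has_derivative
            (\<lambda>s. frechet_derivative f (at (x + 0 *\<^sub>R e)) (s *\<^sub>R e))) (at 0)"
          using has_derivative_compose frechet_derivative_works' by blast
        moreover have "linear (frechet_derivative f (at x))"
          using frechet_derivative_works'[OF C1_onD(1)[OF f]] has_derivative_linear by blast
        ultimately show ?thesis
          by (simp add: has_field_derivative_def linear_scale pd_def e_def mult.commute[of _ "frechet_derivative f (at x) _"])
      qed
      then have "((\<lambda>h. (f (x + h *\<^sub>R e) - f x) / h) \<longlongrightarrow> pd i f x) (at 0)"
        by (simp add: DERIV_def)
      from filterlim_compose[OF this ft] show "(\<lambda>n. s n x) \<longlonglongrightarrow> pd i f x"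
        by (simp add: s_def add.commute)
    qed
    show "AE x in lborel. norm (s n x) \<le> M * indicator (cball 0 (R + 1)) x" for n
    proof (rule AE_I2)
      fix x
      show "norm (s n x) \<le> M * indicator (cball 0 (R + 1)) x"
      proof (cases "norm x \<le> R + 1")
        case True
        obtain \<tau> where "f (x + t n *\<^sub>R e) - f x = t n * pd i f (x + \<tau> *\<^sub>R e)"
          using real_MVT_line[of "t n" f x i] C1_onD(1)[OF f] t(1)[of n] unfolding e_def by blast
        then have "s n x = pd i f (x + \<tau> *\<^sub>R e)" using t(1)[of n] by (simp add: s_def add.commute)
        then show ?thesis using M' True by simp
      next
        case False
        have "norm x - norm (t n *\<^sub>R e) \<le> norm (t n *\<^sub>R e + x)"
          by (metis add.commute norm_diff_ineq)
        moreover have "norm (t n *\<^sub>R e) \<le> 1" using t[of n] e by simp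
        ultimately have "norm (t n *\<^sub>R e + x) > R" "norm x > R" using False by auto
        then show ?thesis using R False by (simp add: s_def)
      qed
    qed
  qed
  with int0 show "integral\<^sup>L lborel (pd i f) = 0"
    using LIMSEQ_unique[OF tendsto_const[of 0]] by simp
qed


section \<open>Defining functions and the outward normal\<close>

lemma defining_functionD:
  assumes "defining_function \<Omega> x U \<rho>"
  shows "open U" "x \<in> U" "C1_on U \<rho>" "y \<in> U \<Longrightarrow> grad \<rho> y \<noteq> 0"
    "y \<in> U \<Longrightarrow> y \<in> \<Omega> \<longleftrightarrow> \<rho> y < 0"
proof -
  note d = assms[unfolded defining_function_def]
  show "open U" "x \<in> U" "y \<in> U \<Longrightarrow> grad \<rho> y \<noteq> 0" "y \<in> U \<Longrightarrow> y \<in> \<Omega> \<longleftrightarrow> \<rho> y < 0"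
    using d by blast+
  have "smooth_on U \<rho>" using d by blast
  then have "\<forall>x\<in>U. pds [] \<rho> differentiable (at x)" "\<forall>x\<in>U. pds [i] \<rho> differentiable (at x)" for i
    unfolding smooth_on_def by blast+
  then have "\<forall>x\<in>U. \<rho> differentiable (at x)" "\<forall>x\<in>U. pd i \<rho> differentiable (at x)" for i
    by (simp_all add: pds_Cons)
  then show "C1_on U \<rho>"
    unfolding C1_on_def
    by (auto intro!: continuous_at_imp_continuous_on differentiable_imp_continuous_within)
qed

lemma defining_function_other_point:
  "defining_function \<Omega> x U \<rho> \<Longrightarrow> y \<in> U \<Longrightarrow> defining_function \<Omega> y U \<rho>"
  unfolding defining_function_def by blast

lemma real_derivative_along_line:
  fixes f :: "real^2 \<Rightarrow> real"
  assumes "f differentiable (at (y + t *\<^sub>R d))"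
  shows "((\<lambda>t. f (y + t *\<^sub>R d)) has_real_derivative grad f (y + t *\<^sub>R d) \<bullet> d) (at t)"
proof -
  have "((\<lambda>t. y + t *\<^sub>R d) has_derivative (\<lambda>s. s *\<^sub>R d)) (at t)"
    by (auto intro!: derivative_eq_intros)
  from has_derivative_compose[OF this has_derivative_pd[OF assms]]
  show ?thesis
    unfolding has_field_derivative_def
    by (rule has_derivative_eq_rhs) (simp add: fun_eq_iff inner_vec_def grad_def sum_distrib_left mult_ac)
qed

text \<open>A boundary point has points of \<open>\<Omega>\<close> arbitrarily near, so the defining function cannot be positive there.\<close>

lemma closure_defining:
  assumes "defining_function \<Omega> x U \<rho>" "y \<in> U" "y \<in> closure \<Omega>"
  shows "\<rho> y \<le> 0"
proof (rule ccontr)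
  note d = defining_functionD[OF assms(1)]
  assume "\<not> \<rho> y \<le> 0"
  have "open (U \<inter> \<rho> -` {0<..})"
    using C1_onD(3)[OF d(3)] continuous_on_open_vimage[OF d(1)] by (metis Int_commute open_greaterThan)
  moreover have "y \<in> U \<inter> \<rho> -` {0<..}" using assms \<open>\<not> \<rho> y \<le> 0\<close> by auto
  ultimately obtain z where "z \<in> \<Omega>" "z \<in> U \<inter> \<rho> -` {0<..}"
    using assms(3) by (meson open_Int_closure_eq_empty disjoint_iff)
  then show False using d(5)[of z] by auto
qed

lemma frontier_defining:
  assumes "open \<Omega>" "defining_function \<Omega> x U \<rho>" "y \<in> U" "y \<in> frontier \<Omega>"
  shows "\<rho> y = 0"
proof -
  have "y \<notin> \<Omega>" "y \<in> closure \<Omega>" using frontier_open_limit[OF assms(1,4)] by auto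
  then show ?thesis
    using closure_defining[OF assms(2,3)] defining_functionD(5)[OF assms(2,3)] by auto
qed

text \<open>A direction that makes an obtuse angle with the gradient of a defining function enters
  \<open>\<Omega>\<close>, and one that makes an acute angle leaves it.  This makes the normal independent of the
  defining function.\<close>

lemma direction_enters:
  assumes "open \<Omega>" "defining_function \<Omega> x U \<rho>" "x \<in> frontier \<Omega>"
  shows "grad \<rho> x \<bullet> d < 0 \<Longrightarrow> \<forall>\<^sub>F t in at_right 0. x + t *\<^sub>R d \<in> \<Omega>"
    and "grad \<rho> x \<bullet> d > 0 \<Longrightarrow> \<forall>\<^sub>F t in at_right 0. x + t *\<^sub>R d \<notin> \<Omega>"
proof -
  note df = defining_functionD[OF assms(2)]
  have D: "((\<lambda>t. \<rho> (x + t *\<^sub>R d)) has_real_derivative grad \<rho> x \<bullet> d) (at 0)"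
    using real_derivative_along_line[of \<rho> x 0 d] C1_onD(1)[OF df(3,2)] by simp
  have "((\<lambda>t. x + t *\<^sub>R d) \<longlongrightarrow> x + 0 *\<^sub>R d) (at_right 0)" by (intro tendsto_intros)
  then have U: "\<forall>\<^sub>F t in at_right 0. x + t *\<^sub>R d \<in> U"
    using topological_tendstoD df(1,2) by fastforce
  have \<rho>0: "\<rho> x = 0" using frontier_defining[OF assms(1,2) df(2) assms(3)] .
  show "\<forall>\<^sub>F t in at_right 0. x + t *\<^sub>R d \<in> \<Omega>" if neg: "grad \<rho> x \<bullet> d < 0"
  proof -
    obtain e where "e > 0" "\<forall>h>0. h < e \<longrightarrow> \<rho> (x + (0 + h) *\<^sub>R d) < \<rho> (x + 0 *\<^sub>R d)"
      using DERIV_neg_dec_right[OF D neg] by auto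
    then have "\<forall>\<^sub>F t in at_right 0. \<rho> (x + t *\<^sub>R d) < 0"
      by (auto simp: eventually_at_right \<rho>0)
    with U show ?thesis by eventually_elim (simp add: df(5))
  qed
  show "\<forall>\<^sub>F t in at_right 0. x + t *\<^sub>R d \<notin> \<Omega>" if pos: "grad \<rho> x \<bullet> d > 0"
  proof -
    obtain e where "e > 0" "\<forall>h>0. h < e \<longrightarrow> \<rho> (x + (0 + h) *\<^sub>R d) > \<rho> (x + 0 *\<^sub>R d)"
      using DERIV_pos_inc_right[OF D pos] by auto
    then have "\<forall>\<^sub>F t in at_right 0. \<rho> (x + t *\<^sub>R d) > 0"
      by (auto simp: eventually_at_right \<rho>0)
    with U show ?thesis by eventually_elim (simp add: df(5))
  qed
qed

text \<open>Used to show that two defining functions cannot have different normals: a direction between them would both enter and leave the domain.\<close>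

lemma unit_vectors_separated:
  fixes m n :: "'a::real_inner"
  assumes "norm m = 1" "norm n = 1" "m \<noteq> n"
  obtains d where "m \<bullet> d < 0" "n \<bullet> d > 0"
proof -
  have "m \<bullet> n < 1"
  proof -
    have "0 < (m - n) \<bullet> (m - n)" using assms(3) by simp
    then show ?thesis using assms(1,2) by (simp add: inner_diff_left inner_diff_right inner_commute norm_eq_1)
  qed
  then show thesis
    using that[of "n - m"] assms(1,2) by (simp add: inner_diff_right inner_commute norm_eq_1)
qed

lemma outward_normal_eq:
  assumes "open \<Omega>" "defining_function \<Omega> x U \<rho>" "x \<in> frontier \<Omega>"
  shows "outward_normal \<Omega> x = grad \<rho> x /\<^sub>R norm (grad \<rho> x)"
  unfolding outward_normal_def
proof (rule the_equality)
  show "\<exists>U' \<rho>'. defining_function \<Omega> x U' \<rho>' \<and> grad \<rho> x /\<^sub>R norm (grad \<rho> x) = grad \<rho>' x /\<^sub>R norm (grad \<rho>' x)"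
    using assms(2) by blast
next
  fix n assume "\<exists>U \<rho>. defining_function \<Omega> x U \<rho> \<and> n = grad \<rho> x /\<^sub>R norm (grad \<rho> x)"
  then obtain U' \<rho>' where d': "defining_function \<Omega> x U' \<rho>'" "n = grad \<rho>' x /\<^sub>R norm (grad \<rho>' x)" by blast
  let ?m = "grad \<rho> x /\<^sub>R norm (grad \<rho> x)"
  have g: "grad \<rho> x \<noteq> 0" "grad \<rho>' x \<noteq> 0"
    using assms(2) d'(1) defining_functionD by blast+
  show "n = ?m"
  proof (rule ccontr)
    assume "n \<noteq> ?m"
    moreover have "norm n = 1" "norm ?m = 1" using g d'(2) by auto
    ultimately obtain d where "n \<bullet> d < 0" "?m \<bullet> d > 0" using unit_vectors_separated by blast
    then have "grad \<rho>' x \<bullet> d < 0" "grad \<rho> x \<bullet> d > 0"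
      using g d'(2) by (auto simp: mult_less_0_iff zero_less_mult_iff)
    then have "\<forall>\<^sub>F t in at_right 0. x + t *\<^sub>R d \<in> \<Omega>" "\<forall>\<^sub>F t in at_right 0. x + t *\<^sub>R d \<notin> \<Omega>"
      using direction_enters[OF assms(1) d'(1) assms(3)] direction_enters[OF assms] by blast+
    then have "\<forall>\<^sub>F t in at_right (0::real). False" by eventually_elim simp
    then show False by simp
  qed
qed

lemma extension_eqI:
  assumes "open \<Omega>" "continuous_on (closure \<Omega>) g" "\<And>y. y \<in> \<Omega> \<Longrightarrow> g y = f y" "x \<in> closure \<Omega>"
  shows "extension \<Omega> f x = g x"
proof -
  have h: "has_extension \<Omega> f" using assms(2,3) unfolding has_extension_def by blast
  show ?thesis
  proof (cases "x \<in> \<Omega>")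
    case True then show ?thesis using extension(2)[OF h] assms(3) by simp
  next
    case False
    then have x: "x \<in> frontier \<Omega>" using assms(1,4) by (simp add: frontier_def interior_open)
    have "(g \<longlongrightarrow> g x) (at x within \<Omega>)"
      using assms(2,4) closure_subset by (meson continuous_on_def tendsto_within_subset)
    then have "has_trace \<Omega> f x (g x)" unfolding has_trace_def
      by (rule Lim_transform_eventually) (auto simp: eventually_at_filter assms(3))
    then show ?thesis using has_trace_iff_extension[OF assms(1) h x] by simp
  qed
qed

lemma extension_mult:
  fixes f g :: "real^2 \<Rightarrow> real"
  assumes "open \<Omega>" "has_extension \<Omega> f" "has_extension \<Omega> g" "x \<in> closure \<Omega>"
  shows "extension \<Omega> (\<lambda>x. f x * g x) x = extension \<Omega> f x * extension \<Omega> g x"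
  by (rule extension_eqI[OF assms(1) _ _ assms(4)])
    (auto intro!: continuous_intros extension[OF assms(2)] extension[OF assms(3)]
      simp: extension(2)[OF assms(2)] extension(2)[OF assms(3)])

lemma has_extension_continuous: "continuous_on UNIV f \<Longrightarrow> has_extension \<Omega> f"
  unfolding has_extension_def by (auto intro!: exI[of _ f] elim: continuous_on_subset)

lemma extension_bounded_on_ball:
  fixes f :: "real^2 \<Rightarrow> real"
  assumes "has_extension \<Omega> f"
  obtains M where "M > 0" "\<And>x. x \<in> closure \<Omega> \<Longrightarrow> norm x \<le> R \<Longrightarrow> \<bar>extension \<Omega> f x\<bar> \<le> M"
proof -
  have "bounded (extension \<Omega> f ` (closure \<Omega> \<inter> cball 0 R))"
    by (intro compact_imp_bounded compact_continuous_image closed_Int_compact)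
      (auto intro: continuous_on_subset[OF extension(1)[OF assms]])
  then obtain M where "M > 0" "\<And>x. x \<in> closure \<Omega> \<inter> cball 0 R \<Longrightarrow> \<bar>extension \<Omega> f x\<bar> \<le> M"
    unfolding bounded_pos by auto
  then show thesis using that by auto
qed

section \<open>The divergence theorem for tangential fields\<close>

definition divergence :: "(2 \<Rightarrow> real^2 \<Rightarrow> real) \<Rightarrow> real^2 \<Rightarrow> real"
  where "divergence F x = (\<Sum>i\<in>UNIV. pd i (F i) x)"

text \<open>A field is a pair of scalar components.  The last two conditions, bounded support and bounded divergence, make the divergence integrable over \<open>\<Omega>\<close> even if \<open>\<Omega>\<close> is unbounded.\<close>

definition tangential_field :: "(real^2) set \<Rightarrow> (2 \<Rightarrow> real^2 \<Rightarrow> real) \<Rightarrow> bool"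
  where "tangential_field \<Omega> F \<longleftrightarrow>
    (\<forall>i. C1_on \<Omega> (F i) \<and> has_extension \<Omega> (F i)) \<and>
    (\<forall>x\<in>frontier \<Omega>. (\<Sum>i\<in>UNIV. extension \<Omega> (F i) x * outward_normal \<Omega> x $ i) = 0) \<and>
    (\<exists>R. \<forall>x\<in>\<Omega>. norm x > R \<longrightarrow> (\<forall>i. F i x = 0)) \<and>
    (\<exists>M. \<forall>x\<in>\<Omega>. \<bar>divergence F x\<bar> \<le> M)"

lemma tangential_field_integrable:
  assumes "open \<Omega>" "tangential_field \<Omega> F"
  shows "set_integrable lborel \<Omega> (divergence F)"
proof -
  obtain R M where R: "\<And>x i. x \<in> \<Omega> \<Longrightarrow> norm x > R \<Longrightarrow> F i x = 0"
    and M: "\<And>x. x \<in> \<Omega> \<Longrightarrow> \<bar>divergence F x\<bar> \<le> M"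
    using assms(2) unfolding tangential_field_def by blast
  have z: "divergence F x = 0" if "x \<in> \<Omega>" "norm x > R" for x
  proof -
    have "pd i (F i) x = 0" for i
      by (rule pd_eq_0_open[where S = "\<Omega> \<inter> - cball 0 R"]) (use assms(1) that R in auto)
    then show ?thesis by (simp add: divergence_def)
  qed
  have "continuous_on \<Omega> (divergence F)"
    using assms(2) unfolding tangential_field_def divergence_def[abs_def]
    by (auto intro!: continuous_on_sum C1_onD(2))
  then have m: "(\<lambda>x. indicator \<Omega> x *\<^sub>R divergence F x) \<in> borel_measurable lborel"
    using borel_measurable_continuous_on_indicator[of \<Omega> "divergence F"] assms(1) by auto
  show ?thesis unfolding set_integrable_def
  proof (rule Bochner_Integration.integrable_bound[OF _ m])
    show "integrable lborel (\<lambda>x. \<bar>M\<bar> * indicator (cball 0 R) x :: real)"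
      by (intro integrable_mult_right integrable_real_indicator)
        (use emeasure_bounded_finite[OF bounded_cball] in \<open>auto simp: less_top\<close>)
    show "AE x in lborel. norm (indicator \<Omega> x *\<^sub>R divergence F x) \<le> norm (\<bar>M\<bar> * indicator (cball 0 R) x :: real)"
      using z M by (intro AE_I2) (force simp: indicator_def)
  qed
qed

lemma divergence_mult:
  assumes "\<eta> differentiable (at x)" "\<And>i. F i differentiable (at x)"
  shows "divergence (\<lambda>i x. \<eta> x * F i x) x = \<eta> x * divergence F x + (\<Sum>i\<in>UNIV. pd i \<eta> x * F i x)"
  using assms by (simp add: divergence_def pd_mult sum.distrib sum_distrib_left)

text \<open>Multiplication by a cutoff keeps a field tangential; this localises the divergence theorem.\<close>

lemma tangential_field_mult:
  assumes \<Omega>: "open \<Omega>" and F: "tangential_field \<Omega> F" and \<eta>: "C1_on UNIV \<eta>"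
  shows "tangential_field \<Omega> (\<lambda>i x. \<eta> x * F i x)"
proof -
  note F' = F[unfolded tangential_field_def]
  have C: "C1_on \<Omega> (F i)" and E: "has_extension \<Omega> (F i)" for i using F' by auto
  have \<eta>E: "has_extension \<Omega> \<eta>" by (rule has_extension_continuous[OF C1_onD(3)[OF \<eta>]])
  obtain R M where R: "\<And>x i. x \<in> \<Omega> \<Longrightarrow> norm x > R \<Longrightarrow> F i x = 0"
    and M: "\<And>x. x \<in> \<Omega> \<Longrightarrow> \<bar>divergence F x\<bar> \<le> M"
    using F' by blast
  have "\<exists>B. \<forall>x\<in>\<Omega>. \<bar>\<eta> x * divergence F x + (\<Sum>i\<in>UNIV. pd i \<eta> x * F i x)\<bar> \<le> B"
  proof -
    have cont: "bounded (f ` cball 0 R)" if "continuous_on UNIV f" for f :: "real^2 \<Rightarrow> real"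
      by (rule compact_imp_bounded[OF compact_continuous_image]) (auto intro: continuous_on_subset[OF that])
    obtain B0 where B0: "B0 > 0" "\<And>x. norm x \<le> R \<Longrightarrow> \<bar>\<eta> x\<bar> \<le> B0"
      using cont[OF C1_onD(3)[OF \<eta>]] unfolding bounded_pos by auto
    have "\<exists>B. B > 0 \<and> (\<forall>x. norm x \<le> R \<longrightarrow> \<bar>pd i \<eta> x\<bar> \<le> B)" for i
      using cont[OF C1_onD(2)[OF \<eta>, of i]] unfolding bounded_pos by auto
    then obtain B1 where B1: "\<And>i. B1 i > 0" "\<And>i x. norm x \<le> R \<Longrightarrow> \<bar>pd i \<eta> x\<bar> \<le> B1 i" by metis
    have "\<exists>B. B > 0 \<and> (\<forall>x\<in>\<Omega>. norm x \<le> R \<longrightarrow> \<bar>F i x\<bar> \<le> B)" for i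
      using extension_bounded_on_ball[OF E[of i], of R] extension(2)[OF E[of i]] closure_subset
      by (metis subsetD)
    then obtain B2 where B2: "\<And>i. B2 i > 0" "\<And>i x. x \<in> \<Omega> \<Longrightarrow> norm x \<le> R \<Longrightarrow> \<bar>F i x\<bar> \<le> B2 i" by metis
    have "\<bar>\<eta> x * divergence F x + (\<Sum>i\<in>UNIV. pd i \<eta> x * F i x)\<bar> \<le> B0 * \<bar>M\<bar> + (\<Sum>i\<in>UNIV. B1 i * B2 i)"
      if x: "x \<in> \<Omega>" for x
    proof (cases "norm x \<le> R")
      case True
      have "\<bar>\<eta> x * divergence F x\<bar> \<le> B0 * \<bar>M\<bar>"
        unfolding abs_mult using B0 True M[OF x] by (intro mult_mono) auto
      moreover have "\<bar>\<Sum>i\<in>UNIV. pd i \<eta> x * F i x\<bar> \<le> (\<Sum>i\<in>UNIV. B1 i * B2 i)"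
        by (rule order_trans[OF sum_abs sum_mono]) (unfold abs_mult, intro mult_mono, use B1 B2 True x in \<open>auto simp: less_imp_le\<close>)
      ultimately show ?thesis by linarith
    next
      case False
      have "pd i (F i) x = 0" for i
        by (rule pd_eq_0_open[where S = "\<Omega> \<inter> - cball 0 R"]) (use \<Omega> False x R in auto)
      then have "\<eta> x * divergence F x + (\<Sum>i\<in>UNIV. pd i \<eta> x * F i x) = 0"
        using R[OF x] False by (simp add: divergence_def)
      moreover have "0 \<le> B0 * \<bar>M\<bar> + (\<Sum>i\<in>UNIV. B1 i * B2 i)"
        using B0 B1(1) B2(1) by (auto intro!: add_nonneg_nonneg sum_nonneg mult_nonneg_nonneg simp: less_imp_le)
      ultimately show ?thesis by linarith
    qed
    then show ?thesis by blast
  qed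
  moreover have "divergence (\<lambda>i x. \<eta> x * F i x) x = \<eta> x * divergence F x + (\<Sum>i\<in>UNIV. pd i \<eta> x * F i x)" if "x \<in> \<Omega>" for x
    by (rule divergence_mult) (use C1_onD(1)[OF \<eta>] C1_onD(1)[OF C] that in auto)
  ultimately have div: "\<exists>B. \<forall>x\<in>\<Omega>. \<bar>divergence (\<lambda>i x. \<eta> x * F i x) x\<bar> \<le> B" by simp
  have "(\<Sum>i\<in>UNIV. extension \<Omega> (\<lambda>x. \<eta> x * F i x) x * outward_normal \<Omega> x $ i) = 0" if x: "x \<in> frontier \<Omega>" for x
  proof -
    have xc: "x \<in> closure \<Omega>" using frontier_open_limit(2)[OF \<Omega> x] .
    have "(\<Sum>i\<in>UNIV. extension \<Omega> (\<lambda>x. \<eta> x * F i x) x * outward_normal \<Omega> x $ i)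
      = extension \<Omega> \<eta> x * (\<Sum>i\<in>UNIV. extension \<Omega> (F i) x * outward_normal \<Omega> x $ i)"
      by (simp add: extension_mult[OF \<Omega> \<eta>E E xc] sum_distrib_left mult.assoc)
    then show ?thesis using F' x by simp
  qed
  moreover have "C1_on \<Omega> (\<lambda>x. \<eta> x * F i x)" "has_extension \<Omega> (\<lambda>x. \<eta> x * F i x)" for i
    using C1_on_mult[OF C1_on_subset[OF \<eta>] C] has_extension_mult[OF \<eta>E E] by auto
  moreover have "\<exists>R. \<forall>x\<in>\<Omega>. norm x > R \<longrightarrow> (\<forall>i. \<eta> x * F i x = 0)" using R by auto
  ultimately show ?thesis unfolding tangential_field_def using div by blast
qed


lemma divergence_integral_whole_plane:
  assumes "\<And>i. C1_on UNIV (G i)" "\<And>i x. norm x > R \<Longrightarrow> G i x = 0"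
  shows "integrable lborel (divergence G)" "integral\<^sup>L lborel (divergence G) = 0"
  using integral_pd_zero[OF assms] unfolding divergence_def[abs_def] by simp_all

lemma norm_gt_imp_not_cball: "norm x > norm c + r \<Longrightarrow> dist c x > r"
  using norm_triangle_ineq2[of x c] by (simp add: dist_norm norm_minus_commute)

lemma divergence_integral_inside:
  assumes \<Omega>: "open \<Omega>" and r: "cball c r \<subseteq> \<Omega>" and F: "\<And>i. C1_on \<Omega> (F i)"
    and supp: "\<And>i x. x \<in> \<Omega> \<Longrightarrow> x \<notin> cball c r \<Longrightarrow> F i x = 0"
  shows "(LINT x:\<Omega>|lborel. divergence F x) = 0"
proof -
  define G where "G i x = (if x \<in> \<Omega> then F i x else 0)" for i x
  have "C1_on UNIV (G i)" for i
    by (rule C1_on_UNIV_patch[OF \<Omega> _ _ F[of i], of "- cball c r"]) (use r supp in \<open>auto simp: G_def\<close>)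
  moreover have "G i x = 0" if "norm x > norm c + r" for i x
    using norm_gt_imp_not_cball[OF that] supp by (simp add: G_def)
  ultimately have "integral\<^sup>L lborel (divergence G) = 0"
    by (rule divergence_integral_whole_plane(2))
  moreover have "divergence G = (\<lambda>x. indicator \<Omega> x *\<^sub>R divergence F x)"
  proof
  fix x show "divergence G x = indicator \<Omega> x *\<^sub>R divergence F x"
  proof (cases "x \<in> \<Omega>")
    case True
    then show ?thesis
      using pd_cong[OF \<Omega> True, of "G i" "F i" for i] by (simp add: divergence_def G_def)
  next
    case False
    have "pd i (G i) x = 0" for i
      by (rule pd_eq_0_open[of "- cball c r"]) (use False r supp in \<open>auto simp: G_def\<close>)
    then show ?thesis using False by (simp add: divergence_def)
  qed
  qed
  ultimately show ?thesis by (simp add: set_lebesgue_integral_def)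
qed

text \<open>Multiply the field by a cutoff \<open>\<theta>\<^sub>n\<close> of \<open>n \<rho>\<close> that vanishes near the boundary and extend by zero to the
  plane, where the integral of the divergence is zero.  The derivative of the cutoff contributes, up to
  sign, \<open>n \<theta>\<^sub>n'\<close> times \<open>\<nabla>\<rho> \<cdot> F\<close> on a thin layer.  Tangentiality makes the second factor uniformly small on the
  layer.  The first has bounded integral, again because a divergence on the plane has integral zero: it
  is controlled by the derivative of \<open>\<theta>\<^sub>n b\<close> in the fixed direction \<open>\<nabla>\<rho>(c)\<close>, in which \<open>\<rho>\<close> strictly increases, for
  a fixed bump function \<open>b\<close>.\<close>

lemma divergence_integral_near_frontier:
  assumes \<Omega>: "open \<Omega>" and df: "defining_function \<Omega> c U \<rho>" 
  obtains r where "r > 0" "\<And>F. tangential_field \<Omega> F \<Longrightarrow>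
      (\<And>i x. x \<in> \<Omega> \<Longrightarrow> x \<notin> cball c r \<Longrightarrow> F i x = 0) \<Longrightarrow>
      (LINT x:\<Omega>|lborel. divergence F x) = 0"
proof -
  note d = defining_functionD[OF df]
  note \<rho>C = d(3)
  define a where "a i = pd i \<rho> c" for i
  define S where "S y = (\<Sum>i\<in>UNIV. pd i \<rho> y * a i)" for y
  \<comment> \<open>\<open>S\<close> is the derivative of \<open>\<rho>\<close> in the fixed direction \<open>a\<close>; half its value at \<open>c\<close> is a lower bound nearby\<close>
  define k where "k = S c / 2"
  have "\<exists>i. a i \<noteq> 0"
    using d(4)[OF d(2)] by (auto simp: a_def grad_def vec_eq_iff)
  then have "S c > 0"
    unfolding S_def a_def[symmetric] by (metis (no_types, lifting) UNIV_I finite not_real_square_gt_zero sum_pos2 zero_le_square)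
  then have k: "k > 0" "k < S c" by (auto simp: k_def)
  have Scont: "continuous_on U S"
    unfolding S_def[abs_def] by (intro continuous_on_sum continuous_on_mult C1_onD(2)[OF \<rho>C] continuous_on_const)
  have "open (U \<inter> S -` {k<..})"
    using Scont continuous_on_open_vimage[OF d(1)] by (metis Int_commute open_greaterThan)
  moreover have "c \<in> U \<inter> S -` {k<..}" using d(2) k by auto
  ultimately obtain e where e: "e > 0" "cball c e \<subseteq> U \<inter> S -` {k<..}"
    using open_contains_cball by meson
  define r where "r = e / 2"
  have r: "r > 0" "cball c (2 * r) \<subseteq> U" "\<And>y. y \<in> cball c (2 * r) \<Longrightarrow> k \<le> S y"
    using e by (auto simp: r_def)
  have crU: "cball c r \<subseteq> U" using r(1,2) subset_cball[of r "2 * r" c] by auto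
  define b where "b = bump c r"
  have b1: "b y = 1" if "y \<in> cball c r" for y using bump_eq_1[OF r(1)] that by (simp add: b_def)
  have b0: "b y = 0" if "y \<notin> cball c (2 * r)" for y using bump_eq_0[OF r(1)] that by (simp add: b_def)
  have bb: "0 \<le> b y" "b y \<le> 1" for y by (simp_all add: b_def bump_bounds)
  have bC: "C1_on V b" for V by (simp add: b_def bump_C1)
  have bd: "b differentiable (at y)" for y using C1_onD(1)[OF bC[of UNIV]] by simp
  \<comment> \<open>vanishes for \<open>\<rho> \<ge> -1/n\<close>, equals 1 for \<open>\<rho> \<le> -2/n\<close>\<close>
  define \<theta> where "\<theta> n y = step ((- real n) * \<rho> y - 1)" for n y
  define \<theta>' where "\<theta>' n y = step' ((- real n) * \<rho> y - 1)" for n y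
  have \<theta>f: "C1_on U (\<lambda>y. (- real n) * \<rho> y - 1)" for n
    by (intro C1_on_diff C1_on_mult C1_on_const \<rho>C)
  have \<theta>C: "C1_on U (\<theta> n)" for n unfolding \<theta>_def[abs_def]
    by (rule C1_on_compose[OF \<theta>f step_deriv]) (rule continuous_on_subset[OF continuous_on_step'], simp)
  have \<theta>pd: "pd i (\<theta> n) y = - (real n * \<theta>' n y * pd i \<rho> y)" if "y \<in> U" for i n y
  proof -
    have "pd i (\<theta> n) y = \<theta>' n y * pd i (\<lambda>y. (- real n) * \<rho> y - 1) y"
      unfolding \<theta>_def[abs_def] \<theta>'_def by (rule pd_compose[OF C1_onD(1)[OF \<theta>f that] step_deriv])
    also have "pd i (\<lambda>y. (- real n) * \<rho> y - 1) y = - real n * pd i \<rho> y"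
      using C1_onD(1)[OF \<rho>C that] by (subst pd_diff) (auto intro!: differentiable_mult differentiable_const simp only: pd_cmult pd_const)
    finally show ?thesis by simp
  qed
  have \<theta>d: "\<theta> n differentiable (at y)" if "y \<in> U" for n y using C1_onD(1)[OF \<theta>C that] .
  have \<theta>01: "0 \<le> \<theta> n y" "\<theta> n y \<le> 1" "0 \<le> \<theta>' n y" for n y
    by (simp_all add: \<theta>_def \<theta>'_def step_bounds step'_nonneg)
  have BU: "open (- cball c (2 * r))" "U \<union> - cball c (2 * r) = UNIV" using r(2) by auto

  \<comment> \<open>The layer where the cutoff varies has an integral that stays bounded.\<close>
  define q where "q n y = (if y \<in> U then real n * \<theta>' n y * b y else 0)" for n y
  have q0: "q n y \<ge> 0" for n y using \<theta>01 bb by (auto simp: q_def)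
  have qint: "integrable lborel (q n)" for n
  proof (rule integrable_continuous_bounded_support[where R = "norm c + 2 * r"])
    have "continuous_on U (\<theta>' n)"
      unfolding \<theta>'_def[abs_def]
      by (rule continuous_on_compose2[OF continuous_on_step' C1_onD(3)[OF \<theta>f]]) auto
    then have "continuous_on U (\<lambda>y. real n * \<theta>' n y * b y)"
      by (intro continuous_on_mult continuous_on_const C1_onD(3)[OF bC])
    then have "continuous_on U (q n)" by (rule continuous_on_eq) (simp add: q_def)
    moreover have "continuous_on (- cball c (2 * r)) (q n)"
      by (rule continuous_on_eq[OF continuous_on_const[of _ 0]]) (use b0 in \<open>auto simp: q_def\<close>)
    ultimately have "continuous_on (U \<union> - cball c (2 * r)) (q n)"
      using d(1) BU(1) continuous_on_open_Un by blast
    then show "continuous_on UNIV (q n)" using BU(2) by simp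
    show "q n y = 0" if "norm y > norm c + 2 * r" for y
      using norm_gt_imp_not_cball[OF that] b0[of y] by (simp add: q_def)
  qed
  define K where "K = (\<integral>y. (\<Sum>i\<in>UNIV. \<bar>a i\<bar> * \<bar>pd i b y\<bar>) \<partial>lborel)"
  have Kint: "integrable lborel (\<lambda>y. \<Sum>i\<in>UNIV. \<bar>a i\<bar> * \<bar>pd i b y\<bar>)"
  proof (rule integrable_continuous_bounded_support[where R = "norm c + 2 * r"])
    show "continuous_on UNIV (\<lambda>y. \<Sum>i\<in>UNIV. \<bar>a i\<bar> * \<bar>pd i b y\<bar>)"
      by (intro continuous_on_sum continuous_on_mult continuous_on_const continuous_on_rabs C1_onD(2)[OF bC])
    show "(\<Sum>i\<in>UNIV. \<bar>a i\<bar> * \<bar>pd i b y\<bar>) = 0" if "norm y > norm c + 2 * r" for y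
    proof -
      have "pd i b y = 0" for i
        by (rule pd_eq_0_open[OF BU(1)]) (use norm_gt_imp_not_cball[OF that] b0 in auto)
      then show ?thesis by simp
    qed
  qed
  have qK: "integral\<^sup>L lborel (q n) \<le> K / k" for n
  proof -
    define \<Phi> where "\<Phi> y = (if y \<in> U then \<theta> n y * b y else 0)" for y
    have \<Phi>C: "C1_on UNIV \<Phi>"
      by (rule C1_on_UNIV_patch[OF d(1) BU C1_on_mult[OF \<theta>C[of n] bC]]) (use b0 in \<open>auto simp: \<Phi>_def\<close>)
    have \<Phi>0: "\<Phi> y = 0" if "norm y > norm c + 2 * r" for y
      using norm_gt_imp_not_cball[OF that] b0[of y] by (simp add: \<Phi>_def)
    note I = integral_pd_zero[OF \<Phi>C \<Phi>0]
    have le: "k * q n y \<le> - (\<Sum>i\<in>UNIV. a i * pd i \<Phi> y) + (\<Sum>i\<in>UNIV. \<bar>a i\<bar> * \<bar>pd i b y\<bar>)" for y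
    proof (cases "y \<in> U")
      case True
      have pd\<Phi>: "pd i \<Phi> y = \<theta> n y * pd i b y - real n * \<theta>' n y * pd i \<rho> y * b y" for i
      proof -
        have "pd i \<Phi> y = pd i (\<lambda>y. \<theta> n y * b y) y"
          by (rule pd_cong[OF d(1) True]) (simp add: \<Phi>_def)
        then show ?thesis using \<theta>d[OF True] bd by (simp add: pd_mult \<theta>pd[OF True])
      qed
      have "- (\<Sum>i\<in>UNIV. a i * pd i \<Phi> y)
          = q n y * S y - (\<Sum>i\<in>UNIV. \<theta> n y * (a i * pd i b y))"
        unfolding pd\<Phi> using True by (simp add: q_def S_def sum_2 algebra_simps)
      moreover have "k * q n y \<le> q n y * S y"
      proof (cases "y \<in> cball c (2 * r)")
        case True
        show ?thesis using mult_right_mono[OF r(3)[OF True] q0[of n y]] by (simp add: mult.commute)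
      qed (use b0 in \<open>auto simp: q_def\<close>)
      moreover have "(\<Sum>i\<in>UNIV. \<theta> n y * (a i * pd i b y)) \<le> (\<Sum>i\<in>UNIV. \<bar>a i\<bar> * \<bar>pd i b y\<bar>)"
      proof (rule sum_mono)
        fix i
        have "\<theta> n y * (a i * pd i b y) \<le> \<theta> n y * \<bar>a i * pd i b y\<bar>"
          using \<theta>01 by (intro mult_left_mono) auto
        also have "\<dots> \<le> 1 * \<bar>a i * pd i b y\<bar>" using \<theta>01 by (intro mult_right_mono) auto
        finally show "\<theta> n y * (a i * pd i b y) \<le> \<bar>a i\<bar> * \<bar>pd i b y\<bar>" by (simp add: abs_mult)
      qed
      ultimately show ?thesis by linarith
    next
      case False
      then have "y \<notin> cball c (2 * r)" using r(2) by auto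
      then have "pd i \<Phi> y = 0" for i
        by (intro pd_eq_0_open[OF BU(1)]) (use b0 in \<open>auto simp: \<Phi>_def\<close>)
      then show ?thesis using False by (simp add: q_def sum_nonneg)
    qed
    have "k * integral\<^sup>L lborel (q n) = (\<integral>y. k * q n y \<partial>lborel)" by simp
    also have "\<dots> \<le> (\<integral>y. - (\<Sum>i\<in>UNIV. a i * pd i \<Phi> y) + (\<Sum>i\<in>UNIV. \<bar>a i\<bar> * \<bar>pd i b y\<bar>) \<partial>lborel)"
      by (intro integral_mono le) (use qint Kint I(1) in auto)
    also have "\<dots> = K" using Kint I unfolding K_def by (subst Bochner_Integration.integral_add) auto
    finally show ?thesis using k by (simp add: field_simps)
  qed

  have main: "(LINT x:\<Omega>|lborel. divergence F x) = 0"
    if F: "tangential_field \<Omega> F" and supp: "\<And>i x. x \<in> \<Omega> \<Longrightarrow> x \<notin> cball c r \<Longrightarrow> F i x = 0" for F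
  proof -
    note F' = F[unfolded tangential_field_def]
    have FC: "C1_on \<Omega> (F i)" and FE: "has_extension \<Omega> (F i)" for i using F' by auto
    have Fd: "F i differentiable (at x)" if "x \<in> \<Omega>" for i x using C1_onD(1)[OF FC that] .
    have div0: "divergence F x = 0" if "x \<in> \<Omega>" "x \<notin> cball c r" for x
    proof -
      have "pd i (F i) x = 0" for i
        by (rule pd_eq_0_open[of "\<Omega> \<inter> - cball c r"]) (use \<Omega> that supp in auto)
      then show ?thesis by (simp add: divergence_def)
    qed
    define G where "G n i x = (if x \<in> \<Omega> \<inter> U then \<theta> n x * F i x else 0)" for n i x
    define B where "B n = (U \<inter> {y. (- real n) * \<rho> y - 1 < 0}) \<union> - cball c r" for n
    have Bo: "open (B n)" for n
    proof -
      have "open (U \<inter> (\<lambda>y. (- real n) * \<rho> y - 1) -` {..<0})"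
        using C1_onD(3)[OF \<theta>f[of n]] continuous_on_open_vimage[OF d(1)] by (metis Int_commute open_lessThan)
      moreover have "U \<inter> {y. (- real n) * \<rho> y - 1 < 0} = U \<inter> (\<lambda>y. (- real n) * \<rho> y - 1) -` {..<0}" by auto
      ultimately show ?thesis unfolding B_def by (metis open_Un open_Compl closed_cball)
    qed
    have Bc: "\<Omega> \<inter> U \<union> B n = UNIV" for n
    proof -
      have "y \<in> \<Omega> \<inter> U \<or> y \<in> B n" for y
      proof (cases "y \<in> cball c r")
        case True
        then have yU: "y \<in> U" using crU by auto
        show ?thesis
        proof (cases "\<rho> y < 0")
          case False
          then have "0 \<le> real n * \<rho> y" by simp
          then show ?thesis using yU by (simp add: B_def)
        qed (use yU d(5) in auto)
      qed (simp add: B_def)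
      then show ?thesis by blast
    qed
    have GB: "G n i y = 0" if "y \<in> B n" for n i y
      using that supp[of y] by (auto simp: G_def B_def \<theta>_def step_eq)
    have GC: "C1_on UNIV (G n i)" for n i
    proof (rule C1_on_UNIV_patch[OF _ Bo[of n] Bc[of n]])
      show "open (\<Omega> \<inter> U)" using \<Omega> d(1) by auto
      show "C1_on (\<Omega> \<inter> U) (\<lambda>x. \<theta> n x * F i x)"
        by (intro C1_on_mult) (auto intro: C1_on_subset[OF \<theta>C] C1_on_subset[OF FC])
      show "\<And>x. x \<in> \<Omega> \<inter> U \<Longrightarrow> G n i x = \<theta> n x * F i x" by (simp add: G_def)
      show "\<And>x. x \<in> B n \<Longrightarrow> G n i x = 0" by (rule GB)
    qed
    have G0: "G n i y = 0" if "norm y > norm c + r" for n i y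
      using norm_gt_imp_not_cball[OF that] supp[of y] by (auto simp: G_def)
    have IG: "integrable lborel (divergence (G n))" "integral\<^sup>L lborel (divergence (G n)) = 0" for n
      by (rule divergence_integral_whole_plane[OF GC G0]; simp)+
    have divG: "divergence (G n) y = (if y \<in> \<Omega> \<inter> U then \<theta> n y * divergence F y
        - real n * \<theta>' n y * (\<Sum>i\<in>UNIV. pd i \<rho> y * F i y) else 0)" for n y
    proof (cases "y \<in> \<Omega> \<inter> U")
      case True
      have "divergence (G n) y = divergence (\<lambda>i x. \<theta> n x * F i x) y"
        unfolding divergence_def
      proof (rule sum.cong[OF refl])
        show "pd i (G n i) y = pd i (\<lambda>x. \<theta> n x * F i x) y" for i
          by (rule pd_cong[of "\<Omega> \<inter> U"]) (use True \<Omega> d(1) in \<open>auto simp: G_def\<close>)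
      qed
      also have "\<dots> = \<theta> n y * divergence F y + (\<Sum>i\<in>UNIV. pd i (\<theta> n) y * F i y)"
        by (rule divergence_mult) (use True \<theta>d Fd in auto)
      finally show ?thesis using True by (simp add: \<theta>pd sum_negf sum_distrib_left mult.assoc)
    next
      case False
      then have "y \<in> B n" using Bc[of n] by blast
      then have "pd i (G n i) y = 0" for i by (intro pd_eq_0_open[OF Bo, of y n]) (use GB in auto)
      then show ?thesis using False by (auto simp: divergence_def)
    qed
    define P where "P n x = indicator (\<Omega> \<inter> U) x *\<^sub>R (\<theta> n x * divergence F x)" for n x
    have divFc: "continuous_on \<Omega> (divergence F)"
      unfolding divergence_def[abs_def] by (intro continuous_on_sum C1_onD(2)[OF FC])
    have Pm: "P n \<in> borel_measurable lborel" for n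
    proof -
      have "continuous_on (\<Omega> \<inter> U) (\<lambda>x. \<theta> n x * divergence F x)"
        by (intro continuous_on_mult) (auto intro: continuous_on_subset[OF divFc] continuous_on_subset[OF C1_onD(3)[OF \<theta>C]])
      from borel_measurable_continuous_on_indicator[OF _ this] show ?thesis
        unfolding P_def[abs_def] using \<Omega> d(1) by auto
    qed
    have iF: "integrable lborel (\<lambda>x. indicator \<Omega> x *\<^sub>R divergence F x)"
      using tangential_field_integrable[OF \<Omega> F] by (simp add: set_integrable_def)
    have Pb: "norm (P n x) \<le> norm (indicator \<Omega> x *\<^sub>R divergence F x)" for n x
    proof -
      have "\<theta> n x * \<bar>divergence F x\<bar> \<le> 1 * \<bar>divergence F x\<bar>" using \<theta>01 by (intro mult_right_mono) auto
      then show ?thesis using \<theta>01(1)[of n x] by (auto simp: P_def indicator_def abs_mult)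
    qed
    have Pint: "integrable lborel (P n)" for n
      by (rule Bochner_Integration.integrable_bound[OF iF Pm]) (use Pb in auto)
    have lim: "(\<lambda>n. integral\<^sup>L lborel (P n)) \<longlonglongrightarrow> (LINT x:\<Omega>|lborel. divergence F x)"
      unfolding set_lebesgue_integral_def
    proof (rule integral_dominated_convergence[where w = "\<lambda>x. norm (indicator \<Omega> x *\<^sub>R divergence F x)"])
      show "AE x in lborel. (\<lambda>n. P n x) \<longlonglongrightarrow> indicator \<Omega> x *\<^sub>R divergence F x"
      proof (rule AE_I2)
        fix x
        show "(\<lambda>n. P n x) \<longlonglongrightarrow> indicator \<Omega> x *\<^sub>R divergence F x"
        proof (cases "x \<in> \<Omega> \<inter> U")
          case True
          then have "\<rho> x < 0" using d(5) by auto
          obtain N :: nat where N: "2 / (- \<rho> x) < real N" using reals_Archimedean2 by blast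
          have "\<theta> n x = 1" if "n \<ge> N" for n
          proof -
            have "2 / (- \<rho> x) \<le> real n" using N that by simp
            then have "2 \<le> real n * (- \<rho> x)" using \<open>\<rho> x < 0\<close> by (simp add: field_simps)
            then show ?thesis unfolding \<theta>_def by (intro step_eq) simp
          qed
          then have "\<forall>\<^sub>F n in sequentially. P n x = indicator \<Omega> x *\<^sub>R divergence F x"
            unfolding eventually_sequentially using True by (auto simp: P_def)
          then show ?thesis by (rule tendsto_eventually)
        next
          case False
          have "indicator \<Omega> x *\<^sub>R divergence F x = 0"
          proof (cases "x \<in> \<Omega>")
            case True
            then have "x \<notin> cball c r" using False crU by auto
            then show ?thesis using div0[OF True] by simp
          qed simp
          moreover have "(\<lambda>n. P n x) = (\<lambda>n. 0)" using False by (simp add: P_def)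
          ultimately show ?thesis by (simp only: tendsto_const)
        qed
      qed
    qed (use iF Pm Pb in auto)
    have small: "\<exists>N. \<forall>n\<ge>N. \<bar>integral\<^sup>L lborel (P n)\<bar> \<le> \<epsilon> * (K / k)" if "\<epsilon> > 0" for \<epsilon>
    proof -
      define h where "h y = (\<Sum>i\<in>UNIV. pd i \<rho> y * extension \<Omega> (F i) y)" for y
      define X where "X = closure \<Omega> \<inter> cball c r"
      have X: "compact X" "X \<subseteq> U" "X \<subseteq> closure \<Omega>"
        using r subset_cball[of r "2 * r" c] by (auto simp: X_def closed_Int_compact)
      have hc: "continuous_on X h"
        unfolding h_def[abs_def]
        by (intro continuous_on_sum continuous_on_mult)
          (use X continuous_on_subset[OF C1_onD(2)[OF \<rho>C]] continuous_on_subset[OF extension(1)[OF FE]] in auto)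
      have h0: "h y = 0" if "y \<in> X" "\<rho> y = 0" for y
      proof -
        have yU: "y \<in> U" using that X by auto
        have "y \<notin> \<Omega>" using d(5)[OF yU] that by auto
        then have yf: "y \<in> frontier \<Omega>" using that X \<Omega> by (auto simp: frontier_def interior_open)
        have "(\<Sum>i\<in>UNIV. extension \<Omega> (F i) y * outward_normal \<Omega> y $ i) = 0" using F' yf by blast
        moreover have "outward_normal \<Omega> y = grad \<rho> y /\<^sub>R norm (grad \<rho> y)"
          by (rule outward_normal_eq[OF \<Omega> defining_function_other_point[OF df yU] yf])
        ultimately have "(\<Sum>i\<in>UNIV. (extension \<Omega> (F i) y * pd i \<rho> y)) / norm (grad \<rho> y) = 0"
          unfolding sum_divide_distrib by (simp add: grad_def field_simps)
        then show ?thesis using d(4)[OF yU] by (simp add: h_def mult.commute)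
      qed
      \<comment> \<open>points where the normal component is not small stay away from the boundary\<close>
      have "\<exists>m>0. \<forall>y\<in>X. \<epsilon> \<le> \<bar>h y\<bar> \<longrightarrow> m \<le> - \<rho> y"
      proof -
        let ?T = "X \<inter> (\<lambda>y. \<bar>h y\<bar>) -` {\<epsilon>..}"
        have "closed ?T"
          using continuous_on_rabs[OF hc] continuous_closed_preimage compact_imp_closed[OF X(1)] closed_atLeast by blast
        then have T: "compact ?T" using X(1) compact_Int_closed[of X ?T] by (simp add: Int_absorb1 inf_commute)
        show ?thesis
        proof (cases "?T = {}")
          case True
          then show ?thesis by (intro exI[of _ 1]) force
        next
          case False
          have "continuous_on ?T (\<lambda>y. - \<rho> y)"
            by (intro continuous_on_minus continuous_on_subset[OF C1_onD(3)[OF \<rho>C]]) (use X in auto)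
          from continuous_attains_inf[OF T False this]
          obtain z where z: "z \<in> ?T" "\<And>y. y \<in> ?T \<Longrightarrow> - \<rho> z \<le> - \<rho> y" by blast
          have "\<rho> z \<le> 0" using closure_defining[OF df] z X by blast
          moreover have "\<rho> z \<noteq> 0" using h0[of z] z(1) \<open>\<epsilon> > 0\<close> by auto
          ultimately show ?thesis using z(2) by (intro exI[of _ "- \<rho> z"]) auto
        qed
      qed
      then obtain m where m: "m > 0" "\<And>y. y \<in> X \<Longrightarrow> \<epsilon> \<le> \<bar>h y\<bar> \<Longrightarrow> m \<le> - \<rho> y" by blast
      obtain N :: nat where N: "2 / m < real N" using reals_Archimedean2 by blast
      have "\<bar>integral\<^sup>L lborel (P n)\<bar> \<le> \<epsilon> * (K / k)" if "n \<ge> N" for n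
      proof -
        have n: "2 / m < real n" using N that by simp
        have n0: "real n > 0" using n m(1) by (meson divide_pos_pos less_trans zero_less_numeral)
        have le: "\<bar>P n y - divergence (G n) y\<bar> \<le> \<epsilon> * q n y" for y
        proof (cases "y \<in> \<Omega> \<inter> U")
          case True
          then have eq: "P n y - divergence (G n) y = real n * \<theta>' n y * (\<Sum>i\<in>UNIV. pd i \<rho> y * F i y)"
            by (simp add: P_def divG)
          show ?thesis
          proof (cases "y \<in> cball c r \<and> \<theta>' n y \<noteq> 0")
            case False
            then have "P n y - divergence (G n) y = 0"
              unfolding eq using supp[of y] True by auto
            then show ?thesis using q0[of n y] \<open>\<epsilon> > 0\<close> by simp
          next
            case yr: True
            then have "- real n * \<rho> y - 1 < 1"
              using step'_eq[of "- real n * \<rho> y - 1"] unfolding \<theta>'_def by linarith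
            then have "- \<rho> y < 2 / real n" using n0 by (simp add: field_simps)
            also have "2 / real n < m" using n n0 m(1) by (simp add: field_simps)
            finally have "\<bar>h y\<bar> < \<epsilon>" using m(2)[of y] True yr closure_subset[of \<Omega>] by (force simp: X_def)
            moreover have "h y = (\<Sum>i\<in>UNIV. pd i \<rho> y * F i y)"
              using extension(2)[OF FE] True by (simp add: h_def)
            ultimately have "\<bar>P n y - divergence (G n) y\<bar> \<le> real n * \<theta>' n y * \<epsilon>"
              unfolding eq abs_mult using \<theta>01(3)[of n y] by (auto intro!: mult_mono)
            then show ?thesis using True yr b1[of y] by (simp add: q_def mult.commute)
          qed
        next
          case False
          then have "P n y - divergence (G n) y = 0" by (auto simp: P_def divG)
          then show ?thesis using q0[of n y] \<open>\<epsilon> > 0\<close> by simp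
        qed
        have "integral\<^sup>L lborel (P n) = (\<integral>y. P n y - divergence (G n) y \<partial>lborel)"
          using Pint IG[of n] by simp
        also have "\<bar>\<dots>\<bar> \<le> (\<integral>y. \<epsilon> * q n y \<partial>lborel)"
          by (rule order_trans[OF integral_abs_bound integral_mono]) (use Pint IG(1)[of n] qint le in auto)
        also have "\<dots> \<le> \<epsilon> * (K / k)" using mult_left_mono[OF qK[of n], of \<epsilon>] \<open>\<epsilon> > 0\<close> by simp
        finally show ?thesis .
      qed
      then show ?thesis by blast
    qed
    have bound: "\<bar>LINT x:\<Omega>|lborel. divergence F x\<bar> \<le> \<epsilon> * (K / k)" if "\<epsilon> > 0" for \<epsilon>
    proof (rule tendsto_upperbound[OF tendsto_rabs[OF lim]])
      show "\<forall>\<^sub>F n in sequentially. \<bar>integral\<^sup>L lborel (P n)\<bar> \<le> \<epsilon> * (K / k)"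
        using small[OF that] unfolding eventually_sequentially .
    qed simp
    have Kk: "K / k \<ge> 0" using order_trans[OF _ qK[of 0]] q0 by (simp add: integral_nonneg)
    have "\<bar>LINT x:\<Omega>|lborel. divergence F x\<bar> \<le> e" if "e > 0" for e
    proof -
      have "\<bar>LINT x:\<Omega>|lborel. divergence F x\<bar> \<le> e / (K / k + 1) * (K / k)"
        by (rule bound) (use that Kk in auto)
      also have "\<dots> = e * (K / k / (K / k + 1))" by simp
      also have "\<dots> \<le> e * 1"
      proof (rule mult_left_mono)
        have "A / (A + 1) \<le> 1" if "A \<ge> 0" for A :: real using that by simp
        from this[OF Kk] show "K / k / (K / k + 1) \<le> 1" .
      qed (use that in simp)
      also have "\<dots> = e" by simp
      finally show ?thesis .
    qed
    then have "\<bar>LINT x:\<Omega>|lborel. divergence F x\<bar> \<le> 0" by (rule field_le_epsilon) simp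
    then show ?thesis by simp
  qed
  show thesis
  proof (rule that[OF r(1)])
    fix F assume "tangential_field \<Omega> F" "\<And>i x. x \<in> \<Omega> \<Longrightarrow> x \<notin> cball c r \<Longrightarrow> F i x = 0"
    then show "(LINT x:\<Omega>|lborel. divergence F x) = 0" using main[of F] by simp
  qed
qed

text \<open>Around every point of the closure there is a disc such that fields supported in it satisfy the theorem.  A general field is split by induction over a finite cover of its support: a bump function that equals 1 on one disc of the cover separates a part supported near that disc from a part that the remaining discs cover.\<close>

theorem divergence_theorem_tangential:
  assumes smooth: "smooth_open_set \<Omega>" and F: "tangential_field \<Omega> F"
  shows "(LINT x:\<Omega>|lborel. divergence F x) = 0"
proof -
  have \<Omega>: "open \<Omega>" using smooth by (simp add: smooth_open_set_def)
  define good where "good c r \<longleftrightarrow> (\<forall>F. tangential_field \<Omega> F \<longrightarrow>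
      (\<forall>i x. x \<in> \<Omega> \<longrightarrow> x \<notin> cball c r \<longrightarrow> F i x = 0) \<longrightarrow> (LINT x:\<Omega>|lborel. divergence F x) = 0)" for c r
  have ex: "\<exists>r>0. good c r" if "c \<in> closure \<Omega>" for c
  proof (cases "c \<in> \<Omega>")
    case True
    then obtain r where r: "r > 0" "cball c r \<subseteq> \<Omega>" using \<Omega> open_contains_cball by blast
    have "good c r" unfolding good_def
      using divergence_integral_inside[OF \<Omega> r(2)] unfolding tangential_field_def by blast
    with r show ?thesis by blast
  next
    case False
    then have "c \<in> frontier \<Omega>" using that \<Omega> by (simp add: frontier_def interior_open)
    then obtain U \<rho> where "defining_function \<Omega> c U \<rho>"
      using smooth unfolding smooth_open_set_def by blast
    then obtain r where "r > 0" "\<And>F. tangential_field \<Omega> F \<Longrightarrow>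
      (\<And>i x. x \<in> \<Omega> \<Longrightarrow> x \<notin> cball c r \<Longrightarrow> F i x = 0) \<Longrightarrow> (LINT x:\<Omega>|lborel. divergence F x) = 0"
      using divergence_integral_near_frontier[OF \<Omega>] by blast
    then show ?thesis unfolding good_def by blast
  qed
  then obtain rad where rad: "\<And>c. c \<in> closure \<Omega> \<Longrightarrow> rad c > 0 \<and> good c (rad c)" by metis
  have step: "(LINT x:\<Omega>|lborel. divergence F x) = 0"
    if "finite C" "C \<subseteq> closure \<Omega>" "tangential_field \<Omega> F"
      "\<And>i x. x \<in> \<Omega> \<Longrightarrow> x \<notin> (\<Union>c\<in>C. ball c (rad c / 2)) \<Longrightarrow> F i x = 0" for C F
    using that
  proof (induction C arbitrary: F rule: finite_induct)
    case empty
    then have z: "divergence F x = 0" if "x \<in> \<Omega>" for x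
      using that pd_eq_0_open[OF \<Omega> that, of "F i" for i] by (simp add: divergence_def)
    have "(\<lambda>x. indicator \<Omega> x *\<^sub>R divergence F x) = (\<lambda>x. 0)"
      using z by (auto simp: indicator_def)
    then show ?case by (simp add: set_lebesgue_integral_def)
  next
    case (insert c C)
    have c: "rad c > 0" "good c (rad c)" using rad insert.prems by auto
    define b where "b = bump c (rad c / 2)"
    have bC: "C1_on UNIV b" "C1_on UNIV (\<lambda>x. 1 - b x)"
      unfolding b_def by (intro C1_on_diff C1_on_const bump_C1)+
    note F = insert.prems(2)
    note t = tangential_field_mult[OF \<Omega> F bC(1)] tangential_field_mult[OF \<Omega> F bC(2)]
    have "b x * F i x = 0" if "x \<notin> cball c (rad c)" for i x
      using bump_eq_0[of "rad c / 2" c x] c(1) that by (simp add: b_def)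
    then have 1: "(LINT x:\<Omega>|lborel. divergence (\<lambda>i x. b x * F i x) x) = 0"
      using c(2) t(1) unfolding good_def by blast
    have 2: "(LINT x:\<Omega>|lborel. divergence (\<lambda>i x. (1 - b x) * F i x) x) = 0"
    proof (rule insert.IH[OF _ t(2)])
      show "(1 - b x) * F i x = 0" if "x \<in> \<Omega>" "x \<notin> (\<Union>c\<in>C. ball c (rad c / 2))" for i x
      proof (cases "x \<in> ball c (rad c / 2)")
        case True
        then show ?thesis using c(1) bump_eq_1[of "rad c / 2" c x] by (simp add: b_def)
      qed (use insert.prems(3)[of x i] that in auto)
    qed (use insert.prems in auto)
    have sum: "divergence F x = divergence (\<lambda>i x. b x * F i x) x + divergence (\<lambda>i x. (1 - b x) * F i x) x"
      if "x \<in> \<Omega>" for x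
    proof -
      have d: "F i differentiable (at x)" "b differentiable (at x)" for i
        using F that bC(1) C1_onD(1) unfolding tangential_field_def by blast+
      have "divergence (\<lambda>i x. (1 - b x) * F i x) x = (1 - b x) * divergence F x + (\<Sum>i\<in>UNIV. pd i (\<lambda>x. 1 - b x) x * F i x)"
        by (rule divergence_mult) (use d in \<open>auto intro!: differentiable_diff\<close>)
      then show ?thesis
        using d by (simp add: divergence_mult pd_diff sum_negf left_diff_distrib)
    qed
    have "(LINT x:\<Omega>|lborel. divergence F x) = (LINT x:\<Omega>|lborel.
        divergence (\<lambda>i x. b x * F i x) x + divergence (\<lambda>i x. (1 - b x) * F i x) x)"
      by (rule set_lebesgue_integral_cong) (use sum \<Omega> in auto)
    also have "\<dots> = 0"
      using tangential_field_integrable[OF \<Omega> t(1)] tangential_field_integrable[OF \<Omega> t(2)] 1 2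
      by (simp add: set_integral_add)
    finally show ?case .
  qed
  obtain R where R: "\<And>x i. x \<in> \<Omega> \<Longrightarrow> norm x > R \<Longrightarrow> F i x = 0"
    using F unfolding tangential_field_def by blast
  have cpt: "compact (closure \<Omega> \<inter> cball 0 R)" by (simp add: closed_Int_compact)
  have cov: "closure \<Omega> \<inter> cball 0 R \<subseteq> (\<Union>c\<in>closure \<Omega>. ball c (rad c / 2))"
    using rad by fastforce
  obtain C where C: "C \<subseteq> closure \<Omega>" "finite C" "closure \<Omega> \<inter> cball 0 R \<subseteq> (\<Union>c\<in>C. ball c (rad c / 2))"
    by (rule compactE_image[OF cpt _ cov]) auto
  have "F i x = 0" if "x \<in> \<Omega>" "x \<notin> (\<Union>c\<in>C. ball c (rad c / 2))" for i x
  proof -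
    have "x \<notin> cball 0 R" using C(3) that closure_subset by blast
    then show ?thesis using R[OF that(1)] by simp
  qed
  then show ?thesis by (rule step[OF C(2,1) F])
qed


text \<open>Boundedness of the divergence follows from its continuous extension, by compactness.\<close>

lemma tangential_fieldI:
  assumes \<Omega>: "open \<Omega>" and "\<And>i. C1_on \<Omega> (F i)" "\<And>i. has_extension \<Omega> (F i)"
    and "\<And>x. x \<in> frontier \<Omega> \<Longrightarrow> (\<Sum>i\<in>UNIV. extension \<Omega> (F i) x * outward_normal \<Omega> x $ i) = 0"
    and supp: "\<And>i x. x \<in> \<Omega> \<Longrightarrow> norm x > R \<Longrightarrow> F i x = 0"
    and E: "has_extension \<Omega> (divergence F)"
  shows "tangential_field \<Omega> F"
proof -
  obtain M where M: "M > 0" "\<And>x. x \<in> closure \<Omega> \<Longrightarrow> norm x \<le> R \<Longrightarrow> \<bar>extension \<Omega> (divergence F) x\<bar> \<le> M"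
    using extension_bounded_on_ball[OF E, of R] by blast
  have "\<bar>divergence F x\<bar> \<le> M" if x: "x \<in> \<Omega>" for x
  proof (cases "norm x \<le> R")
    case True
    then show ?thesis using M(2)[of x] closure_subset x extension(2)[OF E x] by auto
  next
    case False
    have "pd i (F i) x = 0" for i
      by (rule pd_eq_0_open[of "\<Omega> \<inter> - cball 0 R"]) (use \<Omega> False x supp in auto)
    then show ?thesis using M(1) by (simp add: divergence_def)
  qed
  then show ?thesis unfolding tangential_field_def using assms by blast
qed

lemma set_integral_continuous_nonneg_zero:
  fixes g :: "real^2 \<Rightarrow> real"
  assumes "open \<Omega>" "continuous_on \<Omega> g" "\<And>x. x \<in> \<Omega> \<Longrightarrow> g x \<ge> 0"
    and "set_integrable lborel \<Omega> g" "(LINT x:\<Omega>|lborel. g x) \<le> 0" "x \<in> \<Omega>"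
  shows "g x = 0"
proof (rule ccontr)
  assume "g x \<noteq> 0"
  have nn: "AE x in lborel. 0 \<le> indicator \<Omega> x *\<^sub>R g x"
    using assms(3) by (auto simp: indicator_def)
  have "(LINT x|lborel. indicator \<Omega> x *\<^sub>R g x) = 0"
    using assms(5) integral_nonneg_AE[OF nn] by (simp add: set_lebesgue_integral_def)
  then have ae: "AE x in lborel. indicator \<Omega> x *\<^sub>R g x = 0"
    using integral_nonneg_eq_0_iff_AE[OF _ nn] assms(4) by (simp add: set_integrable_def)
  let ?S = "\<Omega> \<inter> g -` (- {0})"
  have S: "open ?S" using assms(1,2) continuous_on_open_vimage by (metis Int_commute open_Compl closed_singleton)
  have "AE x in lborel. x \<notin> ?S" using ae by eventually_elim (auto simp: indicator_def)
  then have "?S \<in> null_sets lborel" using S by (subst AE_iff_null_sets) auto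
  then have "negligible ?S" unfolding negligible_iff_null_sets by (rule null_sets_completionI)
  moreover have "?S \<noteq> {}" using \<open>g x \<noteq> 0\<close> assms(6) by auto
  ultimately show False using open_not_negligible[OF S] by blast
qed

text \<open>A form of Fatou's lemma for cutoffs that are eventually equal to 1 at each point.\<close>

lemma integrable_eventually_equal_limit:
  fixes f :: "nat \<Rightarrow> real^2 \<Rightarrow> real"
  assumes "\<And>n. integrable lborel (f n)" "\<And>n x. 0 \<le> f n x"
    and lim: "\<And>x. \<forall>\<^sub>F n in sequentially. f n x = u x"
    and bound: "\<forall>\<^sub>F n in sequentially. integral\<^sup>L lborel (f n) \<le> c"
  shows "integrable lborel u" "integral\<^sup>L lborel u \<le> c"
proof -
  have u0: "u x \<ge> 0" for x
    using eventually_happens[OF lim[of x]] assms(2) by (metis sequentially_bot)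
  have um: "u \<in> borel_measurable lborel"
    by (rule borel_measurable_LIMSEQ_real[of _ f]) (use lim assms(1) in \<open>auto intro: tendsto_eventually\<close>)
  have "0 \<le> c"
    using eventually_happens[OF bound] assms(2) by (metis sequentially_bot Bochner_Integration.integral_nonneg order_trans)
  have "(\<integral>\<^sup>+x. ennreal (u x) \<partial>lborel) = (\<integral>\<^sup>+x. liminf (\<lambda>n. ennreal (f n x)) \<partial>lborel)"
  proof (rule nn_integral_cong)
    fix x
    have "(\<lambda>n. ennreal (f n x)) \<longlonglongrightarrow> ennreal (u x)"
      by (rule tendsto_eventually) (use lim[of x] in \<open>auto elim: eventually_mono\<close>)
    then show "ennreal (u x) = liminf (\<lambda>n. ennreal (f n x))"
      by (simp add: lim_imp_Liminf)
  qed
  also have "\<dots> \<le> liminf (\<lambda>n. \<integral>\<^sup>+x. ennreal (f n x) \<partial>lborel)"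
    by (rule nn_integral_liminf) (use assms(1) in auto)
  also have "\<dots> \<le> liminf (\<lambda>n. ennreal c)"
  proof (rule Liminf_mono)
    show "\<forall>\<^sub>F n in sequentially. (\<integral>\<^sup>+x. ennreal (f n x) \<partial>lborel) \<le> ennreal c"
      using bound by eventually_elim (simp add: nn_integral_eq_integral assms ennreal_leI)
  qed
  also have "\<dots> = ennreal c" by (simp add: Liminf_const)
  finally have le: "(\<integral>\<^sup>+x. ennreal (u x) \<partial>lborel) \<le> ennreal c" .
  show "integrable lborel u"
    by (rule integrableI_bounded[OF um]) (use le u0 in \<open>auto simp: le_less_trans[OF _ ennreal_less_top]\<close>)
  then show "integral\<^sup>L lborel u \<le> c"
    using le \<open>0 \<le> c\<close> u0 by (simp add: nn_integral_eq_integral)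
qed

section \<open>The Caccioppoli inequality\<close>

lemma has_extension_sum:
  fixes f :: "'i \<Rightarrow> real^2 \<Rightarrow> real"
  assumes "finite I" "\<And>i. i \<in> I \<Longrightarrow> has_extension \<Omega> (f i)"
  shows "has_extension \<Omega> (\<lambda>x. \<Sum>i\<in>I. f i x)"
  using assms by (induction I rule: finite_induct) (auto intro!: has_extension_add has_extension_const)

text \<open>Apply the divergence theorem to \<open>\<eta>\<^sup>2 f \<nabla>f\<close> with a cutoff \<open>\<eta>\<close> at scale \<open>r\<close>.  Its divergence is
  \<open>\<eta>\<^sup>2 (\<bar>\<nabla>f\<bar>\<^sup>2 - \<mu> f\<^sup>2)\<close> plus a cross term that is absorbed into half of the first summand and a multiple of
  \<open>\<bar>\<nabla>\<eta>\<bar>\<^sup>2 f\<^sup>2\<close>, which is of order \<open>f\<^sup>2 / r\<^sup>2\<close>; then let \<open>r\<close> grow.  The boundary condition is stated as a product so that it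
  covers Dirichlet and Neumann data alike.\<close>

theorem caccioppoli:
  fixes f :: "real^2 \<Rightarrow> real"
  assumes smooth: "smooth_open_set \<Omega>" and f: "sub \<Omega> f" and \<mu>: "\<mu> \<ge> 0"
    and eq: "\<And>x. x \<in> \<Omega> \<Longrightarrow> laplacian f x = - \<mu> * f x"
    and L2: "set_integrable lborel \<Omega> (\<lambda>x. (f x)\<^sup>2)"
    and bd: "\<And>x. x \<in> frontier \<Omega> \<Longrightarrow>
      extension \<Omega> f x * (\<Sum>i\<in>UNIV. extension \<Omega> (pd i f) x * outward_normal \<Omega> x $ i) = 0"
  shows "set_integrable lborel \<Omega> (\<lambda>x. \<Sum>i\<in>UNIV. (pd i f x)\<^sup>2)"
    and "(LINT x:\<Omega>|lborel. (\<Sum>i\<in>UNIV. (pd i f x)\<^sup>2)) \<le> 2 * \<mu> * (LINT x:\<Omega>|lborel. (f x)\<^sup>2)"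
proof -
  have \<Omega>: "open \<Omega>" using smooth by (simp add: smooth_open_set_def)
  obtain M where M: "M > 0" "\<And>c r i x. r > 0 \<Longrightarrow> \<bar>pd i (bump c r) x\<bar> \<le> M / r"
    using pd_bump_bound by blast
  define G where "G x = (\<Sum>i\<in>UNIV. (pd i f x)\<^sup>2)" for x
  define J where "J = (LINT x:\<Omega>|lborel. (f x)\<^sup>2)"
  have J0: "J \<ge> 0" unfolding J_def set_lebesgue_integral_def by (rule Bochner_Integration.integral_nonneg) simp
  have Gc: "continuous_on \<Omega> G" unfolding G_def[abs_def]
    by (intro continuous_on_sum continuous_on_power sub_continuous sub_pd f)
  define b where "b r = bump 0 r" for r
  have bC: "C1_on V (b r)" for V r by (simp add: b_def bump_C1)
  have bb: "0 \<le> b r x" "b r x \<le> 1" for r x by (simp_all add: b_def bump_bounds)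
  have energy: "set_integrable lborel \<Omega> (\<lambda>x. (b r x)\<^sup>2 * G x) \<and>
      (LINT x:\<Omega>|lborel. (b r x)\<^sup>2 * G x) \<le> (2 * \<mu> + 8 * M\<^sup>2 / r\<^sup>2) * J" if r: "r > 0" for r
  proof -
    define F where "F i x = (b r x)\<^sup>2 * (f x * pd i f x)" for i x
    have b2C: "C1_on V (\<lambda>x. (b r x)\<^sup>2)" for V by (rule C1_on_power2[OF bC])
    have Hs: "sub \<Omega> (\<lambda>x. f x * pd i f x)" for i by (intro sub_mult[OF \<Omega>] f sub_pd)
    have FC: "C1_on \<Omega> (F i)" for i
      unfolding F_def[abs_def] by (intro C1_on_mult b2C sub_C1_on f sub_pd)
    have be: "has_extension \<Omega> (\<lambda>x. (b r x)\<^sup>2)"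
      by (rule has_extension_continuous[OF C1_onD(3)[OF b2C]])
    have FE: "has_extension \<Omega> (F i)" for i
      unfolding F_def[abs_def] by (intro has_extension_mult be sub_extension f sub_pd)
    have bnd: "(\<Sum>i\<in>UNIV. extension \<Omega> (F i) x * outward_normal \<Omega> x $ i) = 0" if x: "x \<in> frontier \<Omega>" for x
    proof -
      have xc: "x \<in> closure \<Omega>" by (rule frontier_open_limit(2)[OF \<Omega> x])
      have "extension \<Omega> (F i) x = extension \<Omega> (\<lambda>x. (b r x)\<^sup>2) x * (extension \<Omega> f x * extension \<Omega> (pd i f) x)" for i
        unfolding F_def[abs_def]
        by (simp add: extension_mult[OF \<Omega> be sub_extension[OF Hs] xc]
            extension_mult[OF \<Omega> sub_extension[OF f] sub_extension[OF sub_pd[OF f]] xc])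
      then have "(\<Sum>i\<in>UNIV. extension \<Omega> (F i) x * outward_normal \<Omega> x $ i) = extension \<Omega> (\<lambda>x. (b r x)\<^sup>2) x *
          (extension \<Omega> f x * (\<Sum>i\<in>UNIV. extension \<Omega> (pd i f) x * outward_normal \<Omega> x $ i))"
        by (simp add: sum_distrib_left mult.assoc)
      then show ?thesis using bd[OF x] by simp
    qed
    have bz: "b r x = 0" if "norm x > 2 * r" for x
      using bump_eq_0[of r 0 x] that r by (simp add: b_def)
    have div: "divergence F x = (b r x)\<^sup>2 * (G x - \<mu> * (f x)\<^sup>2) + (\<Sum>i\<in>UNIV. 2 * b r x * pd i (b r) x * (f x * pd i f x))"
      if x: "x \<in> \<Omega>" for x
    proof -
      have fd: "f differentiable (at x)" "pd i f differentiable (at x)" for i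
        using sub_differentiable f sub_pd x by blast+
      have bd: "b r differentiable (at x)" using C1_onD(1)[OF bC[of UNIV]] by simp
      have H: "pd i (\<lambda>x. f x * pd i f x) x = f x * pd i (pd i f) x + (pd i f x)\<^sup>2" for i
        using fd by (simp add: pd_mult power2_eq_square)
      have "divergence (\<lambda>i x. f x * pd i f x) x = f x * laplacian f x + G x"
        unfolding divergence_def H laplacian_def G_def by (simp add: sum.distrib sum_distrib_left)
      then have 1: "divergence (\<lambda>i x. f x * pd i f x) x = G x - \<mu> * (f x)\<^sup>2"
        using eq[OF x] by (simp add: power2_eq_square)
      have 2: "pd i (\<lambda>x. (b r x)\<^sup>2) x = 2 * b r x * pd i (b r) x" for i
        unfolding power2_eq_square using bd by (simp add: pd_mult)
      have "divergence F x = (b r x)\<^sup>2 * divergence (\<lambda>i x. f x * pd i f x) x + (\<Sum>i\<in>UNIV. pd i (\<lambda>x. (b r x)\<^sup>2) x * (f x * pd i f x))"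
        unfolding F_def[abs_def]
        by (rule divergence_mult) (use C1_onD(1)[OF b2C[of UNIV]] fd in \<open>auto intro!: differentiable_mult\<close>)
      then show ?thesis unfolding 1 2 .
    qed
    have T: "tangential_field \<Omega> F"
    proof (rule tangential_fieldI[OF \<Omega> FC FE bnd, of "2 * r"])
      show "F i x = 0" if "norm x > 2 * r" for i x using bz[OF that] by (simp add: F_def)
      have "has_extension \<Omega> (\<lambda>x. (b r x)\<^sup>2 * (G x + (- \<mu>) * (f x * f x)) + (\<Sum>i\<in>UNIV. 2 * b r x * pd i (b r) x * (f x * pd i f x)))"
        unfolding G_def power2_eq_square[of "pd _ f _"]
        by (intro has_extension_add has_extension_mult has_extension_sum be has_extension_const sub_extension
            f sub_pd finite has_extension_continuous[OF C1_onD(3)[OF bC]] has_extension_continuous[OF C1_onD(2)[OF bC]])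
      then show "has_extension \<Omega> (divergence F)"
        by (rule has_extension_congI) (simp add: div power2_eq_square)
    qed
    define c where "c = \<mu> + 4 * M\<^sup>2 / r\<^sup>2"
    have le: "(b r x)\<^sup>2 * G x \<le> 2 * (divergence F x + c * (f x)\<^sup>2)" if x: "x \<in> \<Omega>" for x
    proof -
      have t: "- (2 * b r x * pd i (b r) x * (f x * pd i f x)) \<le> (b r x)\<^sup>2 * (pd i f x)\<^sup>2 / 2 + 2 * M\<^sup>2 / r\<^sup>2 * (f x)\<^sup>2" for i
      proof -
        \<comment> \<open>the weights split the cross term into half of the leading term and a remainder\<close>
        have "0 \<le> (b r x * pd i f x + 2 * (pd i (b r) x * f x))\<^sup>2" by simp
        then have "- (2 * b r x * pd i (b r) x * (f x * pd i f x)) \<le> (b r x)\<^sup>2 * (pd i f x)\<^sup>2 / 2 + 2 * (pd i (b r) x)\<^sup>2 * (f x)\<^sup>2"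
          by (simp add: power2_eq_square algebra_simps)
        moreover have "(pd i (b r) x)\<^sup>2 \<le> (M / r)\<^sup>2"
          using M(2)[OF r] unfolding b_def by (metis power2_abs power_mono abs_ge_zero)
        then have "2 * (pd i (b r) x)\<^sup>2 * (f x)\<^sup>2 \<le> 2 * (M / r)\<^sup>2 * (f x)\<^sup>2"
          by (intro mult_right_mono mult_left_mono) auto
        ultimately show ?thesis by (simp add: power_divide)
      qed
      have "- (\<Sum>i\<in>UNIV. 2 * b r x * pd i (b r) x * (f x * pd i f x))
          \<le> (\<Sum>i\<in>UNIV. (b r x)\<^sup>2 * (pd i f x)\<^sup>2 / 2 + 2 * M\<^sup>2 / r\<^sup>2 * (f x)\<^sup>2)"
        unfolding sum_negf[symmetric] by (rule sum_mono) (rule t)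
      also have "\<dots> = (b r x)\<^sup>2 * G x / 2 + 4 * M\<^sup>2 / r\<^sup>2 * (f x)\<^sup>2"
        by (simp add: G_def sum_2 algebra_simps add_divide_distrib)
      finally have "(b r x)\<^sup>2 * G x / 2 \<le> divergence F x + (b r x)\<^sup>2 * (\<mu> * (f x)\<^sup>2) + 4 * M\<^sup>2 / r\<^sup>2 * (f x)\<^sup>2"
        unfolding div[OF x] by (simp add: algebra_simps)
      moreover have "(b r x)\<^sup>2 * (\<mu> * (f x)\<^sup>2) \<le> 1 * (\<mu> * (f x)\<^sup>2)"
        using bb[of r x] \<mu> by (intro mult_right_mono) (auto simp: power_le_one)
      ultimately show ?thesis by (simp add: c_def algebra_simps)
    qed
    have dom: "set_integrable lborel \<Omega> (\<lambda>x. 2 * (divergence F x + c * (f x)\<^sup>2))"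
      by (intro set_integrable_mult_right set_integral_add tangential_field_integrable[OF \<Omega> T] L2)
    have int: "set_integrable lborel \<Omega> (\<lambda>x. (b r x)\<^sup>2 * G x)"
    proof -
      have "continuous_on \<Omega> (\<lambda>x. (b r x)\<^sup>2 * G x)"
        by (intro continuous_on_mult Gc C1_onD(3)[OF b2C])
      then have m: "(\<lambda>x. indicator \<Omega> x *\<^sub>R ((b r x)\<^sup>2 * G x)) \<in> borel_measurable lborel"
        using borel_measurable_continuous_on_indicator[of \<Omega> "\<lambda>x. (b r x)\<^sup>2 * G x"] \<Omega> by simp
      have G0: "G x \<ge> 0" for x by (simp add: G_def sum_nonneg)
      show ?thesis unfolding set_integrable_def
        by (rule Bochner_Integration.integrable_bound[OF dom[unfolded set_integrable_def] m])
          (use le G0 in \<open>auto simp: indicator_def intro!: AE_I2 order_trans[OF _ abs_ge_self]\<close>)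
    qed
    have "(LINT x:\<Omega>|lborel. (b r x)\<^sup>2 * G x) \<le> (LINT x:\<Omega>|lborel. 2 * (divergence F x + c * (f x)\<^sup>2))"
      by (rule set_integral_mono[OF int dom le])
    also have "\<dots> = 2 * ((LINT x:\<Omega>|lborel. divergence F x) + c * J)"
      unfolding J_def using tangential_field_integrable[OF \<Omega> T] L2
      by (simp add: set_integral_add)
    also have "\<dots> = (2 * \<mu> + 8 * M\<^sup>2 / r\<^sup>2) * J"
      unfolding divergence_theorem_tangential[OF smooth T] c_def by (simp add: algebra_simps)
    finally show ?thesis using int by simp
  qed
  define h where "h n x = indicator \<Omega> x *\<^sub>R ((b (real (Suc n)) x)\<^sup>2 * G x)" for n x
  have hi: "integrable lborel (h n)" and hb: "integral\<^sup>L lborel (h n) \<le> (2 * \<mu> + 8 * M\<^sup>2 / (real (Suc n))\<^sup>2) * J" for n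
    using energy[of "real (Suc n)"] unfolding h_def[abs_def] set_integrable_def set_lebesgue_integral_def by simp_all
  have h0: "0 \<le> h n x" for n x by (simp add: h_def G_def sum_nonneg)
  have hl: "\<forall>\<^sub>F n in sequentially. h n x = indicator \<Omega> x *\<^sub>R G x" for x
  proof -
    obtain N :: nat where "norm x < real N" using reals_Archimedean2 by blast
    then have "b (real (Suc n)) x = 1" if "n \<ge> N" for n
      using that by (simp add: b_def bump_eq_1)
    then show ?thesis unfolding eventually_sequentially h_def by (intro exI[of _ N]) simp
  qed
  have hb': "\<forall>\<^sub>F n in sequentially. integral\<^sup>L lborel (h n) \<le> 2 * \<mu> * J + e" if "e > 0" for e
  proof -
    have "(\<lambda>n. (2 * \<mu> + 8 * M\<^sup>2 / (real (Suc n))\<^sup>2) * J) \<longlonglongrightarrow> (2 * \<mu> + 0) * J"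
      by (intro tendsto_intros) (rule LIMSEQ_Suc, real_asymp)
    then have "\<forall>\<^sub>F n in sequentially. (2 * \<mu> + 8 * M\<^sup>2 / (real (Suc n))\<^sup>2) * J < 2 * \<mu> * J + e"
      by (rule order_tendstoD) (use that in simp)
    then show ?thesis by eventually_elim (use hb in \<open>meson less_imp_le order_trans\<close>)
  qed
  note lim = integrable_eventually_equal_limit[OF hi h0 hl hb']
  show "set_integrable lborel \<Omega> (\<lambda>x. \<Sum>i\<in>UNIV. (pd i f x)\<^sup>2)"
    using lim(1)[of 1] by (simp add: set_integrable_def G_def)
  have "(LINT x:\<Omega>|lborel. G x) \<le> 2 * \<mu> * J"
    by (rule field_le_epsilon) (use lim(2) in \<open>simp add: set_lebesgue_integral_def\<close>)
  then show "(LINT x:\<Omega>|lborel. (\<Sum>i\<in>UNIV. (pd i f x)\<^sup>2)) \<le> 2 * \<mu> * (LINT x:\<Omega>|lborel. (f x)\<^sup>2)"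
    by (simp add: G_def J_def)
qed

text \<open>For \<open>\<mu> = 0\<close> the bound in the Caccioppoli inequality is zero.\<close>

corollary harmonic_L2_gradient_zero:
  fixes f :: "real^2 \<Rightarrow> real"
  assumes smooth: "smooth_open_set \<Omega>" and f: "sub \<Omega> f"
    and eq: "\<And>x. x \<in> \<Omega> \<Longrightarrow> laplacian f x = 0"
    and L2: "set_integrable lborel \<Omega> (\<lambda>x. (f x)\<^sup>2)"
    and bd: "\<And>x. x \<in> frontier \<Omega> \<Longrightarrow>
      extension \<Omega> f x * (\<Sum>i\<in>UNIV. extension \<Omega> (pd i f) x * outward_normal \<Omega> x $ i) = 0"
    and x: "x \<in> \<Omega>"
  shows "pd i f x = 0"
proof -
  have \<Omega>: "open \<Omega>" using smooth by (simp add: smooth_open_set_def)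
  have "laplacian f x = - 0 * f x" if "x \<in> \<Omega>" for x using eq[OF that] by simp
  note C = caccioppoli[where \<mu> = 0, OF smooth f order_refl this L2 bd]
  have "continuous_on \<Omega> (\<lambda>x. \<Sum>i\<in>UNIV. (pd i f x)\<^sup>2)"
    by (intro continuous_on_sum continuous_on_power sub_continuous sub_pd f)
  from set_integral_continuous_nonneg_zero[OF \<Omega> this _ C(1) _ x] C(2)
  have "(\<Sum>i\<in>UNIV. (pd i f x)\<^sup>2) = 0" by (simp add: sum_nonneg)
  then show ?thesis by (simp add: sum_nonneg_eq_0_iff)
qed

section \<open>Gradients at the boundary\<close>

text \<open>The continuous extension of the gradient to the closure.\<close>

definition bgrad :: "(real^2) set \<Rightarrow> (real^2 \<Rightarrow> real) \<Rightarrow> real^2 \<Rightarrow> real^2"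
  where "bgrad \<Omega> f x = (\<chi> i. extension \<Omega> (pd i f) x)"

lemma bgrad:
  assumes "sub \<Omega> f"
  shows "continuous_on (closure \<Omega>) (bgrad \<Omega> f)" "x \<in> \<Omega> \<Longrightarrow> bgrad \<Omega> f x = grad f x"
  using extension[OF sub_extension[OF sub_pd[OF assms]]]
  by (auto simp: bgrad_def[abs_def] grad_def intro!: continuous_on_vec_lambda)

lemma has_extension_grad_inner:
  assumes "sub \<Omega> f"
  shows "has_extension \<Omega> (\<lambda>y. grad f y \<bullet> n)"
  unfolding has_extension_def
  by (intro exI[of _ "\<lambda>y. bgrad \<Omega> f y \<bullet> n"] conjI continuous_intros bgrad(1)[OF assms])
    (simp add: bgrad(2)[OF assms])

lemma has_normal_derivative_iff:
  assumes "open \<Omega>" "sub \<Omega> f" "x \<in> frontier \<Omega>"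
  shows "has_normal_derivative \<Omega> f x d \<longleftrightarrow> bgrad \<Omega> f x \<bullet> outward_normal \<Omega> x = d"
proof -
  have "extension \<Omega> (\<lambda>y. grad f y \<bullet> outward_normal \<Omega> x) x = bgrad \<Omega> f x \<bullet> outward_normal \<Omega> x"
    by (rule extension_eqI[OF assms(1) _ _ frontier_open_limit(2)[OF assms(1,3)]])
      (auto intro!: continuous_intros bgrad(1)[OF assms(2)] simp: bgrad(2)[OF assms(2)])
  then show ?thesis unfolding has_normal_derivative_def
    using has_trace_iff_extension[OF assms(1) has_extension_grad_inner[OF assms(2)] assms(3)] by simp
qed

lemma bgrad_inner: "bgrad \<Omega> f x \<bullet> n = (\<Sum>i\<in>UNIV. extension \<Omega> (pd i f) x * n $ i)"
  by (simp add: bgrad_def inner_vec_def)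

text \<open>The mean value inequality along a segment that lies in \<open>\<Omega>\<close> except possibly for its first endpoint, which may be a boundary point.\<close>

lemma segment_increment_bound:
  fixes f :: "real^2 \<Rightarrow> real"
  assumes f: "C1_on \<Omega> f" and E: "has_extension \<Omega> f"
    and x: "x \<in> closure \<Omega>" and seg: "\<And>t. 0 < t \<Longrightarrow> t \<le> 1 \<Longrightarrow> x + t *\<^sub>R (y - x) \<in> \<Omega>"
    and le: "\<And>t. 0 < t \<Longrightarrow> t < 1 \<Longrightarrow> norm (grad f (x + t *\<^sub>R (y - x))) \<le> M"
  shows "\<bar>extension \<Omega> f y - extension \<Omega> f x\<bar> \<le> M * norm (y - x)"
proof -
  let ?p = "\<lambda>t. x + t *\<^sub>R (y - x)"
  let ?\<phi> = "\<lambda>t. extension \<Omega> f (?p t)"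
  have pc: "?p t \<in> closure \<Omega>" if "t \<in> {0..1}" for t
    using x seg[of t] that closure_subset by (cases "t = 0") auto
  have "continuous_on {0..1} ?\<phi>"
    by (rule continuous_on_compose2[OF extension(1)[OF E]]) (use pc in \<open>auto intro!: continuous_intros\<close>)
  moreover have D: "(?\<phi> has_real_derivative grad f (?p t) \<bullet> (y - x)) (at t)" if "0 < t" "t < 1" for t
  proof (rule has_field_derivative_transform_within_open[where S = "{0<..<1}"])
    show "((\<lambda>t. f (?p t)) has_real_derivative grad f (?p t) \<bullet> (y - x)) (at t)"
      by (rule real_derivative_along_line) (use C1_onD(1)[OF f] seg that in auto)
  qed (use that seg extension(2)[OF E] in auto)
  moreover have "?\<phi> differentiable (at t)" if "0 < t" "t < 1" for t
    using D[OF that] real_differentiable_def by blast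
  ultimately obtain l t where t: "0 < t" "t < 1" "(?\<phi> has_real_derivative l) (at t)" "?\<phi> 1 - ?\<phi> 0 = (1 - 0) * l"
    using MVT[of 0 1 ?\<phi>] by auto
  then have "l = grad f (?p t) \<bullet> (y - x)" using D DERIV_unique by blast
  then have "\<bar>?\<phi> 1 - ?\<phi> 0\<bar> = \<bar>grad f (?p t) \<bullet> (y - x)\<bar>" using t(4) by simp
  also have "\<dots> \<le> norm (grad f (?p t)) * norm (y - x)" by (rule Cauchy_Schwarz_ineq2)
  also have "\<dots> \<le> M * norm (y - x)" using le[OF t(1,2)] by (intro mult_right_mono) auto
  finally show ?thesis by simp
qed

lemma first_exit:
  fixes p q :: "real^2"
  assumes "open \<Omega>" "p \<in> \<Omega>" "q \<notin> \<Omega>"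
  obtains t where "0 < t" "t \<le> 1" "p + t *\<^sub>R (q - p) \<in> frontier \<Omega>"
    "\<And>s. 0 \<le> s \<Longrightarrow> s < t \<Longrightarrow> p + s *\<^sub>R (q - p) \<in> \<Omega>"
proof -
  let ?z = "\<lambda>s. p + s *\<^sub>R (q - p)"
  let ?S = "{0..1} \<inter> ?z -` (- \<Omega>)"
  have zc: "continuous_on X ?z" for X by (intro continuous_intros)
  have "closed ?S" by (rule continuous_closed_preimage[OF zc]) (use assms(1) in auto)
  then have S: "compact ?S" using compact_Int_closed[of "{0..1::real}" ?S] by (simp add: Int_absorb1 inf_commute)
  have "1 \<in> ?S" using assms(3) by simp
  then obtain t where t: "t \<in> ?S" "\<And>s. s \<in> ?S \<Longrightarrow> t \<le> s"
    using compact_attains_inf[OF S] by blast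
  have inside: "?z s \<in> \<Omega>" if "0 \<le> s" "s < t" for s
    using t(2)[of s] t(1) that by force
  have "t \<noteq> 0" using t(1) assms(2) by auto
  then have t0: "0 < t" "t \<le> 1" using t(1) by auto
  have "?z ` closure {0..<t} \<subseteq> closure \<Omega>"
    by (rule image_closure_subset[OF zc]) (use inside closure_subset[of \<Omega>] in \<open>auto intro: subsetD\<close>)
  then have "?z t \<in> closure \<Omega>" using t0 by (simp add: image_subset_iff)
  then have "?z t \<in> frontier \<Omega>" using t(1) assms(1) by (auto simp: frontier_def interior_open)
  then show thesis using that t0 inside by blast
qed

text \<open>Going from an inner point towards an outer one, the boundary is met before the segment ends; so the value of \<open>f\<close> inside is close to a boundary value whenever an outer point is close.\<close>

lemma boundary_increment_bound:
  fixes f :: "real^2 \<Rightarrow> real"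
  assumes \<Omega>: "open \<Omega>" and f: "C1_on \<Omega> f" and E: "has_extension \<Omega> f"
    and pq: "p \<in> \<Omega>" "q \<notin> \<Omega>" "p \<in> ball c r" "q \<in> ball c r"
    and le: "\<And>x. x \<in> \<Omega> \<Longrightarrow> x \<in> ball c r \<Longrightarrow> norm (grad f x) \<le> M"
  obtains z where "z \<in> frontier \<Omega>" "z \<in> ball c r" "\<bar>f p - extension \<Omega> f z\<bar> \<le> M * norm (p - q)"
proof -
  obtain t where t: "0 < t" "t \<le> 1" "p + t *\<^sub>R (q - p) \<in> frontier \<Omega>"
    "\<And>s. 0 \<le> s \<Longrightarrow> s < t \<Longrightarrow> p + s *\<^sub>R (q - p) \<in> \<Omega>"
    using first_exit[OF \<Omega> pq(1,2)] by blast
  define z where "z = p + t *\<^sub>R (q - p)"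
  have inball: "p + s *\<^sub>R (q - p) \<in> ball c r" if "0 \<le> s" "s \<le> 1" for s
  proof -
    have "(1 - s) *\<^sub>R p + s *\<^sub>R q \<in> ball c r"
      by (rule convexD[OF convex_ball pq(3,4)]) (use that in auto)
    then show ?thesis by (simp add: algebra_simps)
  qed
  have eq: "z + \<tau> *\<^sub>R (p - z) = p + (t * (1 - \<tau>)) *\<^sub>R (q - p)" for \<tau>
    by (simp add: z_def algebra_simps)
  have rng: "0 \<le> t * (1 - \<tau>)" "t * (1 - \<tau>) < t" if "0 < \<tau>" "\<tau> \<le> 1" for \<tau>
    using that t by (auto simp: algebra_simps)
  have zf: "z \<in> frontier \<Omega>" using t(3) by (simp add: z_def)
  have M0: "M \<ge> 0" using le[OF pq(1,3)] norm_ge_zero order_trans by blast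
  have "\<bar>extension \<Omega> f p - extension \<Omega> f z\<bar> \<le> M * norm (p - z)"
  proof (rule segment_increment_bound[OF f E frontier_open_limit(2)[OF \<Omega> zf]])
    fix \<tau> :: real assume \<tau>: "0 < \<tau>" "\<tau> \<le> 1"
    show "z + \<tau> *\<^sub>R (p - z) \<in> \<Omega>" unfolding eq by (intro t(4) rng \<tau>)
  next
    fix \<tau> :: real assume \<tau>: "0 < \<tau>" "\<tau> < 1"
    show "norm (grad f (z + \<tau> *\<^sub>R (p - z))) \<le> M" unfolding eq
      using rng[OF \<tau>(1) less_imp_le[OF \<tau>(2)]] t(2) by (intro le t(4) inball) auto
  qed
  also have "\<dots> \<le> M * norm (p - q)"
  proof (rule mult_left_mono[OF _ M0])
    have "norm (p - z) = t * norm (q - p)" using t(1) by (simp add: z_def)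
    also have "\<dots> \<le> 1 * norm (q - p)" using t(2) by (intro mult_right_mono) auto
    finally show "norm (p - z) \<le> norm (p - q)" by (simp add: norm_minus_commute)
  qed
  finally have "\<bar>f p - extension \<Omega> f z\<bar> \<le> M * norm (p - q)" using extension(2)[OF E pq(1)] by simp
  moreover have "z \<in> ball c r" using inball[of t] t by (simp add: z_def)
  ultimately show thesis using that zf by blast
qed

lemma grad_near_boundary_point:
  assumes "sub \<Omega> f" "x \<in> closure \<Omega>" "e > 0"
  obtains \<delta> where "\<delta> > 0" "\<And>y. y \<in> \<Omega> \<Longrightarrow> y \<in> ball x \<delta> \<Longrightarrow> norm (grad f y - bgrad \<Omega> f x) \<le> e"
proof -
  obtain \<delta> where "\<delta> > 0" "\<And>y. y \<in> closure \<Omega> \<Longrightarrow> dist y x < \<delta> \<Longrightarrow> dist (bgrad \<Omega> f y) (bgrad \<Omega> f x) < e"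
    using bgrad(1)[OF assms(1)] assms(2,3) unfolding continuous_on_iff by metis
  then show thesis
    using that[of \<delta>] bgrad(2)[OF assms(1)] closure_subset[of \<Omega>]
    by (metis dist_commute dist_norm less_imp_le mem_ball subsetD)
qed

text \<open>Suppose \<open>f\<close> has a constant trace and a tangential direction \<open>d\<close> is given.  Tilt \<open>d\<close> a
  little inwards and a little outwards: moving a distance \<open>t\<close> inwards, \<open>f\<close> changes by about \<open>t\<close>
  times its derivative in the direction \<open>d\<close>, while the outward point at nearly the same place
  shows that \<open>f\<close> stays close to its boundary value.\<close>

lemma constant_trace_tangential_derivative:
  fixes f :: "real^2 \<Rightarrow> real"
  assumes \<Omega>: "open \<Omega>" and f: "sub \<Omega> f" and df: "defining_function \<Omega> x U \<rho>" and x: "x \<in> frontier \<Omega>"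
    and tr: "\<And>y. y \<in> frontier \<Omega> \<Longrightarrow> extension \<Omega> f y = c"
    and d: "grad \<rho> x \<bullet> d = 0"
  shows "bgrad \<Omega> f x \<bullet> d = 0"
proof -
  define N where "N = grad \<rho> x"
  define g where "g = bgrad \<Omega> f x"
  define M where "M = norm g + 1"
  have xc: "x \<in> closure \<Omega>" by (rule frontier_open_limit(2)[OF \<Omega> x])
  have NN: "N \<bullet> N > 0" using defining_functionD(4)[OF df] defining_functionD(2)[OF df] by (simp add: N_def)
  have fC: "C1_on \<Omega> f" and fE: "has_extension \<Omega> f" using f sub_C1_on sub_extension by auto
  have "\<bar>g \<bullet> d\<bar> \<le> e * (\<bar>g \<bullet> N\<bar> + 2 * M * norm N + norm d + norm N)" if e: "0 < e" "e \<le> 1" for e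
  proof -
    define d1 where "d1 = d - e *\<^sub>R N"
    define d2 where "d2 = d + e *\<^sub>R N"
    have neg: "grad \<rho> x \<bullet> d1 < 0" and pos: "grad \<rho> x \<bullet> d2 > 0"
      using d NN e by (auto simp: d1_def d2_def inner_diff_right inner_add_right N_def[symmetric])
    obtain \<delta> where \<delta>: "\<delta> > 0" "\<And>y. y \<in> \<Omega> \<Longrightarrow> y \<in> ball x \<delta> \<Longrightarrow> norm (grad f y - g) \<le> e"
      using grad_near_boundary_point[OF f xc e(1)] unfolding g_def by blast
    have M: "norm (grad f y) \<le> M" if "y \<in> \<Omega>" "y \<in> ball x \<delta>" for y
      using \<delta>(2)[OF that] e(2) norm_triangle_sub[of "grad f y" g] by (simp add: M_def)
    have near: "\<forall>\<^sub>F t in at_right 0. x + t *\<^sub>R v \<in> ball x \<delta>" for v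
    proof -
      have "((\<lambda>t. x + t *\<^sub>R v) \<longlongrightarrow> x + 0 *\<^sub>R v) (at_right 0)" by (intro tendsto_intros)
      then show ?thesis by (rule topological_tendstoD) (use \<delta>(1) in auto)
    qed
    have "\<forall>\<^sub>F t in at_right 0. x + t *\<^sub>R d1 \<in> \<Omega>"
      by (rule direction_enters(1)[OF \<Omega> df x neg])
    then obtain t0 where t0: "t0 > 0" "\<And>t. 0 < t \<Longrightarrow> t < t0 \<Longrightarrow> x + t *\<^sub>R d1 \<in> \<Omega>"
      unfolding eventually_at_right_field by auto
    have "\<forall>\<^sub>F t in at_right (0::real). 0 < t \<and> t < t0"
      using t0(1) by (auto simp: eventually_at_right_field)
    with direction_enters(2)[OF \<Omega> df x pos] near[of d1] near[of d2]
    have "\<forall>\<^sub>F t in at_right 0. 0 < t \<and> t < t0 \<and> x + t *\<^sub>R d2 \<notin> \<Omega> \<and>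
        x + t *\<^sub>R d1 \<in> ball x \<delta> \<and> x + t *\<^sub>R d2 \<in> ball x \<delta>"
      by eventually_elim auto
    then obtain t where t: "0 < t" "t < t0" "x + t *\<^sub>R d2 \<notin> \<Omega>" "x + t *\<^sub>R d1 \<in> ball x \<delta>" "x + t *\<^sub>R d2 \<in> ball x \<delta>"
      using eventually_happens by (metis (mono_tags, lifting) trivial_limit_at_right_real)
    define p where "p = x + t *\<^sub>R d1"
    have p: "p \<in> \<Omega>" "p \<in> ball x \<delta>" using t0(2) t by (auto simp: p_def)
    obtain z where z: "z \<in> frontier \<Omega>" "\<bar>f p - extension \<Omega> f z\<bar> \<le> M * norm (p - (x + t *\<^sub>R d2))"
      using boundary_increment_bound[OF \<Omega> fC fE p(1) t(3) p(2) t(5) M] by blast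
    have "p - (x + t *\<^sub>R d2) = (- 2 * t * e) *\<^sub>R N" by (simp add: p_def d1_def d2_def vec_eq_iff algebra_simps)
    then have fp: "\<bar>f p - c\<bar> \<le> M * (2 * t * e * norm N)"
      using z tr[OF z(1)] t(1) e(1) by (simp add: abs_mult)
    \<comment> \<open>without its linear part at \<open>x\<close>, \<open>f\<close> has a small gradient near \<open>x\<close>\<close>
    define f2 where "f2 y = f y - g \<bullet> (y - x)" for y
    have linC: "C1_on V (\<lambda>y. g \<bullet> (y - x))" and lind: "(\<lambda>y. g \<bullet> (y - x)) differentiable (at y)"
      and linpd: "pd i (\<lambda>y. g \<bullet> (y - x)) y = g $ i" for V y i
    proof -
      have D: "((\<lambda>y. g \<bullet> (y - x)) has_derivative (\<lambda>h. g \<bullet> h)) (at y)" for y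
        by (auto intro!: derivative_eq_intros)
      show 1: "(\<lambda>y. g \<bullet> (y - x)) differentiable (at y)" for y using D differentiable_def by blast
      show 2: "pd i (\<lambda>y. g \<bullet> (y - x)) y = g $ i" for y i using pd_eqI[OF D] by (simp add: inner_axis)
      show "C1_on V (\<lambda>y. g \<bullet> (y - x))"
        by (rule C1_onI[where g = "\<lambda>i y. g $ i"]) (auto simp: 1 2)
    qed
    have f2C: "C1_on \<Omega> f2" unfolding f2_def[abs_def] by (intro C1_on_diff fC linC)
    have f2E: "has_extension \<Omega> f2"
      unfolding has_extension_def f2_def
      by (intro exI[of _ "\<lambda>y. extension \<Omega> f y - g \<bullet> (y - x)"] conjI continuous_intros extension(1)[OF fE])
        (simp add: extension(2)[OF fE])
    have f2x: "extension \<Omega> f2 x = c"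
      by (subst extension_eqI[OF \<Omega> _ _ xc, of "\<lambda>y. extension \<Omega> f y - g \<bullet> (y - x)"])
        (auto intro!: continuous_intros extension(1)[OF fE] simp: extension(2)[OF fE] f2_def tr[OF x])
    have gr: "grad f2 y = grad f y - g" if "y \<in> \<Omega>" for y
      unfolding f2_def[abs_def] grad_def using C1_onD(1)[OF fC that]
      by (simp add: vec_eq_iff pd_diff lind linpd)
    have "\<bar>extension \<Omega> f2 p - extension \<Omega> f2 x\<bar> \<le> e * norm (p - x)"
    proof (rule segment_increment_bound[OF f2C f2E xc])
      fix s :: real assume s: "0 < s" "s \<le> 1"
      have "s * t \<le> t" using s t(1) by simp
      then have "s * t < t0" using t(2) by linarith
      then show "x + s *\<^sub>R (p - x) \<in> \<Omega>" using t0(2)[of "s * t"] s t(1) by (simp add: p_def)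
    next
      fix s :: real assume s: "0 < s" "s < 1"
      have "s * t \<le> t" using s t(1) by simp
      then have "s * t < t0" using t(2) by linarith
      then have i: "x + s *\<^sub>R (p - x) \<in> \<Omega>" using t0(2)[of "s * t"] s t(1) by (simp add: p_def)
      have "s * norm (p - x) \<le> 1 * norm (p - x)" using s by (intro mult_right_mono) auto
      then have "x + s *\<^sub>R (p - x) \<in> ball x \<delta>" using p(2) s by (simp add: dist_norm norm_minus_commute)
      then show "norm (grad f2 (x + s *\<^sub>R (p - x))) \<le> e" using \<delta>(2) i gr by simp
    qed
    then have "\<bar>f p - g \<bullet> (p - x) - c\<bar> \<le> e * norm (p - x)"
      using extension(2)[OF f2E p(1)] f2x by (simp add: f2_def)
    moreover have "norm (p - x) = t * norm d1" using t(1) by (simp add: p_def)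
    moreover have "g \<bullet> (p - x) = t * (g \<bullet> d - e * (g \<bullet> N))"
      by (simp add: p_def d1_def inner_diff_right)
    ultimately have "\<bar>t * (g \<bullet> d - e * (g \<bullet> N))\<bar> \<le> e * (t * norm d1) + M * (2 * t * e * norm N)"
      using fp by simp
    then have "t * \<bar>g \<bullet> d - e * (g \<bullet> N)\<bar> \<le> t * (e * norm d1 + M * (2 * e * norm N))"
      unfolding abs_mult using t(1) by (simp add: distrib_left mult_ac)
    then have "\<bar>g \<bullet> d - e * (g \<bullet> N)\<bar> \<le> e * norm d1 + M * (2 * e * norm N)"
      using t(1) by simp
    moreover have "norm d1 \<le> norm d + norm N"
    proof -
      have "norm d1 \<le> norm d + e * norm N"
        using norm_triangle_ineq4[of d "e *\<^sub>R N"] e(1) by (simp add: d1_def)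
      moreover have "e * norm N \<le> 1 * norm N" using e(2) by (intro mult_right_mono) auto
      ultimately show ?thesis by simp
    qed
    then have "e * norm d1 \<le> e * (norm d + norm N)" using e(1) by (intro mult_left_mono) auto
    moreover have "\<bar>g \<bullet> d\<bar> \<le> \<bar>g \<bullet> d - e * (g \<bullet> N)\<bar> + e * \<bar>g \<bullet> N\<bar>"
      using e(1) abs_triangle_ineq[of "g \<bullet> d - e * (g \<bullet> N)" "e * (g \<bullet> N)"] by (simp add: abs_mult)
    ultimately show ?thesis by (simp add: algebra_simps)
  qed
  note bound = this
  define A where "A = \<bar>g \<bullet> N\<bar> + 2 * M * norm N + norm d + norm N"
  have "((\<lambda>e. e * A) \<longlongrightarrow> 0 * A) (at_right 0)" by (intro tendsto_intros)
  moreover have "\<forall>\<^sub>F e in at_right (0::real). \<bar>g \<bullet> d\<bar> \<le> e * A"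
    unfolding eventually_at_right_field A_def by (intro exI[of _ 1]) (auto intro: bound)
  ultimately have "\<bar>g \<bullet> d\<bar> \<le> 0 * A"
    by (rule tendsto_lowerbound) simp
  then show ?thesis by (simp add: g_def)
qed

text \<open>A constant trace kills the tangential component of the gradient and the Neumann condition the normal one.\<close>

corollary constant_trace_gradient_zero:
  fixes f :: "real^2 \<Rightarrow> real"
  assumes smooth: "smooth_open_set \<Omega>" and f: "sub \<Omega> f" and x: "x \<in> frontier \<Omega>"
    and tr: "\<And>y. y \<in> frontier \<Omega> \<Longrightarrow> extension \<Omega> f y = c"
    and N: "bgrad \<Omega> f x \<bullet> outward_normal \<Omega> x = 0"
  shows "bgrad \<Omega> f x = 0"
proof -
  have \<Omega>: "open \<Omega>" using smooth by (simp add: smooth_open_set_def)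
  obtain U \<rho> where df: "defining_function \<Omega> x U \<rho>" using smooth x unfolding smooth_open_set_def by blast
  let ?g = "bgrad \<Omega> f x" and ?n = "grad \<rho> x"
  have n: "?n \<noteq> 0" using defining_functionD(2,4)[OF df] by blast
  have gn: "?g \<bullet> ?n = 0" using N n by (simp add: outward_normal_eq[OF \<Omega> df x])
  then have "?g \<bullet> ?g = 0"
    using constant_trace_tangential_derivative[OF \<Omega> f df x tr, of ?g] by (simp add: inner_commute)
  then show ?thesis by simp
qed


section \<open>The Stokes system in components\<close>

lemma sub_pd_commute:
  fixes f :: "real^2 \<Rightarrow> real"
  assumes "open \<Omega>" "sub \<Omega> f" "x \<in> \<Omega>"
  shows "pd i (pd j f) x = pd j (pd i f) x"
  by (rule pd_commute[OF assms(1,3)]) (intro sub_C1_on sub_pd assms)+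

lemma laplacian_2: "laplacian f x = pd 1 (pd 1 f) x + pd 2 (pd 2 f) x"
  by (simp add: laplacian_def sum_2)

lemma laplacian_nth:
  fixes u :: "real^2 \<Rightarrow> real^'n"
  assumes "open \<Omega>" "sub \<Omega> u" "x \<in> \<Omega>"
  shows "laplacian u x $ k = laplacian (\<lambda>x. u x $ k) x"
  using pds_nth[OF assms, of "[1, 1]" k] pds_nth[OF assms, of "[2, 2]" k]
  by (simp add: laplacian_2 pds_Cons)

definition vorticity :: "(2 \<Rightarrow> real^2 \<Rightarrow> real) \<Rightarrow> real^2 \<Rightarrow> real"
  where "vorticity w x = pd 1 (w 2) x - pd 2 (w 1) x"

text \<open>The Stokes system for a velocity given by its two scalar components, without boundary conditions and energies.\<close>

definition stokes_components :: "(real^2) set \<Rightarrow> real \<Rightarrow> (2 \<Rightarrow> real^2 \<Rightarrow> real) \<Rightarrow> (real^2 \<Rightarrow> real) \<Rightarrow> bool"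
  where "stokes_components \<Omega> l w p \<longleftrightarrow> open \<Omega> \<and> (\<forall>k. sub \<Omega> (w k)) \<and> sub \<Omega> p \<and>
    (\<forall>x\<in>\<Omega>. \<forall>k. laplacian (w k) x + l * w k x = pd k p x) \<and> (\<forall>x\<in>\<Omega>. pd 1 (w 1) x + pd 2 (w 2) x = 0)"

lemma stokes_componentsD:
  assumes "stokes_components \<Omega> l w p"
  shows "open \<Omega>" "sub \<Omega> (w k)" "sub \<Omega> p"
    "x \<in> \<Omega> \<Longrightarrow> laplacian (w k) x + l * w k x = pd k p x"
    "x \<in> \<Omega> \<Longrightarrow> pd 2 (w 2) x = - pd 1 (w 1) x"
  using assms unfolding stokes_components_def by (auto simp: add_eq_0_iff)

lemma sub_vorticity: "stokes_components \<Omega> l w p \<Longrightarrow> sub \<Omega> (vorticity w)"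
  unfolding vorticity_def[abs_def] by (intro sub_diff sub_pd stokes_componentsD)

text \<open>Because the velocity has no divergence, its Laplacian is the rotated gradient of the vorticity.\<close>

lemma pd_vorticity:
  assumes S: "stokes_components \<Omega> l w p" and x: "x \<in> \<Omega>"
  shows "pd 1 (vorticity w) x = pd 2 p x - l * w 2 x"
    and "pd 2 (vorticity w) x = l * w 1 x - pd 1 p x"
proof -
  note D = stokes_componentsD[OF S]
  have wd: "pd i (w k) differentiable (at x)" for i k
    by (rule sub_differentiable[OF sub_pd[OF D(2)] x])
  have dv: "pd i (pd 2 (w 2)) x = - pd i (pd 1 (w 1)) x" for i
  proof -
    have "pd i (pd 2 (w 2)) x = pd i (\<lambda>x. - pd 1 (w 1) x) x"
      by (rule pd_cong[OF D(1) x]) (rule D(5))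
    then show ?thesis using wd by (simp add: pd_minus)
  qed
  note cm = sub_pd_commute[OF D(1) D(2) x]
  have "pd 1 (vorticity w) x = laplacian (w 2) x"
    unfolding vorticity_def[abs_def] laplacian_2 using wd dv[of 2] cm[of 1 2 1]
    by (simp add: pd_diff)
  then show "pd 1 (vorticity w) x = pd 2 p x - l * w 2 x" using D(4)[OF x, of 2] by simp
  have "pd 2 (vorticity w) x = - laplacian (w 1) x"
    unfolding vorticity_def[abs_def] laplacian_2 using wd dv[of 1] cm[of 2 1 2]
    by (simp add: pd_diff)
  then show "pd 2 (vorticity w) x = l * w 1 x - pd 1 p x" using D(4)[OF x, of 1] by simp
qed

text \<open>The rotated gradient of the vorticity has no divergence, and neither has the velocity.\<close>

lemma pressure_harmonic:
  assumes S: "stokes_components \<Omega> l w p" and x: "x \<in> \<Omega>"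
  shows "laplacian p x = 0"
proof -
  note D = stokes_componentsD[OF S]
  let ?o = "vorticity w"
  have wd: "w k differentiable (at x)" for k by (rule sub_differentiable[OF D(2) x])
  have od: "pd i ?o differentiable (at x)" for i by (rule sub_differentiable[OF sub_pd[OF sub_vorticity[OF S]] x])
  have "pd 1 (pd 1 p) x = pd 1 (\<lambda>x. l * w 1 x - pd 2 ?o x) x"
    by (rule pd_cong[OF D(1) x]) (simp add: pd_vorticity[OF S])
  also have "\<dots> = l * pd 1 (w 1) x - pd 1 (pd 2 ?o) x"
    by (subst pd_diff) (auto intro!: differentiable_mult simp: pd_cmult wd od)
  finally have 1: "pd 1 (pd 1 p) x = l * pd 1 (w 1) x - pd 1 (pd 2 ?o) x" .
  have "pd 2 (pd 2 p) x = pd 2 (\<lambda>x. l * w 2 x + pd 1 ?o x) x"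
    by (rule pd_cong[OF D(1) x]) (simp add: pd_vorticity[OF S])
  also have "\<dots> = l * pd 2 (w 2) x + pd 2 (pd 1 ?o) x"
    by (subst pd_add) (auto intro!: differentiable_mult simp: pd_cmult wd od)
  finally show ?thesis
    using 1 D(5)[OF x] sub_pd_commute[OF D(1) sub_vorticity[OF S] x, of 1 2] by (simp add: laplacian_2)
qed

lemma vorticity_helmholtz:
  assumes S: "stokes_components \<Omega> l w p" and p0: "\<And>i x. x \<in> \<Omega> \<Longrightarrow> pd i p x = 0" and x: "x \<in> \<Omega>"
  shows "laplacian (vorticity w) x = - l * vorticity w x"
proof -
  note D = stokes_componentsD[OF S]
  let ?o = "vorticity w"
  have wd: "w k differentiable (at x)" for k by (rule sub_differentiable[OF D(2) x])
  have "pd 1 (pd 1 ?o) x = pd 1 (\<lambda>x. - l * w 2 x) x"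
    by (rule pd_cong[OF D(1) x]) (simp add: pd_vorticity[OF S] p0)
  moreover have "pd 2 (pd 2 ?o) x = pd 2 (\<lambda>x. l * w 1 x) x"
    by (rule pd_cong[OF D(1) x]) (simp add: pd_vorticity[OF S] p0)
  ultimately show ?thesis
    by (simp only: laplacian_2 pd_cmult[OF wd] vorticity_def) (simp add: algebra_simps)
qed

text \<open>For a constant pressure \<open>\<omega>\<close> is, up to a factor, a stream function of the velocity, so
  that the rotational part of the convective derivative is the gradient of a function of \<open>\<omega>\<close>.\<close>

lemma convection_is_gradient:
  assumes S: "stokes_components \<Omega> l w p" and p0: "\<And>i x. x \<in> \<Omega> \<Longrightarrow> pd i p x = 0" and l: "l > 0"
    and x: "x \<in> \<Omega>"
  defines "q \<equiv> \<lambda>x. (w 1 x * w 1 x + w 2 x * w 2 x) / 2 + vorticity w x * vorticity w x / (2 * l)"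
  shows "pd k q x = w 1 x * pd 1 (w k) x + w 2 x * pd 2 (w k) x"
proof -
  note D = stokes_componentsD[OF S]
  let ?o = "vorticity w"
  have q_eq: "q = (\<lambda>x. (1/2) * (w 1 x * w 1 x + w 2 x * w 2 x) + (1 / (2 * l)) * (?o x * ?o x))"
    by (simp add: q_def fun_eq_iff)
  have wd: "w k differentiable (at x)" for k by (rule sub_differentiable[OF D(2) x])
  have od: "?o differentiable (at x)" by (rule sub_differentiable[OF sub_vorticity[OF S] x])
  have dd: "(\<lambda>x. w k x * w k x) differentiable (at x)" "(\<lambda>x. ?o x * ?o x) differentiable (at x)"
    "(\<lambda>x. w 1 x * w 1 x + w 2 x * w 2 x) differentiable (at x)" for k
    by (intro differentiable_add differentiable_mult wd od)+
  have dd': "(\<lambda>x. (1/2) * (w 1 x * w 1 x + w 2 x * w 2 x)) differentiable (at x)"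
    "(\<lambda>x. (1 / (2 * l)) * (?o x * ?o x)) differentiable (at x)"
    by (intro differentiable_mult dd differentiable_const)+
  have "pd k q x = (1/2) * (2 * w 1 x * pd k (w 1) x + 2 * w 2 x * pd k (w 2) x) + (1 / (2 * l)) * (2 * ?o x * pd k ?o x)"
    unfolding q_eq
    by (simp only: pd_add[OF dd'] pd_cmult[OF dd(3)] pd_cmult[OF dd(2)] pd_add[OF dd(1) dd(1)] pd_mult[OF wd wd] pd_mult[OF od od])
      simp
  also have "\<dots> = w 1 x * pd k (w 1) x + w 2 x * pd k (w 2) x + ?o x * pd k ?o x / l"
    by (simp add: algebra_simps)
  finally have *: "pd k q x = w 1 x * pd k (w 1) x + w 2 x * pd k (w 2) x + ?o x * pd k ?o x / l" .
  consider "k = 1" | "k = 2" using exhaust_2 by blast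
  then show ?thesis
  proof cases
    case 1
    have "?o x * pd 1 ?o x / l = - ?o x * w 2 x" using l by (simp add: pd_vorticity[OF S x] p0[OF x])
    then show ?thesis using * by (simp add: 1 vorticity_def algebra_simps)
  next
    case 2
    have "?o x * pd 2 ?o x / l = ?o x * w 1 x" using l by (simp add: pd_vorticity[OF S x] p0[OF x])
    then show ?thesis using * by (simp add: 2 vorticity_def algebra_simps)
  qed
qed

text \<open>A gradient has no curl, and the curl of the convective derivative of a planar flow without divergence is \<open>u \<cdot> \<nabla>\<omega>\<close>.  In terms of the pressure this is the determinant of \<open>u\<close> and \<open>\<nabla>p\<close>.\<close>

lemma gradient_convection_parallel:
  assumes S: "stokes_components \<Omega> l w p" and s: "sub \<Omega> s"
    and eq: "\<And>x k. x \<in> \<Omega> \<Longrightarrow> pd k s x = w 1 x * pd 1 (w k) x + w 2 x * pd 2 (w k) x" and x: "x \<in> \<Omega>"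
  shows "w 1 x * pd 2 p x = w 2 x * pd 1 p x"
proof -
  note D = stokes_componentsD[OF S]
  let ?o = "vorticity w"
  have wd: "w k differentiable (at x)" "pd i (w k) differentiable (at x)" for i k
    using sub_differentiable[OF D(2) x] sub_differentiable[OF sub_pd[OF D(2)] x] by auto
  have dd: "(\<lambda>x. w j x * pd j (w k) x) differentiable (at x)" for j k by (intro differentiable_mult wd)
  have e: "pd i (pd k s) x = w 1 x * pd i (pd 1 (w k)) x + pd i (w 1) x * pd 1 (w k) x
      + (w 2 x * pd i (pd 2 (w k)) x + pd i (w 2) x * pd 2 (w k) x)" for i k
  proof -
    have "pd i (pd k s) x = pd i (\<lambda>x. w 1 x * pd 1 (w k) x + w 2 x * pd 2 (w k) x) x"
      by (rule pd_cong[OF D(1) x]) (rule eq)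
    then show ?thesis by (simp only: pd_add[OF dd dd] pd_mult[OF wd])
  qed
  have o: "pd i ?o x = pd i (pd 1 (w 2)) x - pd i (pd 2 (w 1)) x" for i
    unfolding vorticity_def[abs_def] by (rule pd_diff[OF wd(2) wd(2)])
  have "pd 1 (pd 2 s) x = pd 2 (pd 1 s) x" by (rule sub_pd_commute[OF D(1) s x])
  then have "w 1 x * pd 1 ?o x + w 2 x * pd 2 ?o x = 0"
    unfolding e o using D(5)[OF x] sub_pd_commute[OF D(1) D(2) x, of 1 2] by (simp add: algebra_simps)
  then show ?thesis by (simp add: pd_vorticity[OF S x] algebra_simps)
qed

section \<open>The pressure of a flow whose inertial force is a gradient\<close>

text \<open>Extension by zero of a function that already vanishes in the outer half of a disc; \<open>3 / 4\<close> is any factor between \<open>1 / 2\<close> and 1.\<close>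

lemma continuous_on_cutoff_ball:
  fixes Z :: "real^2 \<Rightarrow> real"
  assumes "d > 0" "closed K" "continuous_on (K \<inter> cball c d) Z"
    and "\<And>y. y \<in> K \<Longrightarrow> y \<in> cball c d \<Longrightarrow> y \<notin> cball c (d / 2) \<Longrightarrow> Z y = 0"
  shows "continuous_on K (\<lambda>y. if y \<in> cball c d then Z y else 0)"
proof -
  let ?f = "\<lambda>y. if y \<in> cball c d then Z y else 0"
  let ?T = "K \<inter> - ball c (3 * d / 4)"
  have "continuous_on (K \<inter> cball c d) ?f"
    by (rule continuous_on_eq[OF assms(3)]) simp
  moreover have "continuous_on ?T ?f"
    by (rule continuous_on_eq[OF continuous_on_const[of _ 0]]) (use assms(1,4) in auto)
  ultimately have "continuous_on ((K \<inter> cball c d) \<union> ?T) ?f"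
    by (intro continuous_on_closed_Un) (use assms(2) in auto)
  moreover have "(K \<inter> cball c d) \<union> ?T = K" using assms(1) by auto
  ultimately show ?thesis by simp
qed

text \<open>Suppose \<open>\<nabla>p\<close> is transversal to the boundary at \<open>x\<close>.  Near \<open>x\<close> one has \<open>u = \<alpha>\<nabla>p\<close> with \<open>\<nabla>\<alpha> \<cdot> \<nabla>p = 0\<close>, because \<open>u\<close>
  and \<open>\<nabla>p\<close> have no divergence.  Let \<open>\<kappa> = (\<delta> / 2)\<^sup>2 + \<rho> - \<bar>y - x\<bar>\<^sup>2\<close>; inside \<open>\<Omega>\<close> it is positive only on a small lens
  at \<open>x\<close>.  The field \<open>ramp(\<kappa>) \<alpha> u\<close> vanishes on the boundary, and its divergence is
  \<open>2 max(0, \<kappa>) \<alpha>\<^sup>2 \<nabla>p \<cdot> \<nabla>\<kappa>\<close>.  The last factor has a fixed sign near \<open>x\<close>, since there \<open>\<nabla>\<kappa>\<close> is close to \<open>\<nabla>\<rho>\<close>.  As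
  the integral of the divergence is zero, \<open>\<alpha>\<close> vanishes on the lens.  Then so do \<open>u\<close> and
  \<open>\<nabla>p = \<Delta>u + \<lambda>u\<close>, which contradicts transversality.\<close>

theorem gradient_convection_neumann:
  assumes smooth: "smooth_open_set \<Omega>" and S: "stokes_components \<Omega> l w p"
    and bc: "\<And>x k. x \<in> frontier \<Omega> \<Longrightarrow> extension \<Omega> (w k) x = 0"
    and par: "\<And>x. x \<in> \<Omega> \<Longrightarrow> w 1 x * pd 2 p x = w 2 x * pd 1 p x"
    and x: "x \<in> frontier \<Omega>"
  shows "bgrad \<Omega> p x \<bullet> outward_normal \<Omega> x = 0"
proof (rule ccontr)
  assume contra: "bgrad \<Omega> p x \<bullet> outward_normal \<Omega> x \<noteq> 0"
  note D = stokes_componentsD[OF S]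
  note \<Omega> = D(1)
  obtain U \<rho> where df: "defining_function \<Omega> x U \<rho>" using smooth x unfolding smooth_open_set_def by blast
  note d = defining_functionD[OF df]
  have xc: "x \<in> closure \<Omega>" by (rule frontier_open_limit(2)[OF \<Omega> x])
  define m where "m = bgrad \<Omega> p x \<bullet> grad \<rho> x"
  have m: "m \<noteq> 0" using contra by (auto simp: m_def outward_normal_eq[OF \<Omega> df x])
  define V where "V = bgrad \<Omega> p"
  define n where "n y = grad \<rho> y - 2 *\<^sub>R (y - x)" for y
  define h where "h y = m * (V y \<bullet> n y)" for y
  have Vc: "continuous_on (closure \<Omega>) V" unfolding V_def by (rule bgrad(1)[OF D(3)])
  have nc: "continuous_on U n"
    unfolding n_def[abs_def] grad_def[abs_def] by (intro continuous_intros continuous_on_vec_lambda C1_onD(2)[OF d(3)])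
  have hc: "continuous_on (closure \<Omega> \<inter> U) h" unfolding h_def[abs_def]
    by (intro continuous_intros continuous_on_subset[OF Vc] continuous_on_subset[OF nc]) auto
  have "h x > 0" using m by (simp add: h_def n_def V_def m_def[symmetric] zero_less_mult_iff) linarith
  then obtain e where e: "e > 0" "\<And>y. y \<in> closure \<Omega> \<inter> U \<Longrightarrow> dist y x < e \<Longrightarrow> dist (h y) (h x) < h x"
    using hc xc d(2) unfolding continuous_on_iff by (metis IntI)
  obtain e' where e': "e' > 0" "cball x e' \<subseteq> U" using d(1,2) open_contains_cball by blast
  define \<delta> where "\<delta> = min (e / 2) e'"
  have \<delta>: "\<delta> > 0" "cball x \<delta> \<subseteq> U" using e(1) e' by (auto simp: \<delta>_def)
  have hpos: "h y > 0" if "y \<in> closure \<Omega>" "y \<in> cball x \<delta>" for y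
  proof -
    have "dist y x < e" using that(2) e(1) by (auto simp: \<delta>_def dist_commute)
    then have "dist (h y) (h x) < h x" using e(2) that \<delta>(2) by blast
    then show ?thesis by (simp add: dist_real_def abs_if split: if_splits)
  qed
  have V0: "V y \<noteq> 0" if "y \<in> closure \<Omega>" "y \<in> cball x \<delta>" for y
    using hpos[OF that] by (auto simp: h_def)
  have VV: "(V y $ 1)\<^sup>2 + (V y $ 2)\<^sup>2 \<noteq> 0" if "y \<in> closure \<Omega>" "y \<in> cball x \<delta>" for y
    using V0[OF that] by (auto simp: sum_power2_eq_zero_iff vec_eq_iff forall_2)
  have VO: "V y $ i = pd i p y" if "y \<in> \<Omega>" for i y using bgrad(2)[OF D(3) that] by (simp add: V_def grad_def)

  define \<kappa> where "\<kappa> y = (\<delta> / 2)\<^sup>2 + \<rho> y - (norm (y - x))\<^sup>2" for y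
  have \<kappa>C: "C1_on U \<kappa>" unfolding \<kappa>_def[abs_def] by (intro C1_on_diff C1_on_add C1_on_const d(3) C1_on_dist_sq)
  have \<kappa>pd: "pd i \<kappa> y = n y $ i" if "y \<in> U" for y i
  proof -
    have "\<rho> differentiable (at y)" by (rule C1_onD(1)[OF d(3) that])
    moreover have "(\<lambda>y. (norm (y - x))\<^sup>2) differentiable (at y)"
      by (rule C1_onD(1)[OF C1_on_dist_sq(1)[of UNIV]]) simp
    ultimately show ?thesis
      unfolding \<kappa>_def[abs_def] by (simp add: pd_diff pd_add C1_on_dist_sq(2) n_def grad_def)
  qed
  have lens: "\<kappa> y \<le> 0" if "y \<in> closure \<Omega>" "y \<in> cball x \<delta>" "y \<notin> cball x (\<delta> / 2)" for y
  proof -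
    have "\<rho> y \<le> 0" using closure_defining[OF df _ that(1)] that(2) \<delta>(2) by blast
    moreover have "(\<delta> / 2)\<^sup>2 \<le> (norm (y - x))\<^sup>2"
      using that(3) \<delta>(1) by (intro power_mono) (auto simp: dist_norm norm_minus_commute)
    ultimately show ?thesis by (simp add: \<kappa>_def)
  qed
  define A where "A = \<Omega> \<inter> ball x \<delta>"
  define B where "B = \<Omega> \<inter> - cball x (\<delta> / 2)"
  have AB: "open A" "open B" "A \<union> B = \<Omega>" using \<Omega> \<delta>(1) by (auto simp: A_def B_def)
  have AU: "A \<subseteq> U" using \<delta>(2) by (auto simp: A_def)
  have Acl: "y \<in> closure \<Omega>" "y \<in> cball x \<delta>" "y \<in> \<Omega>" if "y \<in> A" for y
    using that closure_subset by (auto simp: A_def)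
  define \<alpha> where "\<alpha> y = (w 1 y * pd 1 p y + w 2 y * pd 2 p y) * inverse ((pd 1 p y)\<^sup>2 + (pd 2 p y)\<^sup>2)" for y
  have pp: "(pd 1 p y)\<^sup>2 + (pd 2 p y)\<^sup>2 \<noteq> 0" if "y \<in> A" for y
    using VV[of y] Acl[OF that] VO by simp
  have w\<alpha>: "w k y = \<alpha> y * pd k p y" if "y \<in> A" for k y
  proof -
    have P: "w 1 y * pd 2 p y = w 2 y * pd 1 p y" using par Acl(3)[OF that] .
    have "w k y * ((pd 1 p y)\<^sup>2 + (pd 2 p y)\<^sup>2) = (w 1 y * pd 1 p y + w 2 y * pd 2 p y) * pd k p y"
    proof -
      consider "k = 1" | "k = 2" using exhaust_2 by blast
      then show ?thesis
      proof cases
        case 1 then show ?thesis using P by (simp add: power2_eq_square algebra_simps)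
      next
        case 2 then show ?thesis using P by (simp add: power2_eq_square algebra_simps)
      qed
    qed
    then show ?thesis using pp[OF that] unfolding \<alpha>_def by (simp add: field_simps)
  qed
  have wC: "C1_on A (w k)" and pC: "C1_on A (pd i p)" for k i
    using D sub_C1_on sub_pd C1_on_subset[of \<Omega>] by (metis AB(3) Un_upper1)+
  have \<alpha>C: "C1_on A \<alpha>"
  proof -
    have "C1_on A (\<lambda>y. inverse ((pd 1 p y)\<^sup>2 + (pd 2 p y)\<^sup>2))"
    proof (rule C1_on_compose[where \<phi> = inverse and \<phi>' = "\<lambda>t. - (inverse t ^ Suc (Suc 0))"])
      show "C1_on A (\<lambda>y. (pd 1 p y)\<^sup>2 + (pd 2 p y)\<^sup>2)" by (intro C1_on_add C1_on_power2 pC)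
      show "continuous_on ((\<lambda>y. (pd 1 p y)\<^sup>2 + (pd 2 p y)\<^sup>2) ` A) (\<lambda>t. - (inverse t ^ Suc (Suc 0)))"
        using pp by (intro continuous_intros) auto
    qed (rule DERIV_inverse[OF pp])
    then show ?thesis unfolding \<alpha>_def[abs_def] by (intro C1_on_mult C1_on_add wC pC)
  qed
  define F where "F i y = (if y \<in> cball x \<delta> then ramp (\<kappa> y) * (\<alpha> y * w i y) else 0)" for i y
  have rC: "C1_on A (\<lambda>y. ramp (\<kappa> y))"
    by (rule C1_on_compose[OF C1_on_subset[OF \<kappa>C AU] ramp_deriv]) (intro continuous_intros)
  have FA: "F i y = ramp (\<kappa> y) * (\<alpha> y * w i y)" if "y \<in> A" for i y using Acl[OF that] by (simp add: F_def)
  have FB: "F i y = 0" if "y \<in> B" for i y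
  proof (cases "y \<in> cball x \<delta>")
    case True
    then have "\<kappa> y \<le> 0" using lens[of y] that closure_subset by (auto simp: B_def)
    then show ?thesis by (simp add: F_def ramp_def)
  qed (simp add: F_def)
  have FC: "C1_on \<Omega> (F i)" for i
  proof -
    have "C1_on A (F i)"
      using C1_on_cong[of A "F i", OF AB(1) FA[of _ i]] C1_on_mult[OF rC C1_on_mult[OF \<alpha>C wC[of i]]] by simp
    moreover have "C1_on B (F i)"
      using C1_on_cong[of B "F i" "\<lambda>y. 0", OF AB(2) FB[of _ i]] by simp
    ultimately show ?thesis using C1_on_Un[OF AB(1,2)] AB(3) by metis
  qed
  define K where "K = closure \<Omega> \<inter> cball x \<delta>"
  define \<alpha>b where "\<alpha>b y = (extension \<Omega> (w 1) y * V y $ 1 + extension \<Omega> (w 2) y * V y $ 2) / ((V y $ 1)\<^sup>2 + (V y $ 2)\<^sup>2)" for y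
  have wE: "has_extension \<Omega> (w k)" for k using D(2) sub_extension by blast
  have Kc: "continuous_on K (extension \<Omega> (w k))" "continuous_on K (\<lambda>y. V y $ i)" "continuous_on K \<kappa>" "continuous_on K n" for k i
    using continuous_on_subset[OF extension(1)[OF wE], of K] continuous_on_subset[OF Vc, of K]
      continuous_on_subset[OF C1_onD(3)[OF \<kappa>C], of K] continuous_on_subset[OF nc, of K] \<delta>(2)
    by (auto simp: K_def intro!: continuous_intros)
  have \<alpha>bc: "continuous_on K \<alpha>b"
    unfolding \<alpha>b_def[abs_def] using VV by (intro continuous_intros Kc) (auto simp: K_def)
  have \<alpha>\<alpha>: "\<alpha>b y = \<alpha> y" if "y \<in> A" for y
    using Acl[OF that] extension(2)[OF wE] VO by (simp add: \<alpha>b_def \<alpha>_def divide_inverse)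
  define Fb where "Fb i y = (if y \<in> cball x \<delta> then ramp (\<kappa> y) * (\<alpha>b y * extension \<Omega> (w i) y) else 0)" for i y
  have rKc: "continuous_on K (\<lambda>y. ramp (\<kappa> y))" "continuous_on K (\<lambda>y. max 0 (\<kappa> y))"
    unfolding ramp_def by (intro continuous_intros Kc)+
  have Fbc: "continuous_on (closure \<Omega>) (Fb i)" for i
    unfolding Fb_def[abs_def]
  proof (rule continuous_on_cutoff_ball[OF \<delta>(1)])
    show "continuous_on (closure \<Omega> \<inter> cball x \<delta>) (\<lambda>y. ramp (\<kappa> y) * (\<alpha>b y * extension \<Omega> (w i) y))"
      unfolding K_def[symmetric] by (intro continuous_on_mult rKc Kc \<alpha>bc)
  qed (use lens in \<open>auto simp: ramp_def\<close>)
  have FbF: "Fb i y = F i y" if "y \<in> \<Omega>" for i y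
  proof (cases "y \<in> A")
    case True then show ?thesis using Acl[OF True] \<alpha>\<alpha>[OF True] extension(2)[OF wE that] by (simp add: Fb_def F_def)
  next
    case False
    then have "y \<in> B" using AB(3) that by blast
    then show ?thesis using FB lens[of y] subsetD[OF closure_subset that] by (auto simp: Fb_def ramp_def B_def)
  qed
  have FE: "has_extension \<Omega> (F i)" for i unfolding has_extension_def using Fbc FbF by blast
  have Fbd: "(\<Sum>i\<in>UNIV. extension \<Omega> (F i) y * outward_normal \<Omega> y $ i) = 0" if y: "y \<in> frontier \<Omega>" for y
  proof -
    have "extension \<Omega> (F i) y = Fb i y" for i
      by (rule extension_eqI[OF \<Omega> Fbc FbF frontier_open_limit(2)[OF \<Omega> y]])
    moreover have "Fb i y = 0" for i using bc[OF y, of i] by (simp add: Fb_def)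
    ultimately show ?thesis by simp
  qed
  have divA: "divergence F y = 2 * max 0 (\<kappa> y) * ((\<alpha> y)\<^sup>2 * (V y \<bullet> n y))" if y: "y \<in> A" for y
  proof -
    have diff: "w k differentiable (at y)" "pd i p differentiable (at y)" "\<alpha> differentiable (at y)" "\<kappa> differentiable (at y)" for k i
      using C1_onD(1) wC pC \<alpha>C C1_on_subset[OF \<kappa>C AU] y by blast+
    have yO: "y \<in> \<Omega>" and yU: "y \<in> U" using y AU Acl by auto
    have dw: "divergence w y = 0" using D(5)[OF yO] by (simp add: divergence_def sum_2)
    have "divergence w y = divergence (\<lambda>i y. \<alpha> y * pd i p y) y"
      unfolding divergence_def by (intro sum.cong refl pd_cong[OF AB(1) y w\<alpha>])
    also have "\<dots> = \<alpha> y * laplacian p y + (\<Sum>i\<in>UNIV. pd i \<alpha> y * pd i p y)"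
      by (subst divergence_mult) (auto simp: diff divergence_def laplacian_def)
    finally have tr: "(\<Sum>i\<in>UNIV. pd i \<alpha> y * pd i p y) = 0"
      using dw pressure_harmonic[OF S yO] by simp
    have rd: "(\<lambda>y. ramp (\<kappa> y)) differentiable (at y)" "pd i (\<lambda>y. ramp (\<kappa> y)) y = 2 * max 0 (\<kappa> y) * n y $ i" for i
      using pd_compose[OF diff(4) ramp_deriv] by (auto simp: \<kappa>pd[OF yU])
    have "divergence (\<lambda>i y. \<alpha> y * w i y) y = \<alpha> y * divergence w y + (\<Sum>i\<in>UNIV. pd i \<alpha> y * w i y)"
      by (rule divergence_mult) (auto simp: diff)
    also have "\<dots> = \<alpha> y * (\<Sum>i\<in>UNIV. pd i \<alpha> y * pd i p y)"
      by (simp add: dw w\<alpha>[OF y] sum_2 algebra_simps)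
    finally have d\<alpha>w: "divergence (\<lambda>i y. \<alpha> y * w i y) y = 0" using tr by simp
    have "divergence F y = divergence (\<lambda>i y. ramp (\<kappa> y) * (\<alpha> y * w i y)) y"
      unfolding divergence_def by (intro sum.cong refl pd_cong[OF AB(1) y FA])
    also have "\<dots> = ramp (\<kappa> y) * divergence (\<lambda>i y. \<alpha> y * w i y) y + (\<Sum>i\<in>UNIV. pd i (\<lambda>y. ramp (\<kappa> y)) y * (\<alpha> y * w i y))"
      by (rule divergence_mult) (auto simp: rd diff intro!: differentiable_mult)
    also have "\<dots> = 2 * max 0 (\<kappa> y) * ((\<alpha> y)\<^sup>2 * (V y \<bullet> n y))"
      unfolding d\<alpha>w rd(2) by (simp add: w\<alpha>[OF y] VO[OF yO] inner_vec_def sum_2 power2_eq_square algebra_simps)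
    finally show ?thesis .
  qed
  have divB: "divergence F y = 0" if "y \<in> B" for y
    unfolding divergence_def by (intro sum.neutral ballI pd_eq_0_open[OF AB(2) that FB])
  define Db where "Db y = (if y \<in> cball x \<delta> then 2 * max 0 (\<kappa> y) * ((\<alpha>b y)\<^sup>2 * (V y \<bullet> n y)) else 0)" for y
  have "continuous_on (closure \<Omega>) Db"
    unfolding Db_def[abs_def]
  proof (rule continuous_on_cutoff_ball[OF \<delta>(1)])
    show "continuous_on (closure \<Omega> \<inter> cball x \<delta>) (\<lambda>y. 2 * max 0 (\<kappa> y) * ((\<alpha>b y)\<^sup>2 * (V y \<bullet> n y)))"
      unfolding K_def[symmetric]
      by (intro continuous_intros rKc Kc \<alpha>bc continuous_on_subset[OF Vc]) (auto simp: K_def)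
  qed (use lens in \<open>auto\<close>)
  moreover have DbF: "Db y = divergence F y" if "y \<in> \<Omega>" for y
  proof (cases "y \<in> A")
    case True then show ?thesis using Acl[OF True] \<alpha>\<alpha>[OF True] by (simp add: Db_def divA)
  next
    case False
    then have "y \<in> B" using AB(3) that by blast
    then show ?thesis using divB lens[of y] subsetD[OF closure_subset that] by (auto simp: Db_def B_def)
  qed
  ultimately have DE: "has_extension \<Omega> (divergence F)" unfolding has_extension_def by blast
  have T: "tangential_field \<Omega> F"
  proof (rule tangential_fieldI[OF \<Omega> FC FE Fbd _ DE])
    show "F i y = 0" if "norm y > norm x + \<delta>" for i y
      using norm_gt_imp_not_cball[OF that] by (simp add: F_def)
  qed
  have zero: "m * divergence F y = 0" if "y \<in> \<Omega>" for y
  proof (rule set_integral_continuous_nonneg_zero[OF \<Omega> _ _ _ _ that])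
    show "continuous_on \<Omega> (\<lambda>y. m * divergence F y)"
      unfolding divergence_def[abs_def] by (intro continuous_intros continuous_on_sum C1_onD(2)[OF FC])
    show "set_integrable lborel \<Omega> (\<lambda>y. m * divergence F y)"
      by (intro set_integrable_mult_right tangential_field_integrable[OF \<Omega> T])
    show "(LINT y:\<Omega>|lborel. m * divergence F y) \<le> 0"
      using divergence_theorem_tangential[OF smooth T] by simp
    show "m * divergence F y \<ge> 0" if y: "y \<in> \<Omega>" for y
    proof (cases "y \<in> A")
      case True
      have "m * divergence F y = 2 * max 0 (\<kappa> y) * (\<alpha> y)\<^sup>2 * h y"
        by (simp add: divA[OF True] h_def)
      then show ?thesis using hpos[OF Acl(1,2)[OF True]] by simp
    next
      case False
      then show ?thesis using divB AB(3) y by auto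
    qed
  qed
  define L where "L = A \<inter> \<kappa> -` {0<..}"
  have Lo: "open L" unfolding L_def
    using continuous_on_open_vimage[OF AB(1)] C1_onD(3)[OF C1_on_subset[OF \<kappa>C AU]] by (metis Int_commute open_greaterThan)
  have wL: "w k y = 0" if "y \<in> L" for y k
  proof -
    have yA: "y \<in> A" and ky: "\<kappa> y > 0" using that by (auto simp: L_def)
    have "2 * max 0 (\<kappa> y) * (\<alpha> y)\<^sup>2 * h y = 0"
      using zero[OF Acl(3)[OF yA]] by (auto simp: divA[OF yA] h_def)
    then have "\<alpha> y = 0" using ky hpos[OF Acl(1,2)[OF yA]] by simp
    then show ?thesis by (simp add: w\<alpha>[OF yA])
  qed
  have "open (U \<inter> ball x \<delta> \<inter> \<kappa> -` {0<..})"
    using continuous_on_open_vimage[of "U \<inter> ball x \<delta>" \<kappa>] continuous_on_subset[OF C1_onD(3)[OF \<kappa>C], of "U \<inter> ball x \<delta>"] d(1)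
    by (metis Int_commute inf_le1 open_Int open_ball open_greaterThan)
  moreover have "x \<in> U \<inter> ball x \<delta> \<inter> \<kappa> -` {0<..}"
    using d(2) \<delta>(1) frontier_defining[OF \<Omega> df d(2) x] by (simp add: \<kappa>_def)
  ultimately obtain y where y: "y \<in> \<Omega>" "y \<in> U \<inter> ball x \<delta> \<inter> \<kappa> -` {0<..}"
    using xc by (meson open_Int_closure_eq_empty disjoint_iff)
  then have yL: "y \<in> L" by (auto simp: L_def A_def)
  have "pd k p y = 0" for k
  proof -
    have "pd i (w k) z = 0" if "z \<in> L" for i z by (rule pd_eq_0_open[OF Lo that wL])
    then have "pd i (pd i (w k)) y = 0" for i by (rule pd_eq_0_open[OF Lo yL])
    then show ?thesis using D(4)[OF y(1), of k] wL[OF yL] by (simp add: laplacian_2)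
  qed
  moreover have "y \<in> A" using yL by (simp add: L_def)
  ultimately show False using pp[of y] by simp
qed


section \<open>A function with vanishing boundary gradient is constant on the boundary\<close>

text \<open>Coordinates along a unit vector and its rotation by a right angle.\<close>

lemma plane_coordinates:
  fixes N v :: "real^2"
  assumes "norm N = 1"
  defines "T \<equiv> (\<chi> i. if i = 1 then - (N $ 2) else N $ 1) :: real^2"
  shows "norm T = 1" "T \<bullet> N = 0" "v = (v \<bullet> T) *\<^sub>R T + (v \<bullet> N) *\<^sub>R N"
proof -
  have N: "N $ 1 * N $ 1 + N $ 2 * N $ 2 = 1"
    using assms(1) by (simp add: norm_eq_1 inner_vec_def sum_2)
  have T: "T $ 1 = - (N $ 2)" "T $ 2 = N $ 1" by (simp_all add: T_def)
  show "norm T = 1" "T \<bullet> N = 0" using N by (simp_all add: norm_eq_1 inner_vec_def sum_2 T)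
  have "v $ 1 = v $ 1 * (N $ 1 * N $ 1 + N $ 2 * N $ 2)" "v $ 2 = v $ 2 * (N $ 1 * N $ 1 + N $ 2 * N $ 2)"
    using N by simp_all
  then show "v = (v \<bullet> T) *\<^sub>R T + (v \<bullet> N) *\<^sub>R N"
    by (simp add: vec_eq_iff forall_2 inner_vec_def sum_2 T algebra_simps)
qed

text \<open>Near a boundary point the outward directions form a uniform cone.\<close>

lemma boundary_cone:
  assumes \<Omega>: "open \<Omega>" and df: "defining_function \<Omega> x U \<rho>" and x: "x \<in> frontier \<Omega>"
  obtains N r where "norm N = 1" "r > 0"
    "\<And>y d. y \<in> frontier \<Omega> \<Longrightarrow> y \<in> cball x r \<Longrightarrow> y + d \<in> cball x r \<Longrightarrow> N \<bullet> d > norm d / 4 \<Longrightarrow> y + d \<notin> closure \<Omega>"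
    "\<And>y d. y \<in> frontier \<Omega> \<Longrightarrow> y \<in> cball x r \<Longrightarrow> y - d \<in> cball x r \<Longrightarrow> N \<bullet> d > norm d / 4 \<Longrightarrow> y - d \<in> \<Omega>"
proof -
  note d = defining_functionD[OF df]
  define g where "g = grad \<rho> x"
  have g: "norm g > 0" using d(2,4) by (simp add: g_def)
  define N where "N = g /\<^sub>R norm g"
  have N: "norm N = 1" using g by (simp add: N_def)
  have gc: "continuous_on U (grad \<rho>)"
    unfolding grad_def[abs_def] by (intro continuous_on_vec_lambda C1_onD(2)[OF d(3)])
  then obtain e where e: "e > 0" "\<And>y. y \<in> U \<Longrightarrow> dist y x < e \<Longrightarrow> dist (grad \<rho> y) g < norm g / 4"
    using d(2) g unfolding continuous_on_iff g_def by (metis divide_pos_pos zero_less_numeral)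
  obtain e' where e': "e' > 0" "cball x e' \<subseteq> U" using d(1,2) open_contains_cball by blast
  define r where "r = min (e / 2) e'"
  have r: "r > 0" "cball x r \<subseteq> U" using e(1) e' by (auto simp: r_def)
  have rg: "norm (grad \<rho> y - g) \<le> norm g / 4" if "y \<in> cball x r" for y
    using e(2)[of y] that r(2) e(1) by (force simp: r_def dist_commute[of x] dist_norm[of _ g])
  have inc: "\<rho> (y + d) > \<rho> y" if "y \<in> cball x r" "y + d \<in> cball x r" "N \<bullet> d > norm d / 4" for y d
  proof -
    have seg: "y + t *\<^sub>R d \<in> cball x r" if "0 \<le> t" "t \<le> 1" for t
    proof -
      have "(1 - t) *\<^sub>R y + t *\<^sub>R (y + d) \<in> cball x r"
        by (rule convexD[OF convex_cball \<open>y \<in> _\<close> \<open>y + d \<in> _\<close>]) (use that in auto)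
      then show ?thesis by (simp add: algebra_simps)
    qed
    have pos: "grad \<rho> z \<bullet> d > 0" if "z \<in> cball x r" for z
    proof -
      have "(g - grad \<rho> z) \<bullet> d \<le> norm (g - grad \<rho> z) * norm d" by (rule norm_cauchy_schwarz)
      also have "\<dots> \<le> norm g / 4 * norm d" using rg[OF that] by (intro mult_right_mono) (auto simp: norm_minus_commute)
      also have "\<dots> < norm g * (N \<bullet> d)" using \<open>N \<bullet> d > norm d / 4\<close> g by simp
      also have "\<dots> = g \<bullet> d" using g by (simp add: N_def)
      finally show ?thesis by (simp add: inner_diff_left)
    qed
    have "\<exists>z>0. z < 1 \<and> \<rho> (y + 1 *\<^sub>R d) - \<rho> (y + 0 *\<^sub>R d) = (1 - 0) * (grad \<rho> (y + z *\<^sub>R d) \<bullet> d)"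
      using MVT2[of 0 1 "\<lambda>t. \<rho> (y + t *\<^sub>R d)" "\<lambda>t. grad \<rho> (y + t *\<^sub>R d) \<bullet> d"]
        real_derivative_along_line[OF C1_onD(1)[OF d(3)]] seg r(2) by (auto simp: subset_iff)
    then obtain z where "0 < z" "z < 1" "\<rho> (y + d) - \<rho> y = grad \<rho> (y + z *\<^sub>R d) \<bullet> d" by auto
    then show ?thesis using pos[OF seg[of z]] by simp
  qed
  have \<rho>0: "\<rho> y = 0" if "y \<in> frontier \<Omega>" "y \<in> cball x r" for y
    using frontier_defining[OF \<Omega> df _ that(1)] r(2) that(2) by blast
  show thesis
  proof (rule that[OF N r(1)])
    fix y d assume y: "y \<in> frontier \<Omega>" "y \<in> cball x r" "N \<bullet> d > norm d / 4"
    show "y + d \<notin> closure \<Omega>" if "y + d \<in> cball x r"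
      using inc[OF y(2) that y(3)] \<rho>0[OF y(1,2)] closure_defining[OF df, of "y + d"] r(2) that by force
    show "y - d \<in> \<Omega>" if "y - d \<in> cball x r"
      using inc[of "y - d" d] y that \<rho>0[OF y(1,2)] d(5)[of "y - d"] r(2) by force
  qed
qed

text \<open>By the cone property the boundary is near \<open>x\<close> a Lipschitz graph over the tangent line.  Two of its points
  at distance \<open>s\<close> are joined by a path in \<open>\<Omega>\<close> that has length at most \<open>3 s\<close> and stays within distance \<open>3 s\<close> of them: step
  inwards, move parallel, step back.  The gradient is small there, so along the graph the boundary value has derivative zero.\<close>

lemma frontier_locally_constant:
  assumes smooth: "smooth_open_set \<Omega>" and f: "sub \<Omega> f" and x: "x \<in> frontier \<Omega>"
    and g0: "\<And>y. y \<in> frontier \<Omega> \<Longrightarrow> bgrad \<Omega> f y = 0"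
  obtains a where "a > 0" "\<And>y. y \<in> frontier \<Omega> \<Longrightarrow> y \<in> ball x a \<Longrightarrow> extension \<Omega> f y = extension \<Omega> f x"
proof -
  have \<Omega>: "open \<Omega>" using smooth by (simp add: smooth_open_set_def)
  have fC: "C1_on \<Omega> f" and fE: "has_extension \<Omega> f" using f sub_C1_on sub_extension by auto
  obtain U \<rho> where df: "defining_function \<Omega> x U \<rho>" using smooth x unfolding smooth_open_set_def by blast
  obtain N r where N: "norm N = 1" and r: "r > 0"
    and out: "\<And>y d. y \<in> frontier \<Omega> \<Longrightarrow> y \<in> cball x r \<Longrightarrow> y + d \<in> cball x r \<Longrightarrow> N \<bullet> d > norm d / 4 \<Longrightarrow> y + d \<notin> closure \<Omega>"
    and inn: "\<And>y d. y \<in> frontier \<Omega> \<Longrightarrow> y \<in> cball x r \<Longrightarrow> y - d \<in> cball x r \<Longrightarrow> N \<bullet> d > norm d / 4 \<Longrightarrow> y - d \<in> \<Omega>"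
    using boundary_cone[OF \<Omega> df x] by metis
  define T :: "real^2" where "T = (\<chi> i. if i = 1 then - (N $ 2) else N $ 1)"
  have T: "norm T = 1" "T \<bullet> N = 0" and dec: "\<And>v. v = (v \<bullet> T) *\<^sub>R T + (v \<bullet> N) *\<^sub>R N"
    using plane_coordinates[OF N] unfolding T_def by blast+
  have cl: "y \<in> closure \<Omega>" if "y \<in> frontier \<Omega>" for y using frontier_open_limit(2)[OF \<Omega> that] .
  have flat: "\<bar>N \<bullet> (z - y)\<bar> \<le> norm (z - y) / 4"
    if "y \<in> frontier \<Omega>" "z \<in> frontier \<Omega>" "y \<in> cball x r" "z \<in> cball x r" for y z
    using out[of y "z - y"] out[of z "y - z"] that cl
    by (force simp: abs_if norm_minus_commute inner_diff_right)

  \<comment> \<open>Two boundary points are joined by a path that runs a little inside, where the gradient is small.\<close>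
  have path: "\<bar>extension \<Omega> f z - extension \<Omega> f y\<bar> \<le> 3 * \<eta> * norm (z - y)"
    if yz: "y \<in> frontier \<Omega>" "z \<in> frontier \<Omega>" "y \<in> ball x (r/8)" "z \<in> ball x (r/8)"
      and \<eta>: "\<And>p. p \<in> \<Omega> \<Longrightarrow> p \<in> cball y (3 * norm (z - y)) \<Longrightarrow> norm (grad f p) \<le> \<eta>" for y z \<eta>
  proof -
    define s where "s = norm (z - y)"
    show ?thesis
    proof (cases "s = 0")
      case False
      then have s: "s > 0" by (simp add: s_def)
      have "s \<le> dist y x + dist x z"
        using dist_triangle[of z y x] by (simp add: s_def dist_norm norm_minus_commute)
      then have sr: "s < r / 4" using yz(3,4) by (simp add: dist_commute)
      have near: "q \<in> cball x r" if "norm (q - y) \<le> 3 * s" for q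
      proof -
        have "dist x q \<le> dist x y + dist y q" by (rule dist_triangle)
        moreover have "dist y q = norm (q - y)" by (simp add: dist_norm norm_minus_commute)
        ultimately show ?thesis using that sr yz(3) r by simp
      qed
      have yr: "y \<in> cball x r" "z \<in> cball x r" using yz(3,4) r by auto
      have dn: "norm (p - (t * s) *\<^sub>R N - y) \<le> 3 * s" if "p \<in> {y, z}" "0 < t" "t \<le> 1" for p t
      proof -
        have "t * s \<le> 1 * s" using that s by (intro mult_right_mono) auto
        moreover have "norm ((p - y) - (t * s) *\<^sub>R N) \<le> norm (p - y) + norm ((t * s) *\<^sub>R N)"
          by (rule norm_triangle_ineq4)
        moreover have "norm (p - y) \<le> s" using that s by (auto simp: s_def)
        moreover have "norm ((t * s) *\<^sub>R N) = t * s" using that s N by simp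
        ultimately have "norm ((p - y) - (t * s) *\<^sub>R N) \<le> 3 * s" using s by linarith
        moreover have "p - (t * s) *\<^sub>R N - y = (p - y) - (t * s) *\<^sub>R N" by simp
        ultimately show ?thesis by (simp only:)
      qed
      have down: "p - (t * s) *\<^sub>R N \<in> \<Omega>" if "p \<in> {y, z}" "0 < t" "t \<le> 1" for p t
      proof (rule inn)
        show "p - (t * s) *\<^sub>R N \<in> cball x r" by (rule near[OF dn[OF that]])
        have "N \<bullet> N = 1" using N by (simp add: norm_eq_1)
        then show "N \<bullet> ((t * s) *\<^sub>R N) > norm ((t * s) *\<^sub>R N) / 4"
          using that s N by simp
      qed (use that yz yr in auto)
      define y' where "y' = y - s *\<^sub>R N"
      define z' where "z' = z - s *\<^sub>R N"
      have in': "y' \<in> \<Omega>" "z' \<in> \<Omega>" using down[of _ 1] by (auto simp: y'_def z'_def)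
      have side: "\<bar>extension \<Omega> f (p - s *\<^sub>R N) - extension \<Omega> f p\<bar> \<le> \<eta> * s" if p: "p \<in> {y, z}" for p
      proof -
        have eq: "p + t *\<^sub>R (p - s *\<^sub>R N - p) = p - (t * s) *\<^sub>R N" for t by simp
        have "\<bar>extension \<Omega> f (p - s *\<^sub>R N) - extension \<Omega> f p\<bar> \<le> \<eta> * norm (p - s *\<^sub>R N - p)"
        proof (rule segment_increment_bound[OF fC fE])
          show "p \<in> closure \<Omega>" using p yz cl by auto
          fix t :: real
          show "p + t *\<^sub>R (p - s *\<^sub>R N - p) \<in> \<Omega>" if "0 < t" "t \<le> 1"
            unfolding eq using down[OF p that] .
          show "norm (grad f (p + t *\<^sub>R (p - s *\<^sub>R N - p))) \<le> \<eta>" if t: "0 < t" "t < 1"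
            unfolding eq
          proof (rule \<eta>)
            show "p - (t * s) *\<^sub>R N \<in> \<Omega>" using down[OF p] t by simp
            show "p - (t * s) *\<^sub>R N \<in> cball y (3 * norm (z - y))"
              using dn[OF p t(1) less_imp_le[OF t(2)]] by (simp add: dist_norm norm_minus_commute s_def)
          qed
        qed
        then show ?thesis using s N by simp
      qed
      have mid: "\<bar>extension \<Omega> f z' - extension \<Omega> f y'\<bar> \<le> \<eta> * s"
      proof -
        have eq: "y' + t *\<^sub>R (z' - y') = y - (s *\<^sub>R N - t *\<^sub>R (z - y))" for t
          by (simp add: y'_def z'_def algebra_simps)
        have b: "norm (s *\<^sub>R N - t *\<^sub>R (z - y)) \<le> 2 * s" if "0 \<le> t" "t \<le> 1" for t
        proof -
          have "t * s \<le> 1 * s" using that s by (intro mult_right_mono) auto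
          moreover have "norm (s *\<^sub>R N - t *\<^sub>R (z - y)) \<le> s + t * s"
            using norm_triangle_ineq4[of "s *\<^sub>R N" "t *\<^sub>R (z - y)"] that s N by (simp add: s_def[symmetric])
          ultimately show ?thesis by linarith
        qed
        have i: "y' + t *\<^sub>R (z' - y') \<in> \<Omega>" if t: "0 \<le> t" "t \<le> 1" for t
          unfolding eq
        proof (rule inn[OF yz(1) yr(1)])
          show "y - (s *\<^sub>R N - t *\<^sub>R (z - y)) \<in> cball x r"
            by (rule near) (use b[OF t] s in \<open>simp add: norm_minus_commute\<close>)
          have "t * (N \<bullet> (z - y)) \<le> 1 * (s / 4)"
          proof -
            have "t * (N \<bullet> (z - y)) \<le> t * (s / 4)"
              using flat[OF yz(1,2) yr] t by (intro mult_left_mono) (auto simp: s_def)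
            also have "\<dots> \<le> 1 * (s / 4)" using t s by (intro mult_right_mono) auto
            finally show ?thesis .
          qed
          moreover have "N \<bullet> N = 1" using N by (simp add: norm_eq_1)
          ultimately have "N \<bullet> (s *\<^sub>R N - t *\<^sub>R (z - y)) \<ge> s - s / 4" by (simp add: inner_diff_right)
          then show "N \<bullet> (s *\<^sub>R N - t *\<^sub>R (z - y)) > norm (s *\<^sub>R N - t *\<^sub>R (z - y)) / 4"
            using b[OF t] s by linarith
        qed
        have "\<bar>extension \<Omega> f z' - extension \<Omega> f y'\<bar> \<le> \<eta> * norm (z' - y')"
        proof (rule segment_increment_bound[OF fC fE])
          show "y' \<in> closure \<Omega>" using in'(1) closure_subset by blast
          show "y' + t *\<^sub>R (z' - y') \<in> \<Omega>" if "0 < t" "t \<le> 1" for t using i that by simp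
          show "norm (grad f (y' + t *\<^sub>R (z' - y'))) \<le> \<eta>" if t: "0 < t" "t < 1" for t
          proof (rule \<eta>[OF i])
            show "y' + t *\<^sub>R (z' - y') \<in> cball y (3 * norm (z - y))"
              unfolding eq mem_cball dist_norm using order_trans[OF b[of t], of "3 * s"] t s by (simp add: s_def)
          qed (use t in auto)
        qed
        then show ?thesis by (simp add: z'_def y'_def s_def)
      qed
      show ?thesis
        using side[of y] side[of z] mid unfolding y'_def z'_def s_def by force
    qed (simp add: s_def)
  qed

  \<comment> \<open>The boundary as a graph over the tangent line.\<close>
  define a where "a = r / 32"
  have a: "a > 0" using r by (simp add: a_def)
  have "\<exists>s. \<bar>s\<bar> \<le> \<bar>t\<bar> \<and> x + t *\<^sub>R T + s *\<^sub>R N \<in> frontier \<Omega>" if t: "\<bar>t\<bar> < a" for t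
  proof (cases "t = 0")
    case True then show ?thesis using x by (intro exI[of _ 0]) simp
  next
    case False
    have nn: "norm (t *\<^sub>R T + s *\<^sub>R N) \<le> 2 * \<bar>t\<bar>" if "\<bar>s\<bar> \<le> \<bar>t\<bar>" for s
      using norm_triangle_ineq[of "t *\<^sub>R T" "s *\<^sub>R N"] T N that by simp
    have inr: "x + v \<in> cball x r" if "norm v \<le> 2 * \<bar>t\<bar>" for v
      using that t a by (simp add: a_def dist_norm)
    have NN: "N \<bullet> N = 1" "N \<bullet> T = 0" using N T by (simp_all add: norm_eq_1 inner_commute)
    define p where "p = x + t *\<^sub>R T - \<bar>t\<bar> *\<^sub>R N"
    define q where "q = x + t *\<^sub>R T + \<bar>t\<bar> *\<^sub>R N"
    have "q \<notin> closure \<Omega>"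
    proof -
      have "x + (t *\<^sub>R T + \<bar>t\<bar> *\<^sub>R N) \<notin> closure \<Omega>"
        by (rule out[OF x]) (use r inr[OF nn] nn[of "\<bar>t\<bar>"] False NN in \<open>auto simp: inner_add_right\<close>)
      then show ?thesis by (simp add: q_def add.assoc)
    qed
    then have q: "q \<notin> \<Omega>" using closure_subset by blast
    have p: "p \<in> \<Omega>"
    proof -
      have e: "norm (\<bar>t\<bar> *\<^sub>R N - t *\<^sub>R T) \<le> 2 * \<bar>t\<bar>"
        using norm_triangle_ineq4[of "\<bar>t\<bar> *\<^sub>R N" "t *\<^sub>R T"] T N by simp
      have "x - (\<bar>t\<bar> *\<^sub>R N - t *\<^sub>R T) \<in> \<Omega>"
      proof (rule inn[OF x])
        show "x - (\<bar>t\<bar> *\<^sub>R N - t *\<^sub>R T) \<in> cball x r"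
          unfolding mem_cball dist_norm using order_trans[OF e, of r] t a by (simp add: a_def)
      qed (use r e False NN in \<open>auto simp: inner_diff_right\<close>)
      then show ?thesis by (simp add: p_def algebra_simps)
    qed
    obtain \<tau> where \<tau>: "0 < \<tau>" "\<tau> \<le> 1" "p + \<tau> *\<^sub>R (q - p) \<in> frontier \<Omega>"
      using first_exit[OF \<Omega> p q] by blast
    have "p + \<tau> *\<^sub>R (q - p) = x + t *\<^sub>R T + ((2 * \<tau> - 1) * \<bar>t\<bar>) *\<^sub>R N"
      by (simp add: p_def q_def vec_eq_iff algebra_simps)
    moreover have "\<bar>(2 * \<tau> - 1) * \<bar>t\<bar>\<bar> \<le> 1 * \<bar>t\<bar>"
      unfolding abs_mult using \<tau> by (intro mult_mono) auto
    ultimately show ?thesis using \<tau>(3) by (intro exI[of _ "(2 * \<tau> - 1) * \<bar>t\<bar>"]) simp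
  qed
  then obtain \<gamma> where \<gamma>: "\<And>t. \<bar>t\<bar> < a \<Longrightarrow> \<bar>\<gamma> t\<bar> \<le> \<bar>t\<bar>"
    "\<And>t. \<bar>t\<bar> < a \<Longrightarrow> x + t *\<^sub>R T + \<gamma> t *\<^sub>R N \<in> frontier \<Omega>" by metis
  define c where "c t = x + t *\<^sub>R T + \<gamma> t *\<^sub>R N" for t
  have c: "c t \<in> frontier \<Omega>" "c t \<in> ball x (r/8)" if "\<bar>t\<bar> < a" for t
  proof -
    show "c t \<in> frontier \<Omega>" using \<gamma>(2)[OF that] by (simp add: c_def)
    have "norm (t *\<^sub>R T + \<gamma> t *\<^sub>R N) \<le> 2 * \<bar>t\<bar>"
      using norm_triangle_ineq[of "t *\<^sub>R T" "\<gamma> t *\<^sub>R N"] T N \<gamma>(1)[OF that] by simp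
    moreover have "dist x (c t) = norm (t *\<^sub>R T + \<gamma> t *\<^sub>R N)"
      by (subst dist_commute) (simp add: c_def dist_norm add.assoc)
    ultimately show "c t \<in> ball x (r/8)" using that a by (simp add: a_def)
  qed
  have lip: "norm (c t - c t') \<le> 2 * \<bar>t - t'\<bar>" if "\<bar>t\<bar> < a" "\<bar>t'\<bar> < a" for t t'
  proof -
    have D: "c t - c t' = (t - t') *\<^sub>R T + (\<gamma> t - \<gamma> t') *\<^sub>R N" by (simp add: c_def algebra_simps)
    have "N \<bullet> (c t - c t') = \<gamma> t - \<gamma> t'"
      unfolding D using N T by (simp add: inner_add_right norm_eq_1 inner_commute)
    moreover have "\<bar>N \<bullet> (c t - c t')\<bar> \<le> norm (c t - c t') / 4"
      by (rule flat) (use c[OF that(1)] c[OF that(2)] r in auto)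
    moreover have "norm (c t - c t') \<le> \<bar>t - t'\<bar> + \<bar>\<gamma> t - \<gamma> t'\<bar>"
      unfolding D using norm_triangle_ineq[of "(t - t') *\<^sub>R T" "(\<gamma> t - \<gamma> t') *\<^sub>R N"] T N by simp
    ultimately have "norm (c t - c t') \<le> \<bar>t - t'\<bar> + norm (c t - c t') / 4" by simp
    moreover have "n \<le> 2 * m" if "n \<le> m + n / 4" "0 \<le> m" for n m :: real using that by linarith
    ultimately show ?thesis using abs_ge_zero by blast
  qed
  have "((\<lambda>t. extension \<Omega> f (c t)) has_real_derivative 0) (at t)" if t: "\<bar>t\<bar> < a" for t
    unfolding has_field_derivative_def has_derivative_at_alt
  proof (intro conjI allI impI)
    show "bounded_linear ((*) (0::real))" by (rule bounded_linear_mult_right)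
    fix e :: real assume e: "e > 0"
    obtain \<delta> where \<delta>: "\<delta> > 0" "\<And>p. p \<in> \<Omega> \<Longrightarrow> p \<in> ball (c t) \<delta> \<Longrightarrow> norm (grad f p - bgrad \<Omega> f (c t)) \<le> e / 6"
      using grad_near_boundary_point[OF f cl[OF c(1)[OF t]], of "e / 6"] e by auto
    show "\<exists>d>0. \<forall>s. norm (s - t) < d \<longrightarrow> norm (extension \<Omega> f (c s) - extension \<Omega> f (c t) - 0 * (s - t)) \<le> e * norm (s - t)"
    proof (intro exI[of _ "min (\<delta> / 6) (a - \<bar>t\<bar>)"] conjI allI impI)
      show "min (\<delta> / 6) (a - \<bar>t\<bar>) > 0" using \<delta>(1) t by simp
      fix s assume s: "norm (s - t) < min (\<delta> / 6) (a - \<bar>t\<bar>)"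
      then have sa: "\<bar>s\<bar> < a" by auto
      note L = lip[OF sa t]
      have "\<bar>extension \<Omega> f (c s) - extension \<Omega> f (c t)\<bar> \<le> 3 * (e / 6) * norm (c s - c t)"
      proof (rule path[OF c(1)[OF t] c(1)[OF sa] c(2)[OF t] c(2)[OF sa]])
        fix p assume "p \<in> \<Omega>" "p \<in> cball (c t) (3 * norm (c s - c t))"
        moreover from this have "p \<in> ball (c t) \<delta>" using L s by simp
        ultimately show "norm (grad f p) \<le> e / 6" using \<delta>(2)[of p] g0[OF c(1)[OF t]] by simp
      qed
      also have "\<dots> \<le> 3 * (e / 6) * (2 * \<bar>s - t\<bar>)" using L e by (intro mult_left_mono) auto
      finally show "norm (extension \<Omega> f (c s) - extension \<Omega> f (c t) - 0 * (s - t)) \<le> e * norm (s - t)" by simp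
    qed
  qed
  then have "\<exists>k. \<forall>t\<in>{-a<..<a}. extension \<Omega> f (c t) = k"
    by (intro has_field_derivative_zero_constant) (auto intro: has_field_derivative_at_within)
  then obtain k where k: "\<And>t. \<bar>t\<bar> < a \<Longrightarrow> extension \<Omega> f (c t) = k" by (auto simp: abs_less_iff)
  have onc: "y = c ((y - x) \<bullet> T)" "\<bar>(y - x) \<bullet> T\<bar> < a" if y: "y \<in> frontier \<Omega>" "y \<in> ball x a" for y
  proof -
    define t where "t = (y - x) \<bullet> T"
    have "\<bar>t\<bar> \<le> norm (y - x) * norm T" unfolding t_def by (rule Cauchy_Schwarz_ineq2)
    then show ta: "\<bar>(y - x) \<bullet> T\<bar> < a" using y(2) T by (simp add: t_def dist_norm norm_minus_commute)
    have ta': "\<bar>t\<bar> < a" using ta by (simp add: t_def)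
    have "y - c t = (y - x) - t *\<^sub>R T - \<gamma> t *\<^sub>R N" by (simp add: c_def algebra_simps)
    also have "\<dots> = ((y - x) \<bullet> N - \<gamma> t) *\<^sub>R N"
      by (subst (1) dec[of "y - x"]) (simp add: t_def algebra_simps)
    finally have D: "y - c t = ((y - x) \<bullet> N - \<gamma> t) *\<^sub>R N" .
    have "\<bar>N \<bullet> (y - c t)\<bar> \<le> norm (y - c t) / 4"
      by (rule flat) (use c[OF ta'] y r in \<open>auto simp: a_def\<close>)
    moreover have "\<bar>N \<bullet> (y - c t)\<bar> = norm (y - c t)" using N by (simp add: D norm_eq_1)
    ultimately have "norm (y - c t) = 0" using norm_ge_zero[of "y - c t"] by linarith
    then show "y = c ((y - x) \<bullet> T)" by (simp add: t_def)
  qed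
  show thesis
  proof (rule that[OF a])
    fix y assume y: "y \<in> frontier \<Omega>" "y \<in> ball x a"
    have "extension \<Omega> f y = k" using onc[OF y] k by metis
    moreover have "extension \<Omega> f x = k" using onc[OF x] k a by (metis centre_in_ball)
    ultimately show "extension \<Omega> f y = extension \<Omega> f x" by simp
  qed
qed

text \<open>The boundary of a component of the complement of a connected set is connected, and the boundary value is locally constant on it.\<close>

lemma frontier_component_constant:
  assumes smooth: "smooth_open_set \<Omega>" and con: "connected \<Omega>" and f: "sub \<Omega> f"
    and g0: "\<And>y. y \<in> frontier \<Omega> \<Longrightarrow> bgrad \<Omega> f y = 0"
    and C: "C \<in> components (- \<Omega>)" and yz: "y \<in> frontier C" "z \<in> frontier C"
  shows "extension \<Omega> f y = extension \<Omega> f z"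
proof -
  have sub: "frontier C \<subseteq> frontier \<Omega>"
    using frontier_of_components_subset[OF C] by (simp add: frontier_complement)
  have "connected (frontier C)" by (rule connected_frontier_component_complement[OF con C])
  then have "extension \<Omega> f constant_on frontier C"
  proof (rule locally_constant_imp_constant)
    fix x assume x: "x \<in> frontier C"
    obtain a where a: "a > 0" "\<And>y. y \<in> frontier \<Omega> \<Longrightarrow> y \<in> ball x a \<Longrightarrow> extension \<Omega> f y = extension \<Omega> f x"
      using frontier_locally_constant[OF smooth f _ g0] x sub by blast
    show "\<exists>T. openin (top_of_set (frontier C)) T \<and> x \<in> T \<and> (\<forall>y\<in>T. extension \<Omega> f y = extension \<Omega> f x)"
    proof (intro exI[of _ "frontier C \<inter> ball x a"] conjI ballI)
      show "openin (top_of_set (frontier C)) (frontier C \<inter> ball x a)" by (rule openin_open_Int[OF open_ball])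
      show "x \<in> frontier C \<inter> ball x a" using x a(1) by simp
      show "extension \<Omega> f y = extension \<Omega> f x" if "y \<in> frontier C \<inter> ball x a" for y
        using a(2)[of y] that sub by blast
    qed
  qed
  then show ?thesis using yz unfolding constant_on_def by metis
qed

text \<open>Extended by its boundary value on each component of the complement, the function
  becomes continuously differentiable on the whole plane.\<close>

lemma extension_to_plane:
  assumes smooth: "smooth_open_set \<Omega>" and con: "connected \<Omega>" and f: "sub \<Omega> f"
    and g0: "\<And>y. y \<in> frontier \<Omega> \<Longrightarrow> bgrad \<Omega> f y = 0"
  obtains W where "C1_on UNIV W" "\<And>x i. pd i W x = (if x \<in> \<Omega> then pd i f x else 0)"
    "\<And>x. x \<in> frontier \<Omega> \<Longrightarrow> W x = extension \<Omega> f x"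
    "\<And>C x y. connected C \<Longrightarrow> C \<subseteq> - \<Omega> \<Longrightarrow> x \<in> C \<Longrightarrow> y \<in> C \<Longrightarrow> W x = W y"
proof -
  have \<Omega>: "open \<Omega>" using smooth by (simp add: smooth_open_set_def)
  have fC: "C1_on \<Omega> f" and fE: "has_extension \<Omega> f" using f sub_C1_on sub_extension by auto
  define cc where "cc x = connected_component_set (- \<Omega>) x" for x
  define W where "W x = (if x \<in> \<Omega> then f x else extension \<Omega> f (SOME z. z \<in> frontier (cc x)))" for x
  have W\<Omega>: "W x = f x" if "x \<in> \<Omega>" for x using that by (simp add: W_def)
  have Wc: "W x = W y" if "connected C" "C \<subseteq> - \<Omega>" "x \<in> C" "y \<in> C" for C x y
  proof -
    have "connected_component (- \<Omega>) x y" using that unfolding connected_component_def by blast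
    then have "cc x = cc y" unfolding cc_def using connected_component_eq[of y "- \<Omega>" x] by simp
    then show ?thesis using that by (auto simp: W_def)
  qed
  have Wf: "W x = extension \<Omega> f x" if x: "x \<in> frontier \<Omega>" for x
  proof -
    have xn: "x \<notin> \<Omega>" "x \<in> closure \<Omega>" using frontier_open_limit[OF \<Omega> x] by auto
    have C: "cc x \<in> components (- \<Omega>)" using xn unfolding cc_def by (simp add: componentsI)
    have "x \<in> cc x" using xn by (simp add: cc_def)
    moreover have "x \<in> closure (- cc x)"
    proof -
      have "\<Omega> \<subseteq> - cc x" using in_components_subset[OF C] by blast
      then show ?thesis using xn(2) closure_mono by blast
    qed
    ultimately have xf: "x \<in> frontier (cc x)" using closure_subset by (auto simp: frontier_closures)
    then have "(SOME z. z \<in> frontier (cc x)) \<in> frontier (cc x)" by (rule someI)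
    then show ?thesis using xn frontier_component_constant[OF smooth con f g0 C _ xf] by (simp add: W_def)
  qed
  have D0: "(W has_derivative (\<lambda>h. 0)) (at x)" if x: "x \<notin> \<Omega>" for x
  proof (cases "x \<in> closure \<Omega>")
    case False
    then obtain e where e: "e > 0" "ball x e \<subseteq> - closure \<Omega>"
      using open_contains_ball[of "- closure \<Omega>"] by auto
    have Wx: "W y = W x" if "y \<in> ball x e" for y
      by (rule Wc[OF connected_ball, of x e]) (use e that closure_subset[of \<Omega>] in auto)
    have "(W has_derivative (\<lambda>h. 0)) (at x) \<longleftrightarrow> ((\<lambda>y. W x) has_derivative (\<lambda>h. 0)) (at x)"
    proof (rule has_derivative_cong_open[OF open_ball])
      show "x \<in> ball x e" using e(1) by simp
    qed (rule Wx)
    then show ?thesis using has_derivative_const by blast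
  next
    case True
    then have xf: "x \<in> frontier \<Omega>" using x \<Omega> by (simp add: frontier_def interior_open)
    obtain a where a: "a > 0" "\<And>y. y \<in> frontier \<Omega> \<Longrightarrow> y \<in> ball x a \<Longrightarrow> extension \<Omega> f y = extension \<Omega> f x"
      using frontier_locally_constant[OF smooth f xf g0] by metis
    show ?thesis unfolding has_derivative_at_alt
    proof (intro conjI allI impI)
      show "bounded_linear (\<lambda>h::real^2. 0::real)" by (rule bounded_linear_zero)
      fix e :: real assume e: "e > 0"
      obtain \<delta> where \<delta>: "\<delta> > 0" "\<And>y. y \<in> \<Omega> \<Longrightarrow> y \<in> ball x \<delta> \<Longrightarrow> norm (grad f y - bgrad \<Omega> f x) \<le> e"
        using grad_near_boundary_point[OF f True e] by blast
      define d where "d = min a \<delta>"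
      have d: "d > 0" using a \<delta> by (simp add: d_def)
      show "\<exists>d>0. \<forall>y. norm (y - x) < d \<longrightarrow> norm (W y - W x - 0) \<le> e * norm (y - x)"
      proof (intro exI[of _ d] conjI allI impI d)
        fix y assume "norm (y - x) < d"
        then have yb: "y \<in> ball x d" by (simp add: dist_norm norm_minus_commute)
        show "norm (W y - W x - 0) \<le> e * norm (y - x)"
        proof (cases "y \<in> \<Omega>")
          case yO: True
          obtain z where z: "z \<in> frontier \<Omega>" "z \<in> ball x d" "\<bar>f y - extension \<Omega> f z\<bar> \<le> e * norm (y - x)"
          proof (rule boundary_increment_bound[OF \<Omega> fC fE yO x yb])
            show "x \<in> ball x d" using d by simp
            show "norm (grad f p) \<le> e" if "p \<in> \<Omega>" "p \<in> ball x d" for p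
              using \<delta>(2)[of p] that g0[OF xf] by (simp add: d_def)
          qed
          then show ?thesis using a(2)[of z] Wf[OF xf] W\<Omega>[OF yO] by (simp add: d_def)
        next
          case False
          \<comment> \<open>the first point of the closure on the way from \<open>y\<close> to \<open>x\<close>\<close>
          let ?z = "\<lambda>s. y + s *\<^sub>R (x - y)"
          let ?S = "{0..1} \<inter> ?z -` closure \<Omega>"
          have zc: "continuous_on X ?z" for X by (intro continuous_intros)
          have "closed ?S" by (rule continuous_closed_preimage[OF zc]) auto
          then have S: "compact ?S" using compact_Int_closed[of "{0..1::real}" ?S] by (simp add: Int_absorb1 inf_commute)
          have "1 \<in> ?S" using True by simp
          then obtain t where t: "t \<in> ?S" "\<And>s. s \<in> ?S \<Longrightarrow> t \<le> s"
            using compact_attains_inf[OF S] by blast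
          have before: "?z s \<notin> closure \<Omega>" if "0 \<le> s" "s < t" for s using t(2)[of s] t(1) that by force
          have zt: "?z t \<notin> \<Omega>"
          proof (cases "t = 0")
            case False
            have "?z ` closure {0..<t} \<subseteq> - \<Omega>"
              by (rule image_closure_subset[OF zc]) (use before closure_subset[of \<Omega>] \<Omega> in auto)
            then show ?thesis using t(1) False by (auto simp: image_subset_iff)
          qed (use \<open>y \<notin> \<Omega>\<close> in simp)
          then have zf: "?z t \<in> frontier \<Omega>" using t(1) \<Omega> by (auto simp: frontier_def interior_open)
          have "W y = W (?z t)"
          proof (rule Wc)
            show "connected (?z ` {0..t})" by (rule connected_continuous_image[OF zc]) simp
            show "?z ` {0..t} \<subseteq> - \<Omega>"
            proof (clarify)
              fix s assume "s \<in> {0..t}" "?z s \<in> \<Omega>"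
              then show False using before[of s] zt closure_subset[of \<Omega>] by (cases "s = t") auto
            qed
            show "y \<in> ?z ` {0..t}" using t(1) by (intro image_eqI[of _ _ 0]) auto
            show "?z t \<in> ?z ` {0..t}" using t(1) by (intro imageI) simp
          qed
          also have "\<dots> = W x"
          proof -
            have "(1 - t) *\<^sub>R y + t *\<^sub>R x \<in> ball x d"
              by (rule convexD[OF convex_ball yb]) (use t(1) d in auto)
            then have "?z t \<in> ball x a" by (simp add: d_def algebra_simps)
            then show ?thesis using a(2)[OF zf] Wf[OF zf] Wf[OF xf] by simp
          qed
          finally show ?thesis using e by simp
        qed
      qed
    qed
  qed
  have pdW: "pd i W x = (if x \<in> \<Omega> then pd i f x else 0)" for x i
  proof (cases "x \<in> \<Omega>")
    case True
    then show ?thesis using pd_cong[of \<Omega> x W f i, OF \<Omega> True W\<Omega>] by simp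
  next
    case False
    then show ?thesis using pd_eqI[OF D0[OF False]] by simp
  qed
  have "C1_on UNIV W"
  proof (rule C1_onI[where g = "\<lambda>i x. if x \<in> \<Omega> then pd i f x else 0"])
    show "W differentiable (at x)" for x
    proof (cases "x \<in> \<Omega>")
      case True
      then show ?thesis using differentiable_congI[of \<Omega> x f W, OF \<Omega> True C1_onD(1)[OF fC True] W\<Omega>] by simp
    qed (use D0 differentiable_def in blast)
    fix i
    let ?G = "\<lambda>x. if x \<in> \<Omega> then pd i f x else 0"
    have "continuous_on (closure \<Omega>) ?G"
    proof (rule continuous_on_eq)
      show "continuous_on (closure \<Omega>) (\<lambda>x. bgrad \<Omega> f x $ i)" by (intro continuous_intros bgrad(1)[OF f])
      show "bgrad \<Omega> f x $ i = ?G x" if "x \<in> closure \<Omega>" for x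
      proof (cases "x \<in> \<Omega>")
        case True then show ?thesis using bgrad(2)[OF f True] by (simp add: grad_def)
      next
        case False
        then have "x \<in> frontier \<Omega>" using that \<Omega> by (simp add: frontier_def interior_open)
        then show ?thesis using False g0 by simp
      qed
    qed
    moreover have "continuous_on (- \<Omega>) ?G" by (rule continuous_on_eq[OF continuous_on_const[of _ 0]]) auto
    ultimately have "continuous_on (closure \<Omega> \<union> - \<Omega>) ?G" using \<Omega> by (intro continuous_on_closed_Un) auto
    moreover have "closure \<Omega> \<union> - \<Omega> = UNIV" using closure_subset by auto
    ultimately show "continuous_on UNIV ?G" by simp
  qed (rule pdW)
  then show thesis using pdW Wf Wc by (rule that)
qed

section \<open>Gradients that are integrable over the plane\<close>

text \<open>Identifies the product of two lines with the plane, so that the theorem of Tonelli applies.\<close>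

definition point :: "real \<times> real \<Rightarrow> real^2"
  where "point p = (\<chi> i. if i = 1 then fst p else snd p)"

lemma point_nth [simp]: "point p $ 1 = fst p" "point p $ 2 = snd p"
  by (simp_all add: point_def)

lemma point_components: "point (x $ 1, x $ 2) = x"
  by (simp add: vec_eq_iff forall_2)

lemma continuous_on_point: "continuous_on S point"
proof -
  have "continuous_on S (\<lambda>p. (\<chi> i. if i = 1 then fst p else snd p) :: real^2)"
  proof (rule continuous_on_vec_lambda)
    show "continuous_on S (\<lambda>p. if i = 1 then fst p else snd p :: real)" for i :: 2
      by (cases "i = 1") (auto intro!: continuous_intros)
  qed
  then show ?thesis by (simp add: point_def[abs_def])
qed

text \<open>Both measures give a box the product of its side lengths.\<close>

lemma lborel_plane: "(lborel :: (real^2) measure) = distr (lborel \<Otimes>\<^sub>M lborel) borel point"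
proof (rule lborel_eqI)
  have pm: "point \<in> borel_measurable (lborel \<Otimes>\<^sub>M lborel)"
    using borel_measurable_continuous_onI[OF continuous_on_point] by (simp add: lborel_prod)
  fix l u :: "real^2" assume lu: "\<And>b. b \<in> Basis \<Longrightarrow> l \<bullet> b \<le> u \<bullet> b"
  have ax: "axis i 1 \<in> (Basis :: (real^2) set)" for i by (auto simp: Basis_vec_def)
  have le: "l $ i \<le> u $ i" for i using lu[OF ax[of i]] by (simp add: inner_axis)
  have "point -` box l u \<inter> space (lborel \<Otimes>\<^sub>M lborel) = {l $ 1<..<u $ 1} \<times> {l $ 2<..<u $ 2}"
    by (auto simp: mem_box Basis_vec_def inner_axis space_pair_measure forall_2)
  then have "emeasure (distr (lborel \<Otimes>\<^sub>M lborel) borel point) (box l u)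
      = emeasure (lborel \<Otimes>\<^sub>M lborel) ({l $ 1<..<u $ 1} \<times> {l $ 2<..<u $ 2})"
    by (subst emeasure_distr[OF pm]) auto
  also have "\<dots> = ennreal (u $ 1 - l $ 1) * ennreal (u $ 2 - l $ 2)"
    using le by (subst lborel.emeasure_pair_measure_Times) auto
  also have "\<dots> = ennreal (\<Prod>i\<in>UNIV. u $ i - l $ i)"
    using le by (simp add: UNIV_2 ennreal_mult)
  also have "(\<Prod>i\<in>UNIV. u $ i - l $ i) = (\<Prod>b\<in>Basis. (u - l) \<bullet> b)"
  proof -
    have B: "(Basis :: (real^2) set) = (\<lambda>i. axis i 1) ` UNIV" by (auto simp: Basis_vec_def)
    have "inj (\<lambda>i::2. axis i (1::real))" by (auto simp: inj_def axis_eq_axis)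
    then show ?thesis unfolding B by (subst prod.reindex) (auto simp: inner_axis)
  qed
  finally show "emeasure (distr (lborel \<Otimes>\<^sub>M lborel) borel point) (box l u) = ennreal (\<Prod>b\<in>Basis. (u - l) \<bullet> b)" .
qed simp

lemma nn_integral_plane:
  fixes g :: "real^2 \<Rightarrow> real"
  assumes "continuous_on UNIV g"
  shows "(\<integral>\<^sup>+x. ennreal \<bar>g x\<bar> \<partial>lborel) = (\<integral>\<^sup>+s. \<integral>\<^sup>+t. ennreal \<bar>g (point (s, t))\<bar> \<partial>lborel \<partial>lborel)"
    and "(\<integral>\<^sup>+x. ennreal \<bar>g x\<bar> \<partial>lborel) = (\<integral>\<^sup>+t. \<integral>\<^sup>+s. ennreal \<bar>g (point (s, t))\<bar> \<partial>lborel \<partial>lborel)"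
proof -
  have [measurable]: "g \<in> borel_measurable borel" by (rule borel_measurable_continuous_onI[OF assms])
  have [measurable]: "point \<in> borel_measurable (lborel \<Otimes>\<^sub>M lborel)"
    using borel_measurable_continuous_onI[OF continuous_on_point] by (simp add: lborel_prod)
  have "(\<integral>\<^sup>+x. ennreal \<bar>g x\<bar> \<partial>lborel) = (\<integral>\<^sup>+p. ennreal \<bar>g (point p)\<bar> \<partial>(lborel \<Otimes>\<^sub>M lborel))"
    by (subst lborel_plane) (simp add: nn_integral_distr)
  moreover have m: "(\<lambda>p. ennreal \<bar>g (point p)\<bar>) \<in> borel_measurable (lborel \<Otimes>\<^sub>M lborel)" by measurable
  ultimately show "(\<integral>\<^sup>+x. ennreal \<bar>g x\<bar> \<partial>lborel) = (\<integral>\<^sup>+s. \<integral>\<^sup>+t. ennreal \<bar>g (point (s, t))\<bar> \<partial>lborel \<partial>lborel)"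
    and "(\<integral>\<^sup>+x. ennreal \<bar>g x\<bar> \<partial>lborel) = (\<integral>\<^sup>+t. \<integral>\<^sup>+s. ennreal \<bar>g (point (s, t))\<bar> \<partial>lborel \<partial>lborel)"
    using lborel.nn_integral_fst[OF m] lborel_pair.nn_integral_snd[OF m] by simp_all
qed

lemma increment_le_nn_integral:
  fixes F f :: "real \<Rightarrow> real"
  assumes "\<And>t. (F has_real_derivative f t) (at t)" "continuous_on UNIV f"
  shows "ennreal \<bar>F b - F a\<bar> \<le> (\<integral>\<^sup>+t. ennreal \<bar>f t\<bar> \<partial>lborel)"
proof -
  have *: "ennreal \<bar>F b - F a\<bar> \<le> (\<integral>\<^sup>+t. ennreal \<bar>f t\<bar> \<partial>lborel)" if "a \<le> b" for a b
  proof -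
    have "isCont f t" for t using assms(2) continuous_on_eq_continuous_at by blast
    then have h: "has_bochner_integral lborel (\<lambda>t. f t * indicator {a..b} t) (F b - F a)"
      by (intro has_bochner_integral_FTC_Icc_real that assms(1))
    have "ennreal \<bar>F b - F a\<bar> \<le> (\<integral>\<^sup>+t. ennreal (norm (f t * indicator {a..b} t)) \<partial>lborel)"
      using integral_norm_bound_ennreal[of lborel "\<lambda>t. f t * indicator {a..b} t"] h
      unfolding has_bochner_integral_iff by simp
    also have "\<dots> \<le> (\<integral>\<^sup>+t. ennreal \<bar>f t\<bar> \<partial>lborel)"
      by (intro nn_integral_mono) (auto simp: indicator_def)
    finally show ?thesis .
  qed
  show ?thesis using *[of a b] *[of b a] by (cases "a \<le> b") (auto simp: abs_minus_commute)
qed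


lemma ennreal_abs_triangle: "ennreal \<bar>x - z\<bar> \<le> ennreal \<bar>x - y\<bar> + ennreal \<bar>y - z\<bar>" for x y z :: real
  by (simp flip: ennreal_plus)

text \<open>Two unbounded connected sets both meet the boundary of every large square.  If the
  function takes different constant values on them, its gradient has an integral over the boundary of
  each large square that is bounded below, and so it is not integrable.\<close>

lemma integrable_gradient_unbounded_connected:
  assumes W: "C1_on UNIV W" and fin: "\<And>i. (\<integral>\<^sup>+x. ennreal \<bar>pd i W x\<bar> \<partial>lborel) < \<infinity>"
    and A: "connected A" "\<not> bounded A" "\<And>x. x \<in> A \<Longrightarrow> W x = \<alpha>"
    and B: "connected B" "\<not> bounded B" "\<And>x. x \<in> B \<Longrightarrow> W x = \<beta>"
  shows "\<alpha> = \<beta>"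
proof (rule ccontr)
  assume "\<alpha> \<noteq> \<beta>"
  define v where "v r = (\<integral>\<^sup>+t. ennreal \<bar>pd 2 W (point (r, t))\<bar> \<partial>lborel)" for r
  define h where "h r = (\<integral>\<^sup>+s. ennreal \<bar>pd 1 W (point (s, r))\<bar> \<partial>lborel)" for r
  have pdc: "continuous_on UNIV (pd i W)" for i by (rule C1_onD(2)[OF W])
  have pc: "continuous_on S (\<lambda>r. point (r, t))" "continuous_on S (\<lambda>t. point (r, t))" for S r t
    by (rule continuous_on_compose2[OF continuous_on_point[of UNIV]]; auto intro!: continuous_intros)+
  have vert: "ennreal \<bar>W (point (r, b)) - W (point (r, a))\<bar> \<le> v r" for r a b
    unfolding v_def
  proof (rule increment_le_nn_integral[where F = "\<lambda>t. W (point (r, t))" and f = "\<lambda>t. pd 2 W (point (r, t))"])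
    have e: "point (r, t) = point (r, 0) + t *\<^sub>R axis 2 1" for t
      by (simp add: vec_eq_iff forall_2 axis_def)
    show "((\<lambda>t. W (point (r, t))) has_real_derivative pd 2 W (point (r, t))) (at t)" for t
      using real_derivative_along_line[of W "point (r, 0)" t "axis 2 1"] C1_onD(1)[OF W]
      by (simp add: e[symmetric] inner_axis grad_def)
    show "continuous_on UNIV (\<lambda>t. pd 2 W (point (r, t)))"
      by (rule continuous_on_compose2[OF pdc pc(2)]) simp
  qed
  have horiz: "ennreal \<bar>W (point (b, r)) - W (point (a, r))\<bar> \<le> h r" for r a b
    unfolding h_def
  proof (rule increment_le_nn_integral[where F = "\<lambda>s. W (point (s, r))" and f = "\<lambda>s. pd 1 W (point (s, r))"])
    have e: "point (s, r) = point (0, r) + s *\<^sub>R axis 1 1" for s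
      by (simp add: vec_eq_iff forall_2 axis_def)
    show "((\<lambda>s. W (point (s, r))) has_real_derivative pd 1 W (point (s, r))) (at s)" for s
      using real_derivative_along_line[of W "point (0, r)" s "axis 1 1"] C1_onD(1)[OF W]
      by (simp add: e[symmetric] inner_axis grad_def)
    show "continuous_on UNIV (\<lambda>s. pd 1 W (point (s, r)))"
      by (rule continuous_on_compose2[OF pdc pc(1)]) simp
  qed
  define Q where "Q r = v r + v (- r) + h r + h (- r)" for r
  define f where "f z = max \<bar>z $ 1\<bar> \<bar>z $ 2\<bar>" for z :: "real^2"
  have corner: "ennreal \<bar>W z - W (point (r, r))\<bar> \<le> Q r" if fz: "f z = r" for z r
  proof -
    have z: "z = point (z $ 1, z $ 2)" by (simp add: point_components)
    have le: "v r \<le> Q r" "h r \<le> Q r" "v (- r) + h r \<le> Q r" "h (- r) + v r \<le> Q r"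
      unfolding Q_def by (auto intro: add_increasing add_increasing2 add_mono simp: add.assoc add.commute add.left_commute)
    consider "z $ 1 = r" | "z $ 1 = - r" | "z $ 2 = r" | "z $ 2 = - r"
      using fz unfolding f_def by (auto simp: max_def abs_if split: if_splits)
    then show ?thesis
    proof cases
      case 1
      then show ?thesis using vert[of r "z $ 2" r] le(1) z by (metis order_trans)
    next
      case 2
      have "ennreal \<bar>W z - W (point (r, r))\<bar> \<le> ennreal \<bar>W z - W (point (- r, r))\<bar> + ennreal \<bar>W (point (- r, r)) - W (point (r, r))\<bar>"
        by (rule ennreal_abs_triangle)
      also have "\<dots> \<le> v (- r) + h r" using vert[of "- r" "z $ 2" r] horiz[of "- r" r r] z 2 by (intro add_mono) metis+
      finally show ?thesis using le(3) by (rule order_trans)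
    next
      case 3
      then show ?thesis using horiz[of "z $ 1" r r] le(2) z by (metis order_trans)
    next
      case 4
      have "ennreal \<bar>W z - W (point (r, r))\<bar> \<le> ennreal \<bar>W z - W (point (r, - r))\<bar> + ennreal \<bar>W (point (r, - r)) - W (point (r, r))\<bar>"
        by (rule ennreal_abs_triangle)
      also have "\<dots> \<le> h (- r) + v r" using horiz[of "z $ 1" "- r" r] vert[of r "- r" r] z 4 by (intro add_mono) metis+
      finally show ?thesis using le(4) by (rule order_trans)
    qed
  qed
  have meets: "\<exists>z\<in>S. f z = r" if S: "connected S" "\<not> bounded S" "x \<in> S" "f x \<le> r" for S x r
  proof -
    have "continuous_on S f" unfolding f_def by (intro continuous_intros)
    then have c: "connected (f ` S)" using S(1) by (rule connected_continuous_image)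
    have "\<exists>y\<in>S. r \<le> f y"
    proof (rule ccontr)
      assume "\<not> ?thesis"
      then have "norm y \<le> 2 * r" if "y \<in> S" for y
        using norm_le_l1_cart[of y] that unfolding f_def sum_2 by fastforce
      then show False using S(2) unfolding bounded_iff by blast
    qed
    then obtain y where "y \<in> S" "r \<le> f y" by blast
    then have "r \<in> f ` S"
      using connected_contains_Icc[OF c imageI[OF S(3)] imageI[of y S f]] S(4) by auto
    then show ?thesis by auto
  qed
  obtain a b where ab: "a \<in> A" "b \<in> B" using A(2) B(2) by fastforce
  \<comment> \<open>from this radius on the squares enclose a point of each of the two sets\<close>
  define r0 where "r0 = max (f a) (f b)"
  have low: "ennreal \<bar>\<alpha> - \<beta>\<bar> \<le> Q r + Q r" if r: "r0 \<le> r" for r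
  proof -
    obtain a' b' where a': "a' \<in> A" "f a' = r" and b': "b' \<in> B" "f b' = r"
      using meets[OF A(1,2) ab(1), of r] meets[OF B(1,2) ab(2), of r] r unfolding r0_def by auto
    have "ennreal \<bar>W a' - W b'\<bar> \<le> ennreal \<bar>W a' - W (point (r, r))\<bar> + ennreal \<bar>W (point (r, r)) - W b'\<bar>"
      by (rule ennreal_abs_triangle)
    also have "\<dots> \<le> Q r + Q r"
      using corner[OF a'(2)] corner[OF b'(2)] by (intro add_mono) (auto simp: abs_minus_commute)
    finally show ?thesis using A(3)[OF a'(1)] B(3)[OF b'(1)] by simp
  qed
  have pm: "(\<lambda>p. ennreal \<bar>pd i W (point p)\<bar>) \<in> borel_measurable (lborel \<Otimes>\<^sub>M lborel)" for i
    using borel_measurable_continuous_onI[OF continuous_on_compose2[OF continuous_on_rabs[OF pdc[of i]] continuous_on_point[of UNIV]]]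
    by (simp add: lborel_prod)
  have vm: "v \<in> borel_measurable borel"
    using lborel.borel_measurable_nn_integral_fst[OF pm[of 2]] by (simp add: v_def[abs_def])
  have hm: "h \<in> borel_measurable borel"
  proof -
    have "continuous_on UNIV (\<lambda>q. point (snd q, fst q))"
      by (rule continuous_on_compose2[OF continuous_on_point[of UNIV]]) (auto intro!: continuous_intros)
    then have "continuous_on UNIV (\<lambda>q. \<bar>pd 1 W (point (snd q, fst q))\<bar>)"
      by (intro continuous_on_rabs continuous_on_compose2[OF pdc]) auto
    then have "(\<lambda>q. ennreal \<bar>pd 1 W (point (snd q, fst q))\<bar>) \<in> borel_measurable (lborel \<Otimes>\<^sub>M lborel)"
      using borel_measurable_continuous_onI by (simp add: lborel_prod)
    from lborel.borel_measurable_nn_integral_fst[OF this] show ?thesis by (simp add: h_def[abs_def])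
  qed
  have iv: "(\<integral>\<^sup>+r. v r \<partial>lborel) < \<infinity>" and ih: "(\<integral>\<^sup>+r. h r \<partial>lborel) < \<infinity>"
    using fin[of 2] fin[of 1] nn_integral_plane[OF pdc] by (simp_all add: v_def h_def)
  have iv': "(\<integral>\<^sup>+r. v (- r) \<partial>lborel) = (\<integral>\<^sup>+r. v r \<partial>lborel)" and ih': "(\<integral>\<^sup>+r. h (- r) \<partial>lborel) = (\<integral>\<^sup>+r. h r \<partial>lborel)"
    using nn_integral_real_affine[OF vm, of "-1" 0] nn_integral_real_affine[OF hm, of "-1" 0] by simp_all
  note [measurable] = vm hm
  define I where "I = (\<integral>\<^sup>+r. Q r + Q r \<partial>lborel)"
  have "I = (\<integral>\<^sup>+r. Q r \<partial>lborel) + (\<integral>\<^sup>+r. Q r \<partial>lborel)"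
    unfolding I_def Q_def by (intro nn_integral_add) measurable
  moreover have "(\<integral>\<^sup>+r. Q r \<partial>lborel) = (\<integral>\<^sup>+r. v r \<partial>lborel) + (\<integral>\<^sup>+r. v r \<partial>lborel) + (\<integral>\<^sup>+r. h r \<partial>lborel) + (\<integral>\<^sup>+r. h r \<partial>lborel)"
    unfolding Q_def by (simp add: nn_integral_add iv' ih')
  ultimately have fI: "I < \<infinity>" using iv ih by simp
  then obtain K where K: "I = ennreal K" "K \<ge> 0" by (metis ennreal_cases infinity_ennreal_def less_irrefl)
  obtain n :: nat where n: "K < real n * \<bar>\<alpha> - \<beta>\<bar>"
    using \<open>\<alpha> \<noteq> \<beta>\<close> reals_Archimedean3[of "\<bar>\<alpha> - \<beta>\<bar>"] by auto
  have "ennreal (real n * \<bar>\<alpha> - \<beta>\<bar>) = (\<integral>\<^sup>+r. ennreal \<bar>\<alpha> - \<beta>\<bar> * indicator {r0..r0 + real n} r \<partial>lborel)"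
    by (simp add: nn_integral_cmult_indicator ennreal_mult mult.commute)
  also have "\<dots> \<le> I"
    unfolding I_def by (intro nn_integral_mono) (auto simp: indicator_def intro: low)
  finally show False using n K by simp
qed

text \<open>Transported from the characterisation of simply connected open subsets of the complex plane.\<close>

lemma simply_connected_complement_unbounded:
  fixes \<Omega> :: "(real^2) set"
  assumes "open \<Omega>" "simply_connected \<Omega>" "C \<in> components (- \<Omega>)"
  shows "\<not> bounded C"
proof -
  define h where "h x = Complex (x $ 1) (x $ 2)" for x :: "real^2"
  define k where "k z = point (Re z, Im z)" for z
  have kh: "k (h x) = x" and hk: "h (k z) = z" for x z
    by (simp_all add: h_def k_def point_components)
  have hc: "continuous_on S h" for S unfolding h_def[abs_def] Complex_eq by (intro continuous_intros)
  have kc: "continuous_on S k" for S unfolding k_def[abs_def]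
    by (rule continuous_on_compose2[OF continuous_on_point[of UNIV]]) (auto intro!: continuous_intros)
  have im: "h ` S = k -` S" for S
  proof (intro set_eqI iffI)
    fix z assume "z \<in> k -` S"
    then have "h (k z) \<in> h ` S" by simp
    then show "z \<in> h ` S" by (simp only: hk)
  qed (auto simp: kh)
  have "open (h ` \<Omega>)" unfolding im by (rule open_vimage[OF assms(1) kc])
  moreover have "homeomorphism \<Omega> (h ` \<Omega>) h k"
    by (rule homeomorphismI[OF hc kc]) (auto simp: kh hk)
  then have "simply_connected (h ` \<Omega>)"
    using assms(2) homeomorphic_simply_connected[of \<Omega> "h ` \<Omega>"] unfolding homeomorphic_def by blast
  ultimately have unb: "\<forall>C\<in>components (- h ` \<Omega>). \<not> bounded C"
    using simply_connected_eq_unbounded_complement_components[of "h ` \<Omega>"] by simp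
  have "h ` C \<in> components (- h ` \<Omega>)"
    unfolding in_components_maximal
  proof (intro conjI allI impI)
    have C: "C \<noteq> {}" "C \<subseteq> - \<Omega>" "connected C" "\<And>D. D \<noteq> {} \<and> C \<subseteq> D \<and> D \<subseteq> - \<Omega> \<and> connected D \<Longrightarrow> D = C"
      using assms(3) unfolding in_components_maximal by blast+
    show "h ` C \<noteq> {}" using C by simp
    have inj: "h x = h y \<longleftrightarrow> x = y" for x y by (metis kh)
    show "h ` C \<subseteq> - h ` \<Omega>" using C(2) by (auto simp: inj)
    show "connected (h ` C)" by (rule connected_continuous_image[OF hc C(3)])
    fix D assume D: "D \<noteq> {} \<and> h ` C \<subseteq> D \<and> D \<subseteq> - h ` \<Omega> \<and> connected D"
    have "k ` D = C"
    proof (rule C(4), intro conjI)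
      show "k ` D \<noteq> {}" using D by simp
      show "C \<subseteq> k ` D"
      proof
        fix x assume "x \<in> C"
        then have "k (h x) \<in> k ` D" using D by blast
        then show "x \<in> k ` D" by (simp only: kh)
      qed
      show "k ` D \<subseteq> - \<Omega>"
      proof clarify
        fix z assume z: "z \<in> D" "k z \<in> \<Omega>"
        then have "h (k z) \<in> h ` \<Omega>" by blast
        then show False using z(1) D unfolding hk by blast
      qed
      show "connected (k ` D)" using connected_continuous_image[OF kc] D by blast
    qed
    then have "h ` C = (\<lambda>z. h (k z)) ` D" by (simp add: image_image[symmetric])
    then show "D = h ` C" by (simp add: hk)
  qed
  then have "\<not> bounded (h ` C)" using unb by blast
  then show ?thesis
  proof (rule contrapos_nn)
    assume "bounded C"
    then obtain M where M: "\<And>x. x \<in> C \<Longrightarrow> norm x \<le> M" unfolding bounded_iff by blast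
    have le: "norm (h x) \<le> 2 * norm x" for x
      using cmod_le[of "h x"] component_le_norm_cart[of x 1] component_le_norm_cart[of x 2] by (simp add: h_def)
    have "norm (h x) \<le> 2 * M" if "x \<in> C" for x using le[of x] M[OF that] by linarith
    then show "bounded (h ` C)" unfolding bounded_iff by blast
  qed
qed

lemma set_integrable_continuous_bound:
  fixes g h :: "real^2 \<Rightarrow> real"
  assumes "open \<Omega>" "continuous_on \<Omega> g" "set_integrable lborel \<Omega> h" "\<And>x. x \<in> \<Omega> \<Longrightarrow> \<bar>g x\<bar> \<le> h x"
  shows "set_integrable lborel \<Omega> g"
  unfolding set_integrable_def
proof (rule Bochner_Integration.integrable_bound[OF assms(3)[unfolded set_integrable_def]])
  show "(\<lambda>x. indicator \<Omega> x *\<^sub>R g x) \<in> borel_measurable lborel"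
    using borel_measurable_continuous_on_indicator[OF _ assms(2)] assms(1) by simp
  show "AE x in lborel. norm (indicator \<Omega> x *\<^sub>R g x) \<le> norm (indicator \<Omega> x *\<^sub>R h x)"
    using assms(4) by (auto simp: indicator_def intro: order_trans[OF _ abs_ge_self])
qed

theorem constant_boundary_trace:
  assumes smooth: "smooth_open_set \<Omega>" and sc: "simply_connected \<Omega>" and area: "emeasure lborel \<Omega> < \<infinity>"
    and f: "sub \<Omega> f" and g0: "\<And>y. y \<in> frontier \<Omega> \<Longrightarrow> bgrad \<Omega> f y = 0"
    and L2: "\<And>i. set_integrable lborel \<Omega> (\<lambda>x. (pd i f x)\<^sup>2)"
  obtains c where "\<And>x. x \<in> frontier \<Omega> \<Longrightarrow> extension \<Omega> f x = c"
proof -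
  have \<Omega>: "open \<Omega>" using smooth by (simp add: smooth_open_set_def)
  have con: "connected \<Omega>" using sc by (rule simply_connected_imp_connected)
  show thesis
  proof (rule extension_to_plane[OF smooth con f g0])
  fix W assume W: "C1_on UNIV W" "\<And>x i. pd i W x = (if x \<in> \<Omega> then pd i f x else 0)"
    "\<And>x. x \<in> frontier \<Omega> \<Longrightarrow> W x = extension \<Omega> f x"
    "\<And>C x y. connected C \<Longrightarrow> C \<subseteq> - \<Omega> \<Longrightarrow> x \<in> C \<Longrightarrow> y \<in> C \<Longrightarrow> W x = W y"
  have fin: "(\<integral>\<^sup>+x. ennreal \<bar>pd i W x\<bar> \<partial>lborel) < \<infinity>" for i
  proof -
    have one: "set_integrable lborel \<Omega> (\<lambda>x. 1 :: real)"
      unfolding set_integrable_def using area \<Omega> by (simp add: integrable_real_indicator)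
    have i: "set_integrable lborel \<Omega> (\<lambda>x. 1 + (pd i f x)\<^sup>2)"
      by (intro set_integral_add one L2)
    have "(\<integral>\<^sup>+x. ennreal \<bar>pd i W x\<bar> \<partial>lborel) \<le> (\<integral>\<^sup>+x. ennreal (norm (indicator \<Omega> x *\<^sub>R (1 + (pd i f x)\<^sup>2))) \<partial>lborel)"
    proof (intro nn_integral_mono ennreal_leI)
      fix x
      have "\<bar>y\<bar> \<le> 1 + y\<^sup>2" for y :: real
        using zero_le_power2[of "\<bar>y\<bar> - 1"] by (simp add: power2_eq_square algebra_simps)
      then show "\<bar>pd i W x\<bar> \<le> norm (indicator \<Omega> x *\<^sub>R (1 + (pd i f x)\<^sup>2))"
        by (auto simp: W(2) indicator_def intro: order_trans[OF _ abs_ge_self])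
    qed
    also have "\<dots> < \<infinity>" using i unfolding set_integrable_def integrable_iff_bounded by blast
    finally show ?thesis .
  qed
  have eq: "extension \<Omega> f x = extension \<Omega> f y" if x: "x \<in> frontier \<Omega>" and y: "y \<in> frontier \<Omega>" for x y
  proof -
    let ?C = "connected_component_set (- \<Omega>)"
    have n: "x \<notin> \<Omega>" "y \<notin> \<Omega>" using frontier_open_limit(1)[OF \<Omega>] x y by auto
    have unb: "\<not> bounded (?C z)" if "z \<notin> \<Omega>" for z
      by (rule simply_connected_complement_unbounded[OF \<Omega> sc]) (use that in \<open>simp add: componentsI\<close>)
    have const: "W p = W z" if "z \<notin> \<Omega>" "p \<in> ?C z" for p z
      by (rule W(4)[of "?C z"]) (use that connected_component_subset[of "- \<Omega>" z] in auto)
    have "W x = W y"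
      by (rule integrable_gradient_unbounded_connected[OF W(1) fin connected_connected_component unb[OF n(1)] const[OF n(1)]
            connected_connected_component unb[OF n(2)] const[OF n(2)]])
    then show ?thesis using W(3) x y by simp
  qed
  show thesis
  proof (cases "frontier \<Omega> = {}")
    case True then show ?thesis using that by blast
  next
    case False
    then obtain y where y: "y \<in> frontier \<Omega>" by blast
    show ?thesis by (rule that) (rule eq[OF _ y])
  qed
  qed
qed

section \<open>From the Stokes system to its components and back\<close>

lemma length_le_1: "length is \<le> 1 \<longleftrightarrow> is = [] \<or> (\<exists>i. is = [i])" for "is" :: "'a list"
  by (cases "is") auto

lemma length_le_2: "length is \<le> 2 \<longleftrightarrow> is = [] \<or> (\<exists>i. is = [i]) \<or> (\<exists>i j. is = [i, j])" for "is" :: "'a list"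
  by (cases "is"; cases "tl is") auto

lemma finite_energyD:
  assumes "finite_energy n \<Omega> f"
  shows "set_integrable lborel \<Omega> (\<lambda>x. (norm (f x))\<^sup>2)"
    and "n \<ge> 1 \<Longrightarrow> set_integrable lborel \<Omega> (\<lambda>x. (norm (pd i f x))\<^sup>2)"
    and "n \<ge> 2 \<Longrightarrow> set_integrable lborel \<Omega> (\<lambda>x. (norm (pd i (pd j f) x))\<^sup>2)"
  using assms[unfolded finite_energy_def, rule_format, of "[]"] assms[unfolded finite_energy_def, rule_format, of "[i]"]
    assms[unfolded finite_energy_def, rule_format, of "[i, j]"]
  by (simp_all add: pds_Cons)

lemma set_integrable_square_add:
  fixes f g :: "real^2 \<Rightarrow> real"
  assumes \<Omega>: "open \<Omega>" and c: "continuous_on \<Omega> f" "continuous_on \<Omega> g"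
    and i: "set_integrable lborel \<Omega> (\<lambda>x. (f x)\<^sup>2)" "set_integrable lborel \<Omega> (\<lambda>x. (g x)\<^sup>2)"
  shows "set_integrable lborel \<Omega> (\<lambda>x. (f x + g x)\<^sup>2)"
proof (rule set_integrable_continuous_bound[OF \<Omega>])
  show "continuous_on \<Omega> (\<lambda>x. (f x + g x)\<^sup>2)" by (intro continuous_intros c)
  show "set_integrable lborel \<Omega> (\<lambda>x. 2 * (f x)\<^sup>2 + 2 * (g x)\<^sup>2)"
    by (intro set_integral_add set_integrable_mult_right i)
  have "(a + b)\<^sup>2 \<le> 2 * a\<^sup>2 + 2 * b\<^sup>2" for a b :: real
    using zero_le_power2[of "a - b"] by (simp add: power2_eq_square algebra_simps)
  then show "\<bar>(f x + g x)\<^sup>2\<bar> \<le> 2 * (f x)\<^sup>2 + 2 * (g x)\<^sup>2" for x by simp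
qed

lemma set_integrable_square_cmult:
  fixes f :: "real^2 \<Rightarrow> real"
  assumes "set_integrable lborel \<Omega> (\<lambda>x. (f x)\<^sup>2)"
  shows "set_integrable lborel \<Omega> (\<lambda>x. (c * f x)\<^sup>2)"
  using set_integrable_mult_right[OF assms, of "c\<^sup>2"] by (simp add: power_mult_distrib)

lemma set_integrable_square_const:
  fixes \<Omega> :: "(real^2) set"
  assumes "open \<Omega>" "emeasure lborel \<Omega> < \<infinity>"
  shows "set_integrable lborel \<Omega> (\<lambda>x. (c :: real)\<^sup>2)"
  unfolding set_integrable_def using assms by (simp add: integrable_real_indicator)

lemma set_integrable_cong_on:
  assumes "set_integrable lborel \<Omega> f" "\<And>x. x \<in> \<Omega> \<Longrightarrow> f x = g x"
  shows "set_integrable lborel \<Omega> g"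
  using assms set_integrable_cong[OF refl refl, of \<Omega> f g lborel] by blast

lemma has_trace_cong:
  assumes "has_trace \<Omega> f x b" "\<And>y. y \<in> \<Omega> \<Longrightarrow> f y = g y"
  shows "has_trace \<Omega> g x b"
  using assms(1) unfolding has_trace_def
  by (rule Lim_transform_eventually) (auto simp: eventually_at_filter assms(2))

lemma laplacian_cong:
  assumes "open \<Omega>" "x \<in> \<Omega>" "\<And>y. y \<in> \<Omega> \<Longrightarrow> f y = g y"
  shows "laplacian f x = laplacian g x"
proof -
  have "pd i f y = pd i g y" if "y \<in> \<Omega>" for i y
    by (rule pd_cong[OF assms(1) that assms(3)])
  from pd_cong[OF assms(1,2) this] show ?thesis by (simp add: laplacian_def)
qed

lemma laplacian_pd:
  fixes f :: "real^2 \<Rightarrow> real"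
  assumes \<Omega>: "open \<Omega>" and f: "sub \<Omega> f" and x: "x \<in> \<Omega>"
  shows "laplacian (pd i f) x = pd i (laplacian f) x"
proof -
  have "pd k (pd k (pd i f)) x = pd i (pd k (pd k f)) x" for k
  proof -
    have "pd k (pd k (pd i f)) x = pd k (pd i (pd k f)) x"
      by (rule pd_cong[OF \<Omega> x]) (rule sub_pd_commute[OF \<Omega> f])
    also have "\<dots> = pd i (pd k (pd k f)) x" by (rule sub_pd_commute[OF \<Omega> sub_pd[OF f] x])
    finally show ?thesis .
  qed
  moreover have "pd i (laplacian f) x = pd i (pd 1 (pd 1 f)) x + pd i (pd 2 (pd 2 f)) x"
    unfolding laplacian_2[abs_def] by (rule pd_add) (intro sub_differentiable[OF _ x] sub_pd f)+
  ultimately show ?thesis by (simp add: laplacian_2)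
qed

lemma sub_laplacian:
  fixes f :: "real^2 \<Rightarrow> real"
  assumes "open \<Omega>" "sub \<Omega> f"
  shows "sub \<Omega> (laplacian f)"
  unfolding laplacian_2[abs_def] by (intro sub_add sub_pd assms)

lemma stokes_eigenpairD:
  fixes u :: "real^2 \<Rightarrow> real^2"
  assumes \<Omega>: "open \<Omega>" and S: "stokes_eigenpair \<Omega> l u p" and w_def: "w = (\<lambda>k x. u x $ k)"
  shows "stokes_components \<Omega> l w p"
    and "x \<in> frontier \<Omega> \<Longrightarrow> extension \<Omega> (w k) x = 0"
    and "set_integrable lborel \<Omega> (\<lambda>x. (w k x)\<^sup>2)"
    and "set_integrable lborel \<Omega> (\<lambda>x. (pd i (w k) x)\<^sup>2)"
    and "set_integrable lborel \<Omega> (\<lambda>x. (p x)\<^sup>2)"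
proof -
  note S' = S[unfolded stokes_eigenpair_def]
  have u: "sub \<Omega> u" and p: "sub \<Omega> p" using S' by auto
  have w: "sub \<Omega> (w k)" for k unfolding w_def by (rule sub_nth[OF \<Omega> u])
  have pdw: "pd i (w k) x = pd i u x $ k" if "x \<in> \<Omega>" for i k x
    unfolding w_def by (rule pd_nth[OF sub_differentiable[OF u that]])
  have "laplacian (w k) x + l * w k x = pd k p x" if x: "x \<in> \<Omega>" for k x
  proof -
    have "(laplacian u x + l *\<^sub>R u x) $ k = grad p x $ k" using S' x by simp
    then show ?thesis by (simp add: laplacian_nth[OF \<Omega> u x] w_def grad_def)
  qed
  moreover have "pd 1 (w 1) x + pd 2 (w 2) x = 0" if "x \<in> \<Omega>" for x
    using S' that by (simp add: divg_def sum_2 pdw)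
  ultimately show "stokes_components \<Omega> l w p"
    unfolding stokes_components_def using \<Omega> w p by blast
  show "extension \<Omega> (w k) x = 0" if x: "x \<in> frontier \<Omega>"
  proof -
    have "has_trace \<Omega> u x 0" using S' x by blast
    then have "has_trace \<Omega> (w k) x 0"
      unfolding has_trace_def w_def using tendsto_vec_nth[of u 0 _ k] by simp
    then show ?thesis using has_trace_iff_extension[OF \<Omega> sub_extension[OF w] x] by simp
  qed
  have sq: "\<bar>(v $ k)\<^sup>2\<bar> \<le> (norm v)\<^sup>2" for v :: "real^2"
    using component_le_norm_cart[of v k] power_mono[of "\<bar>v $ k\<bar>" "norm v" 2] by simp
  have e: "finite_energy 1 \<Omega> u" using S' by blast
  show "set_integrable lborel \<Omega> (\<lambda>x. (w k x)\<^sup>2)"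
    by (rule set_integrable_continuous_bound[OF \<Omega> _ finite_energyD(1)[OF e]])
      (auto simp: w_def sq[simplified] intro!: continuous_intros sub_continuous[OF u])
  show "set_integrable lborel \<Omega> (\<lambda>x. (pd i (w k) x)\<^sup>2)"
  proof (rule set_integrable_continuous_bound[OF \<Omega> _ finite_energyD(2)[OF e, of i]])
    show "continuous_on \<Omega> (\<lambda>x. (pd i (w k) x)\<^sup>2)" by (intro continuous_on_power sub_continuous sub_pd w)
    show "\<bar>(pd i (w k) x)\<^sup>2\<bar> \<le> (norm (pd i u x))\<^sup>2" if "x \<in> \<Omega>" for x unfolding pdw[OF that] by (rule sq)
  qed simp
  have "finite_energy 0 \<Omega> p" using S' by blast
  from finite_energyD(1)[OF this] show "set_integrable lborel \<Omega> (\<lambda>x. (p x)\<^sup>2)" by simp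
qed

text \<open>The pressure is zero here; the energy of the velocity is the sum of the energies of its components.\<close>

lemma stokes_eigenpairI:
  assumes \<Omega>: "open \<Omega>" and w: "\<And>k. sub \<Omega> (w k)"
    and eq: "\<And>x k. x \<in> \<Omega> \<Longrightarrow> laplacian (w k) x + l * w k x = 0"
    and div: "\<And>x. x \<in> \<Omega> \<Longrightarrow> pd 1 (w 1) x + pd 2 (w 2) x = 0"
    and bc: "\<And>x k. x \<in> frontier \<Omega> \<Longrightarrow> extension \<Omega> (w k) x = 0"
    and L2: "\<And>k. set_integrable lborel \<Omega> (\<lambda>x. (w k x)\<^sup>2)"
    and H1: "\<And>i k. set_integrable lborel \<Omega> (\<lambda>x. (pd i (w k) x)\<^sup>2)"
  shows "stokes_eigenpair \<Omega> l (\<lambda>x. \<chi> k. w k x) (\<lambda>x. 0)"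
proof -
  let ?u = "\<lambda>x. \<chi> k. w k x"
  have u: "sub \<Omega> ?u" by (rule sub_vec[OF \<Omega> w])
  have pdu: "pd i ?u x = (\<chi> k. pd i (w k) x)" if "x \<in> \<Omega>" for i x
    by (rule pd_vec) (rule sub_differentiable[OF w that])
  have nsq: "(norm (\<chi> k. f k))\<^sup>2 = (f 1)\<^sup>2 + (f 2)\<^sup>2" for f :: "2 \<Rightarrow> real"
    by (simp add: norm_sq_eq sum_2)
  have "finite_energy 1 \<Omega> ?u" unfolding finite_energy_def length_le_1
  proof (intro allI impI, elim disjE exE)
    fix "is" :: "2 list"
    show "set_integrable lborel \<Omega> (\<lambda>x. (norm (pds is ?u x))\<^sup>2)" if "is = []"
      unfolding that using set_integral_add(1)[OF L2[of 1] L2[of 2]] by (simp add: nsq)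
    show "set_integrable lborel \<Omega> (\<lambda>x. (norm (pds is ?u x))\<^sup>2)" if "is = [i]" for i
      unfolding that
      by (rule set_integrable_cong_on[OF set_integral_add(1)[OF H1[of i 1] H1[of i 2]]])
        (simp add: pds_Cons pdu nsq)
  qed
  moreover have "finite_energy 0 \<Omega> (\<lambda>x. 0 :: real)"
    unfolding finite_energy_def by (simp add: set_integrable_def)
  moreover have "laplacian ?u x + l *\<^sub>R ?u x = grad (\<lambda>x. 0) x" if x: "x \<in> \<Omega>" for x
    using laplacian_nth[OF \<Omega> u x] eq[OF x] by (simp add: vec_eq_iff grad_def)
  moreover have "divg ?u x = 0" if "x \<in> \<Omega>" for x
    using div[OF that] by (simp add: divg_def sum_2 pdu[OF that])
  moreover have "has_trace \<Omega> ?u x 0" if x: "x \<in> frontier \<Omega>" for x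
    unfolding has_trace_def
  proof (rule vec_tendstoI)
    fix k
    have "has_trace \<Omega> (w k) x 0"
      using bc[OF x] has_trace_iff_extension[OF \<Omega> sub_extension[OF w] x] by simp
    then show "((\<lambda>x. ?u x $ k) \<longlongrightarrow> 0 $ k) (at x within \<Omega>)" by (simp add: has_trace_def)
  qed
  ultimately show ?thesis unfolding stokes_eigenpair_def using u sub_const by blast
qed

section \<open>The equivalences\<close>

lemma constant_in_iff_gradient_zero:
  assumes \<Omega>: "open \<Omega>" and con: "connected \<Omega>" and p: "sub \<Omega> p"
  shows "constant_in \<Omega> p \<longleftrightarrow> (\<forall>x\<in>\<Omega>. \<forall>i. pd i p x = 0)"
proof
  assume "constant_in \<Omega> p"
  then obtain c where "\<And>x. x \<in> \<Omega> \<Longrightarrow> p x = c" unfolding constant_in_def by blast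
  then show "\<forall>x\<in>\<Omega>. \<forall>i. pd i p x = 0" using pd_cong[OF \<Omega>, of _ p "\<lambda>x. c"] by simp
next
  assume z: "\<forall>x\<in>\<Omega>. \<forall>i. pd i p x = 0"
  have "p constant_on \<Omega>"
  proof (rule has_derivative_zero_connected_constant_on[OF con \<Omega> finite.emptyI sub_continuous[OF p]], intro ballI)
    fix x assume x: "x \<in> \<Omega> - {}"
    have "(p has_derivative (\<lambda>h. 0)) (at x)"
      using has_derivative_pd[OF sub_differentiable[OF p, of x]] x z by simp
    then show "(p has_derivative (\<lambda>h. 0)) (at x within \<Omega>)" by (rule has_derivative_at_withinI)
  qed
  then show "constant_in \<Omega> p" unfolding constant_on_def constant_in_def .
qed

lemma neumann_iff_constant_pressure:
  assumes smooth: "smooth_open_set \<Omega>" and con: "connected \<Omega>" and S: "stokes_eigenpair \<Omega> l u p"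
  shows "neumann_condition \<Omega> p \<longleftrightarrow> constant_in \<Omega> p"
proof -
  have \<Omega>: "open \<Omega>" using smooth by (simp add: smooth_open_set_def)
  note C = stokes_eigenpairD[OF \<Omega> S refl]
  have p: "sub \<Omega> p" by (rule stokes_componentsD(3)[OF C(1)])
  note iff = constant_in_iff_gradient_zero[OF \<Omega> con p]
  show ?thesis
  proof
    assume N: "neumann_condition \<Omega> p"
    have "pd i p x = 0" if "x \<in> \<Omega>" for i x
    proof (rule harmonic_L2_gradient_zero[OF smooth p pressure_harmonic[OF C(1)] C(5) _ that])
      fix y assume y: "y \<in> frontier \<Omega>"
      then have "bgrad \<Omega> p y \<bullet> outward_normal \<Omega> y = 0"
        using N has_normal_derivative_iff[OF \<Omega> p] unfolding neumann_condition_def by blast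
      then show "extension \<Omega> p y * (\<Sum>i\<in>UNIV. extension \<Omega> (pd i p) y * outward_normal \<Omega> y $ i) = 0"
        by (simp add: bgrad_inner)
    qed
    then show "constant_in \<Omega> p" using iff by blast
  next
    assume "constant_in \<Omega> p"
    then have "grad p y = 0" if "y \<in> \<Omega>" for y using iff that by (simp add: grad_def vec_eq_iff)
    then have "has_trace \<Omega> (\<lambda>y. grad p y \<bullet> n) x 0" for x n
      using has_trace_cong[of \<Omega> "\<lambda>y. 0" x 0 "\<lambda>y. grad p y \<bullet> n"] by (simp add: has_trace_def)
    then show "neumann_condition \<Omega> p" unfolding neumann_condition_def has_normal_derivative_def by blast
  qed
qed

text \<open>A function with vanishing boundary gradient is the stream function of a Stokes flow with
  zero pressure as soon as \<open>\<Delta>s + l s\<close> is constant.\<close>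

lemma stream_function_gives_stokes:
  assumes \<Omega>: "open \<Omega>" and s: "sub \<Omega> s" and g0: "\<And>x. x \<in> frontier \<Omega> \<Longrightarrow> bgrad \<Omega> s x = 0"
    and eq: "\<And>x i. x \<in> \<Omega> \<Longrightarrow> pd i (\<lambda>x. laplacian s x + l * s x) x = 0"
    and L2: "\<And>i. set_integrable lborel \<Omega> (\<lambda>x. (pd i s x)\<^sup>2)"
    and H1: "\<And>i j. set_integrable lborel \<Omega> (\<lambda>x. (pd j (pd i s) x)\<^sup>2)"
    and nt: "x0 \<in> \<Omega>" "pd i0 s x0 \<noteq> 0"
  shows "\<exists>u p. nontrivial_on \<Omega> u \<and> stokes_eigenpair \<Omega> l u p \<and> neumann_condition \<Omega> p"
proof -
  \<comment> \<open>the velocity is \<open>(\<partial>\<^sub>2 s, - \<partial>\<^sub>1 s)\<close>; the sign \<open>\<sigma>\<close> and the index \<open>\<tau>\<close> treat both components alike\<close>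
  define \<sigma> :: "2 \<Rightarrow> real" where "\<sigma> k = (if k = 1 then 1 else - 1)" for k
  define \<tau> :: "2 \<Rightarrow> 2" where "\<tau> k = (if k = 1 then 2 else 1)" for k
  define w where "w k x = \<sigma> k * pd (\<tau> k) s x" for k x
  have w_eq: "w k = (\<lambda>x. \<sigma> k * pd (\<tau> k) s x)" for k by (simp add: w_def fun_eq_iff)
  have w: "sub \<Omega> (w k)" for k unfolding w_eq by (intro sub_cmult[OF \<Omega>] sub_pd s)
  have pdw: "pd i (w k) x = \<sigma> k * pd i (pd (\<tau> k) s) x" if "x \<in> \<Omega>" for i k x
    unfolding w_eq by (rule pd_cmult[OF sub_differentiable[OF sub_pd[OF s] that]])
  have pdpdw: "pd j (pd i (w k)) x = \<sigma> k * pd j (pd i (pd (\<tau> k) s)) x" if "x \<in> \<Omega>" for i j k x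
  proof -
    have "pd j (pd i (w k)) x = pd j (\<lambda>x. \<sigma> k * pd i (pd (\<tau> k) s) x) x"
      by (rule pd_cong[OF \<Omega> that pdw])
    then show ?thesis by (simp add: pd_cmult[OF sub_differentiable[OF sub_pd[OF sub_pd[OF s]] that]])
  qed
  have S: "stokes_eigenpair \<Omega> l (\<lambda>x. \<chi> k. w k x) (\<lambda>x. 0)"
  proof (rule stokes_eigenpairI[OF \<Omega> w])
    fix x k assume x: "x \<in> \<Omega>"
    have "pd i (\<lambda>x. laplacian s x + l * s x) x = pd i (laplacian s) x + l * pd i s x" for i
      using sub_differentiable[OF sub_laplacian[OF \<Omega> s] x] sub_differentiable[OF s x]
      by (simp add: pd_add pd_cmult differentiable_mult)
    then have "laplacian (pd i s) x + l * pd i s x = 0" for i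
      using eq[OF x, of i] laplacian_pd[OF \<Omega> s x, of i] by simp
    from this[of "\<tau> k"] have "\<sigma> k * (laplacian (pd (\<tau> k) s) x + l * pd (\<tau> k) s x) = 0" by simp
    then show "laplacian (w k) x + l * w k x = 0"
      by (simp add: laplacian_2 pdpdw[OF x] w_def algebra_simps)
    show "pd 1 (w 1) x + pd 2 (w 2) x = 0"
      using sub_pd_commute[OF \<Omega> s x, of 1 2] by (simp add: pdw[OF x] \<sigma>_def \<tau>_def)
  next
    fix x k assume x: "x \<in> frontier \<Omega>"
    have "bgrad \<Omega> s x $ \<tau> k = 0" using g0[OF x] by simp
    then have "has_trace \<Omega> (pd (\<tau> k) s) x 0"
      using has_trace_iff_extension[OF \<Omega> sub_extension[OF sub_pd[OF s]] x] by (simp add: bgrad_def)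
    then have "has_trace \<Omega> (w k) x (\<sigma> k * 0)"
      unfolding has_trace_def w_eq by (intro tendsto_mult_left)
    then show "extension \<Omega> (w k) x = 0"
      using has_trace_iff_extension[OF \<Omega> sub_extension[OF w] x] by simp
  next
    fix i k
    show "set_integrable lborel \<Omega> (\<lambda>x. (w k x)\<^sup>2)"
      unfolding w_def by (rule set_integrable_square_cmult[OF L2])
    show "set_integrable lborel \<Omega> (\<lambda>x. (pd i (w k) x)\<^sup>2)"
      by (rule set_integrable_cong_on[OF set_integrable_square_cmult[OF H1[of i "\<tau> k"], of "\<sigma> k"]]) (simp add: pdw)
  qed
  have "w (\<tau> i0) x0 \<noteq> 0"
    using nt(2) exhaust_2[of i0] by (auto simp: w_def \<sigma>_def \<tau>_def)
  then have "nontrivial_on \<Omega> (\<lambda>x. \<chi> k. w k x)"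
    unfolding nontrivial_on_def using nt(1) by (intro bexI[of _ x0]) (auto simp: vec_eq_iff)
  moreover have "neumann_condition \<Omega> (\<lambda>x. 0)"
    unfolding neumann_condition_def has_normal_derivative_def has_trace_def grad_def
    by (simp add: inner_vec_def)
  ultimately show ?thesis using S by blast
qed

text \<open>The velocity is the rotated gradient of \<open>w\<close>.  Its own gradient has finite energy by the Caccioppoli inequality for the partial derivatives of \<open>w\<close>, which solve the same equation and vanish on the boundary.\<close>

lemma helmholtz_gives_stokes:
  assumes smooth: "smooth_open_set \<Omega>" and l: "l > 0"
    and nt: "nontrivial_on \<Omega> w" and H: "overdetermined_helmholtz \<Omega> l w"
  shows "\<exists>u p. nontrivial_on \<Omega> u \<and> stokes_eigenpair \<Omega> l u p \<and> neumann_condition \<Omega> p"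
proof -
  have \<Omega>: "open \<Omega>" using smooth by (simp add: smooth_open_set_def)
  note H' = H[unfolded overdetermined_helmholtz_def]
  have w: "sub \<Omega> w" and e: "finite_energy 1 \<Omega> w" using H' by auto
  have eq: "laplacian w x = - l * w x" if "x \<in> \<Omega>" for x using H' that by force
  obtain c where c: "\<And>x. x \<in> frontier \<Omega> \<Longrightarrow> extension \<Omega> w x = c"
    using H' has_trace_iff_extension[OF \<Omega> sub_extension[OF w]] unfolding constant_on_boundary_def by blast
  have g0: "bgrad \<Omega> w x = 0" if "x \<in> frontier \<Omega>" for x
    using constant_trace_gradient_zero[OF smooth w that c] H' has_normal_derivative_iff[OF \<Omega> w that] that by blast
  have L2: "set_integrable lborel \<Omega> (\<lambda>x. (pd i w x)\<^sup>2)" for i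
    using finite_energyD(2)[OF e, of i] by simp
  have lap: "laplacian (pd i w) x = - l * pd i w x" if x: "x \<in> \<Omega>" for i x
  proof -
    have "laplacian (pd i w) x = pd i (laplacian w) x" by (rule laplacian_pd[OF \<Omega> w x])
    also have "\<dots> = pd i (\<lambda>x. - l * w x) x" by (rule pd_cong[OF \<Omega> x eq])
    also have "\<dots> = - l * pd i w x" by (rule pd_cmult[OF sub_differentiable[OF w x]])
    finally show ?thesis .
  qed
  have H1: "set_integrable lborel \<Omega> (\<lambda>x. (pd j (pd i w) x)\<^sup>2)" for i j
  proof -
    have sum: "set_integrable lborel \<Omega> (\<lambda>x. \<Sum>j\<in>UNIV. (pd j (pd i w) x)\<^sup>2)"
    proof (rule caccioppoli(1)[OF smooth sub_pd[OF w] less_imp_le[OF l] lap L2])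
      fix x assume "x \<in> frontier \<Omega>"
      from g0[OF this] have "bgrad \<Omega> w x $ i = 0" by simp
      then have z: "extension \<Omega> (pd i w) x = 0" by (simp add: bgrad_def)
      show "extension \<Omega> (pd i w) x * (\<Sum>j\<in>UNIV. extension \<Omega> (pd j (pd i w)) x * outward_normal \<Omega> x $ j) = 0"
        unfolding z by simp
    qed
    have "continuous_on \<Omega> (\<lambda>x. (pd j (pd i w) x)\<^sup>2)" by (intro continuous_on_power sub_continuous sub_pd w)
    then show ?thesis
    proof (rule set_integrable_continuous_bound[OF \<Omega> _ sum])
      show "\<bar>(pd j (pd i w) x)\<^sup>2\<bar> \<le> (\<Sum>j\<in>UNIV. (pd j (pd i w) x)\<^sup>2)" for x
        using member_le_sum[of j UNIV "\<lambda>j. (pd j (pd i w) x)\<^sup>2"] by simp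
    qed
  qed
  have "\<exists>x\<in>\<Omega>. \<exists>i. pd i w x \<noteq> 0"
  proof (rule ccontr)
    assume "\<not> ?thesis"
    then have z: "pd i w x = 0" if "x \<in> \<Omega>" for x i using that by blast
    obtain x where x: "x \<in> \<Omega>" "w x \<noteq> 0" using nt unfolding nontrivial_on_def by blast
    have "laplacian w x = 0"
      unfolding laplacian_2 using pd_eq_0_open[OF \<Omega> x(1) z] by simp
    then show False using eq[OF x(1)] x(2) l by simp
  qed
  then obtain x i where nt': "x \<in> \<Omega>" "pd i w x \<noteq> 0" by blast
  show ?thesis
  proof (rule stream_function_gives_stokes[OF \<Omega> w g0 _ L2 H1 nt'])
    show "pd i (\<lambda>x. laplacian w x + l * w x) x = 0" if "x \<in> \<Omega>" for x i
      by (rule pd_eq_0_open[OF \<Omega> that]) (simp add: eq)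
  qed
qed

text \<open>The function \<open>\<Delta>\<psi> + l \<psi> - c\<close>, where \<open>c\<close> is the boundary value of \<open>\<Delta>\<psi>\<close>, is harmonic and square integrable and has zero trace; so it is constant, and the rotated gradient of \<open>\<psi>\<close> is a Stokes eigenfield with zero pressure.\<close>

lemma buckling_gives_stokes:
  assumes smooth: "smooth_open_set \<Omega>" and con: "connected \<Omega>" and area: "emeasure lborel \<Omega> < \<infinity>"
    and nt: "nontrivial_on \<Omega> \<psi>" and B: "clamped_buckling \<Omega> l \<psi>"
    and cb: "constant_on_boundary \<Omega> (laplacian \<psi>)"
  shows "\<exists>u p. nontrivial_on \<Omega> u \<and> stokes_eigenpair \<Omega> l u p \<and> neumann_condition \<Omega> p"
proof -
  have \<Omega>: "open \<Omega>" using smooth by (simp add: smooth_open_set_def)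
  note B' = B[unfolded clamped_buckling_def]
  have s: "sub \<Omega> \<psi>" and e: "finite_energy 2 \<Omega> \<psi>" using B' by auto
  have t0: "extension \<Omega> \<psi> x = 0" if "x \<in> frontier \<Omega>" for x
    using B' that has_trace_iff_extension[OF \<Omega> sub_extension[OF s]] by blast
  have g0: "bgrad \<Omega> \<psi> x = 0" if "x \<in> frontier \<Omega>" for x
    using constant_trace_gradient_zero[OF smooth s that t0] B' has_normal_derivative_iff[OF \<Omega> s that] that by blast
  have E: "set_integrable lborel \<Omega> (\<lambda>x. (\<psi> x)\<^sup>2)" "set_integrable lborel \<Omega> (\<lambda>x. (pd i \<psi> x)\<^sup>2)"
    "set_integrable lborel \<Omega> (\<lambda>x. (pd i (pd j \<psi>) x)\<^sup>2)" for i j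
    using finite_energyD(1)[OF e] finite_energyD(2)[OF e, of i] finite_energyD(3)[OF e, of i j] by simp_all
  obtain c where c: "\<And>x. x \<in> frontier \<Omega> \<Longrightarrow> extension \<Omega> (laplacian \<psi>) x = c"
    using cb has_trace_iff_extension[OF \<Omega> sub_extension[OF sub_laplacian[OF \<Omega> s]]]
    unfolding constant_on_boundary_def by blast
  \<comment> \<open>This function is harmonic and square integrable, and it vanishes on the boundary.\<close>
  define h where "h x = laplacian \<psi> x + l * \<psi> x - c" for x
  have hs0: "sub \<Omega> (\<lambda>x. laplacian \<psi> x + l * \<psi> x)" by (intro sub_add sub_cmult sub_laplacian \<Omega> s)
  have hs: "sub \<Omega> h" unfolding h_def[abs_def] by (intro sub_diff[OF \<Omega>] hs0 sub_const)
  have pdh: "pd i h x = pd i (\<lambda>x. laplacian \<psi> x + l * \<psi> x) x" if "x \<in> \<Omega>" for i x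
    unfolding h_def[abs_def] using sub_differentiable[OF hs0 that] by (simp add: pd_diff)
  have harm: "laplacian h x = 0" if x: "x \<in> \<Omega>" for x
  proof -
    note d = sub_differentiable[OF _ x]
    have p1: "pd i h y = pd i (laplacian \<psi>) y + l * pd i \<psi> y" if "y \<in> \<Omega>" for i y
      using sub_differentiable[OF sub_laplacian[OF \<Omega> s] that] sub_differentiable[OF s that]
      by (simp add: pdh[OF that] pd_add pd_cmult differentiable_mult)
    have "pd i (pd i h) x = pd i (pd i (laplacian \<psi>)) x + l * pd i (pd i \<psi>) x" for i
    proof -
      have "pd i (pd i h) x = pd i (\<lambda>x. pd i (laplacian \<psi>) x + l * pd i \<psi> x) x"
        by (rule pd_cong[OF \<Omega> x p1])
      then show ?thesis
        using d[OF sub_pd[OF sub_laplacian[OF \<Omega> s]]] d[OF sub_pd[OF s]]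
        by (simp add: pd_add pd_cmult differentiable_mult)
    qed
    then have "laplacian h x = laplacian (laplacian \<psi>) x + l * laplacian \<psi> x"
      by (simp add: laplacian_2 algebra_simps)
    then show ?thesis using B' x by simp
  qed
  have hL2: "set_integrable lborel \<Omega> (\<lambda>x. (h x)\<^sup>2)"
  proof -
    have "set_integrable lborel \<Omega> (\<lambda>x. (pd 1 (pd 1 \<psi>) x + pd 2 (pd 2 \<psi>) x + l * \<psi> x + (- c))\<^sup>2)"
      by (intro set_integrable_square_add[OF \<Omega>] set_integrable_square_cmult set_integrable_square_const[OF \<Omega> area] E)
        (intro continuous_on_add continuous_on_mult continuous_on_const sub_continuous sub_pd s)+
    then show ?thesis by (simp add: h_def laplacian_2)
  qed
  have ht: "extension \<Omega> h x = 0" if x: "x \<in> frontier \<Omega>" for x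
  proof -
    have "has_trace \<Omega> (laplacian \<psi>) x c" "has_trace \<Omega> \<psi> x 0"
      using c[OF x] t0[OF x] has_trace_iff_extension[OF \<Omega> _ x] sub_extension[OF s] sub_extension[OF sub_laplacian[OF \<Omega> s]]
      by blast+
    then have "has_trace \<Omega> h x (c + l * 0 - c)"
      unfolding has_trace_def h_def[abs_def] by (intro tendsto_intros)
    then show ?thesis using has_trace_iff_extension[OF \<Omega> sub_extension[OF hs] x] by simp
  qed
  have ph0: "pd i h x = 0" if "x \<in> \<Omega>" for i x
  proof (rule harmonic_L2_gradient_zero[OF smooth hs harm hL2 _ that])
    show "extension \<Omega> h x * (\<Sum>i\<in>UNIV. extension \<Omega> (pd i h) x * outward_normal \<Omega> x $ i) = 0" if "x \<in> frontier \<Omega>" for x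
      using ht[OF that] by simp
  qed
  have "\<exists>x\<in>\<Omega>. \<exists>i. pd i \<psi> x \<noteq> 0"
  proof (rule ccontr)
    assume "\<not> ?thesis"
    then have "constant_in \<Omega> \<psi>" using constant_in_iff_gradient_zero[OF \<Omega> con s] by blast
    then obtain k where k: "\<And>x. x \<in> \<Omega> \<Longrightarrow> \<psi> x = k" unfolding constant_in_def by blast
    obtain x where x: "x \<in> \<Omega>" "\<psi> x \<noteq> 0" using nt unfolding nontrivial_on_def by blast
    have "\<Omega> \<noteq> UNIV"
    proof
      assume "\<Omega> = UNIV"
      then have "emeasure lborel (UNIV :: (real^2) set) < \<infinity>" using area by simp
      then show False by simp
    qed
    then obtain y where y: "y \<in> frontier \<Omega>"
      using frontier_eq_empty[of \<Omega>] x(1) by blast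
    have "has_trace \<Omega> \<psi> y k" by (rule has_trace_cong[of \<Omega> "\<lambda>x. k"]) (auto simp: has_trace_def k)
    then have "k = 0" using has_trace_iff_extension[OF \<Omega> sub_extension[OF s] y] t0[OF y] by simp
    then show False using k x by simp
  qed
  then obtain x i where nt': "x \<in> \<Omega>" "pd i \<psi> x \<noteq> 0" by blast
  show ?thesis
    by (rule stream_function_gives_stokes[OF \<Omega> s g0 _ E(2,3) nt']) (use ph0 pdh in auto)
qed

text \<open>The vorticity of a Stokes flow with constant pressure solves the Helmholtz problem, and the
  vorticity minus its boundary value solves the buckling problem.\<close>

lemma stokes_gives_helmholtz_and_buckling:
  fixes u :: "real^2 \<Rightarrow> real^2"
  assumes smooth: "smooth_open_set \<Omega>" and sc: "simply_connected \<Omega>" and area: "emeasure lborel \<Omega> < \<infinity>" and l: "l > 0"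
    and nt: "nontrivial_on \<Omega> u" and S: "stokes_eigenpair \<Omega> l u p" and cp: "constant_in \<Omega> p"
  shows "\<exists>w. nontrivial_on \<Omega> w \<and> overdetermined_helmholtz \<Omega> l w"
    and "\<exists>\<psi>. nontrivial_on \<Omega> \<psi> \<and> clamped_buckling \<Omega> l \<psi> \<and> constant_on_boundary \<Omega> (laplacian \<psi>)"
proof -
  have \<Omega>: "open \<Omega>" using smooth by (simp add: smooth_open_set_def)
  have con: "connected \<Omega>" using sc by (rule simply_connected_imp_connected)
  define w where "w k x = u x $ k" for k x
  have w_eq: "w = (\<lambda>k x. u x $ k)" by (simp add: w_def fun_eq_iff)
  note C = stokes_eigenpairD[OF \<Omega> S w_eq]
  have sc': "stokes_components \<Omega> l w p" using C(1) .
  note D = stokes_componentsD[OF sc']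
  have p0: "pd i p x = 0" if "x \<in> \<Omega>" for i x
    using constant_in_iff_gradient_zero[OF \<Omega> con D(3)] cp that by blast
  define o' where "o' = vorticity w"
  have os: "sub \<Omega> o'" unfolding o'_def by (rule sub_vorticity[OF sc'])
  have po: "pd 1 o' x = - l * w 2 x" "pd 2 o' x = l * w 1 x" if "x \<in> \<Omega>" for x
    using pd_vorticity[OF sc' that] p0[OF that] by (simp_all add: o'_def)
  \<comment> \<open>with these the two equations read \<open>\<partial>\<^sub>i \<omega> = \<sigma>\<^sub>i u\<close> with \<open>u\<close> taken at the other index\<close>
  define \<sigma> :: "2 \<Rightarrow> real" where "\<sigma> k = (if k = 1 then - l else l)" for k
  define \<tau> :: "2 \<Rightarrow> 2" where "\<tau> k = (if k = 1 then 2 else 1)" for k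
  have po': "pd i o' x = \<sigma> i * w (\<tau> i) x" if "x \<in> \<Omega>" for i x
    using po[OF that] exhaust_2[of i] by (auto simp: \<sigma>_def \<tau>_def)
  have ppo: "pd j (pd i o') x = \<sigma> i * pd j (w (\<tau> i)) x" if x: "x \<in> \<Omega>" for i j x
  proof -
    have "pd j (pd i o') x = pd j (\<lambda>x. \<sigma> i * w (\<tau> i) x) x" by (rule pd_cong[OF \<Omega> x po'])
    then show ?thesis by (simp add: pd_cmult[OF sub_differentiable[OF D(2) x]])
  qed
  have g0: "bgrad \<Omega> o' x = 0" if x: "x \<in> frontier \<Omega>" for x
  proof -
    have "extension \<Omega> (pd i o') x = 0" for i
    proof -
      have "has_trace \<Omega> (w (\<tau> i)) x 0"
        using C(2)[OF x] has_trace_iff_extension[OF \<Omega> sub_extension[OF D(2)] x] by simp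
      then have "has_trace \<Omega> (\<lambda>x. \<sigma> i * w (\<tau> i) x) x (\<sigma> i * 0)"
        unfolding has_trace_def by (intro tendsto_mult_left)
      then have "has_trace \<Omega> (pd i o') x 0" using has_trace_cong po' by fastforce
      then show ?thesis using has_trace_iff_extension[OF \<Omega> sub_extension[OF sub_pd[OF os]] x] by simp
    qed
    then show ?thesis by (simp add: bgrad_def vec_eq_iff)
  qed
  have L2: "set_integrable lborel \<Omega> (\<lambda>x. (o' x)\<^sup>2)"
  proof -
    have "set_integrable lborel \<Omega> (\<lambda>x. (pd 1 (w 2) x + (-1) * pd 2 (w 1) x)\<^sup>2)"
      by (intro set_integrable_square_add[OF \<Omega>] set_integrable_square_cmult C(4))
        (intro continuous_on_mult continuous_on_const sub_continuous sub_pd D(2))+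
    then show ?thesis by (simp add: o'_def vorticity_def)
  qed
  have H1: "set_integrable lborel \<Omega> (\<lambda>x. (pd i o' x)\<^sup>2)" for i
    by (rule set_integrable_cong_on[OF set_integrable_square_cmult[OF C(3)[of "\<tau> i"], of "\<sigma> i"]]) (simp add: po')
  have H2: "set_integrable lborel \<Omega> (\<lambda>x. (pd j (pd i o') x)\<^sup>2)" for i j
    by (rule set_integrable_cong_on[OF set_integrable_square_cmult[OF C(4)[of j "\<tau> i"], of "\<sigma> i"]]) (simp add: ppo)
  have lap: "laplacian o' x = - l * o' x" if "x \<in> \<Omega>" for x
    unfolding o'_def by (rule vorticity_helmholtz[OF sc' p0 that])
  have "\<exists>c. \<forall>x\<in>frontier \<Omega>. extension \<Omega> o' x = c"
  proof (rule constant_boundary_trace[OF smooth sc area os g0 H1])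
    fix c assume "\<And>x. x \<in> frontier \<Omega> \<Longrightarrow> extension \<Omega> o' x = c"
    then show "\<exists>c. \<forall>x\<in>frontier \<Omega>. extension \<Omega> o' x = c" by (intro exI[of _ c]) simp
  qed
  then obtain c where c: "\<And>x. x \<in> frontier \<Omega> \<Longrightarrow> extension \<Omega> o' x = c" by blast
  have tr: "has_trace \<Omega> o' x c" if "x \<in> frontier \<Omega>" for x
    using c[OF that] has_trace_iff_extension[OF \<Omega> sub_extension[OF os] that] by simp
  have nd: "has_normal_derivative \<Omega> o' x 0" if "x \<in> frontier \<Omega>" for x
    using has_normal_derivative_iff[OF \<Omega> os that] g0[OF that] by simp
  obtain x0 k0 where x0: "x0 \<in> \<Omega>" "w k0 x0 \<noteq> 0"
    using nt unfolding nontrivial_on_def w_def vec_eq_iff by auto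
  have nc: "\<not> constant_in \<Omega> o'"
  proof
    assume "constant_in \<Omega> o'"
    then have "pd i o' x0 = 0" for i using constant_in_iff_gradient_zero[OF \<Omega> con os] x0(1) by blast
    then have "w k x0 = 0" for k using po[OF x0(1)] l exhaust_2[of k] by auto
    then show False using x0(2) by simp
  qed
  show "\<exists>w. nontrivial_on \<Omega> w \<and> overdetermined_helmholtz \<Omega> l w"
  proof (intro exI[of _ o'] conjI)
    show "nontrivial_on \<Omega> o'" using nc unfolding nontrivial_on_def constant_in_def by auto
    have "finite_energy 1 \<Omega> o'" unfolding finite_energy_def length_le_1
      using L2 H1 by (auto simp: pds_Cons)
    then show "overdetermined_helmholtz \<Omega> l o'"
      unfolding overdetermined_helmholtz_def constant_on_boundary_def using os lap tr nd by auto
  qed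
  define \<psi> where "\<psi> x = o' x + (- c)" for x
  have ps: "sub \<Omega> \<psi>" unfolding \<psi>_def[abs_def] by (intro sub_add[OF \<Omega>] os sub_const)
  have pp: "pd i \<psi> x = pd i o' x" if "x \<in> \<Omega>" for i x
    unfolding \<psi>_def[abs_def] using sub_differentiable[OF os that] by (subst pd_add) auto
  have ppp: "pd j (pd i \<psi>) x = pd j (pd i o') x" if "x \<in> \<Omega>" for i j x
    by (rule pd_cong[OF \<Omega> that pp])
  have lp: "laplacian \<psi> x = - l * o' x" if "x \<in> \<Omega>" for x
    using lap[OF that] by (simp add: laplacian_2 ppp[OF that])
  have llp: "laplacian (laplacian \<psi>) x = - l * laplacian o' x" if x: "x \<in> \<Omega>" for x
  proof -
    have p1: "pd i (\<lambda>x. - l * o' x) y = - l * pd i o' y" if "y \<in> \<Omega>" for i y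
      by (rule pd_cmult[OF sub_differentiable[OF os that]])
    have p2: "pd i (pd i (\<lambda>x. - l * o' x)) x = - l * pd i (pd i o') x" for i
    proof -
      have "pd i (pd i (\<lambda>x. - l * o' x)) x = pd i (\<lambda>x. - l * pd i o' x) x" by (rule pd_cong[OF \<Omega> x p1])
      then show ?thesis by (simp only: pd_cmult[OF sub_differentiable[OF sub_pd[OF os] x]])
    qed
    have "laplacian (laplacian \<psi>) x = laplacian (\<lambda>x. - l * o' x) x" by (rule laplacian_cong[OF \<Omega> x lp])
    also have "\<dots> = - l * laplacian o' x" unfolding laplacian_2 p2 by (simp add: algebra_simps)
    finally show ?thesis .
  qed
  show "\<exists>\<psi>. nontrivial_on \<Omega> \<psi> \<and> clamped_buckling \<Omega> l \<psi> \<and> constant_on_boundary \<Omega> (laplacian \<psi>)"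
  proof (intro exI[of _ \<psi>] conjI)
    show "nontrivial_on \<Omega> \<psi>" using nc unfolding nontrivial_on_def constant_in_def \<psi>_def by auto
    have "set_integrable lborel \<Omega> (\<lambda>x. (\<psi> x)\<^sup>2)" unfolding \<psi>_def
      by (intro set_integrable_square_add[OF \<Omega>] L2 set_integrable_square_const[OF \<Omega> area] sub_continuous[OF os] continuous_on_const)
    moreover have "set_integrable lborel \<Omega> (\<lambda>x. (pd i \<psi> x)\<^sup>2)" for i
      by (rule set_integrable_cong_on[OF H1[of i]]) (simp add: pp)
    moreover have "set_integrable lborel \<Omega> (\<lambda>x. (pd j (pd i \<psi>) x)\<^sup>2)" for i j
      by (rule set_integrable_cong_on[OF H2[of j i]]) (simp add: ppp)
    ultimately have fe: "finite_energy 2 \<Omega> \<psi>"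
      unfolding finite_energy_def length_le_2 by (auto simp: pds_Cons)
    have "has_trace \<Omega> \<psi> x 0" if "x \<in> frontier \<Omega>" for x
      using tendsto_add[OF tr[OF that, unfolded has_trace_def] tendsto_const[of "- c"]]
      unfolding has_trace_def \<psi>_def[abs_def] by simp
    moreover have "has_normal_derivative \<Omega> \<psi> x 0" if "x \<in> frontier \<Omega>" for x
      unfolding has_normal_derivative_def
      by (rule has_trace_cong[OF nd[OF that, unfolded has_normal_derivative_def]]) (simp add: grad_def pp inner_vec_def)
    ultimately show "clamped_buckling \<Omega> l \<psi>"
      unfolding clamped_buckling_def using ps fe llp lp lap by simp
    have "has_trace \<Omega> (laplacian \<psi>) x (- l * c)" if "x \<in> frontier \<Omega>" for x
    proof (rule has_trace_cong)
      show "has_trace \<Omega> (\<lambda>x. - l * o' x) x (- l * c)"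
        using tr[OF that] unfolding has_trace_def by (intro tendsto_mult_left)
    qed (simp add: lp)
    then show "constant_on_boundary \<Omega> (laplacian \<psi>)" unfolding constant_on_boundary_def by blast
  qed
qed

text \<open>The pressure only has to balance the convective derivative, which is a gradient, because \<open>\<partial>\<^sub>t v = \<nu> \<Delta>v\<close> already holds.\<close>

lemma constant_pressure_gives_navier_stokes:
  fixes u :: "real^2 \<Rightarrow> real^2"
  assumes \<Omega>: "open \<Omega>" and con: "connected \<Omega>" and l: "l > 0"
    and S: "stokes_eigenpair \<Omega> l u p" and cp: "constant_in \<Omega> p"
  shows "\<exists>q. navier_stokes \<Omega> \<nu> (\<lambda>t x. exp (- \<nu> * l * t) *\<^sub>R u x) q \<and>
    purely_inertial_pressure \<Omega> (\<lambda>t x. exp (- \<nu> * l * t) *\<^sub>R u x) q"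
proof -
  define w where "w k x = u x $ k" for k x
  have w_eq: "w = (\<lambda>k x. u x $ k)" by (simp add: w_def fun_eq_iff)
  note C = stokes_eigenpairD[OF \<Omega> S w_eq]
  note D = stokes_componentsD[OF C(1)]
  note S' = S[unfolded stokes_eigenpair_def]
  have u: "sub \<Omega> u" using S' by blast
  have p0: "pd i p x = 0" if "x \<in> \<Omega>" for i x
    using constant_in_iff_gradient_zero[OF \<Omega> con D(3)] cp that by blast
  define q0 where "q0 x = (w 1 x * w 1 x + w 2 x * w 2 x) / 2 + vorticity w x * vorticity w x / (2 * l)" for x
  have q0_eq: "q0 = (\<lambda>x. (1 / 2) * (w 1 x * w 1 x + w 2 x * w 2 x) + (1 / (2 * l)) * (vorticity w x * vorticity w x))"
    by (simp add: q0_def fun_eq_iff)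
  have q0s: "sub \<Omega> q0" unfolding q0_eq
    by (intro sub_add[OF \<Omega>] sub_cmult[OF \<Omega>] sub_mult[OF \<Omega>] D(2) sub_vorticity[OF C(1)])
  have pdw: "pd i (w k) x = pd i u x $ k" if "x \<in> \<Omega>" for i k x
    unfolding w_def by (rule pd_nth[OF sub_differentiable[OF u that]])
  have conv: "convect u u x = grad q0 x" if x: "x \<in> \<Omega>" for x
  proof -
    have "pd k q0 x = w 1 x * pd 1 (w k) x + w 2 x * pd 2 (w k) x" for k
      unfolding q0_def[abs_def] by (rule convection_is_gradient[OF C(1) p0 l x])
    then show ?thesis by (simp add: vec_eq_iff grad_def convect_def sum_2 pdw[OF x] w_def)
  qed
  define q where "q t x = - (exp (- \<nu> * l * t) * exp (- \<nu> * l * t)) * q0 x" for t x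
  have main: "sub \<Omega> (\<lambda>x. e *\<^sub>R u x)"
    "\<And>x. x \<in> \<Omega> \<Longrightarrow> convect (\<lambda>x. e *\<^sub>R u x) (\<lambda>x. e *\<^sub>R u x) x = (e * e) *\<^sub>R grad q0 x"
    "\<And>x. x \<in> \<Omega> \<Longrightarrow> laplacian (\<lambda>x. e *\<^sub>R u x) x = - (e * l) *\<^sub>R u x"
    "\<And>x. x \<in> \<Omega> \<Longrightarrow> divg (\<lambda>x. e *\<^sub>R u x) x = 0"
    "\<And>x. x \<in> frontier \<Omega> \<Longrightarrow> has_trace \<Omega> (\<lambda>x. e *\<^sub>R u x) x 0" for e
  proof -
    have "sub \<Omega> (\<lambda>x. \<chi> k. e * w k x)" by (intro sub_vec[OF \<Omega>] sub_cmult[OF \<Omega>] D(2))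
    moreover have "(\<lambda>x. \<chi> k. e * w k x) = (\<lambda>x. e *\<^sub>R u x)" by (simp add: fun_eq_iff vec_eq_iff w_def)
    ultimately show "sub \<Omega> (\<lambda>x. e *\<^sub>R u x)" by simp
    have pde: "pd i (\<lambda>x. e *\<^sub>R u x) x = e *\<^sub>R pd i u x" if "x \<in> \<Omega>" for i x
      by (rule pd_scaleR[OF sub_differentiable[OF u that]])
    fix x
    show "convect (\<lambda>x. e *\<^sub>R u x) (\<lambda>x. e *\<^sub>R u x) x = (e * e) *\<^sub>R grad q0 x" if x: "x \<in> \<Omega>"
      unfolding conv[OF x, symmetric] convect_def sum_2 pde[OF x]
      by (simp add: vec_eq_iff algebra_simps)
    show "divg (\<lambda>x. e *\<^sub>R u x) x = 0" if x: "x \<in> \<Omega>"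
    proof -
      have "divg (\<lambda>x. e *\<^sub>R u x) x = e * divg u x" by (simp add: divg_def pde[OF x] sum_2 algebra_simps)
      then show ?thesis using S' x by simp
    qed
    show "laplacian (\<lambda>x. e *\<^sub>R u x) x = - (e * l) *\<^sub>R u x" if x: "x \<in> \<Omega>"
    proof -
      have "pd i (pd i (\<lambda>x. e *\<^sub>R u x)) x = e *\<^sub>R pd i (pd i u) x" for i
      proof -
        have "pd i (pd i (\<lambda>x. e *\<^sub>R u x)) x = pd i (\<lambda>x. e *\<^sub>R pd i u x) x" by (rule pd_cong[OF \<Omega> x pde])
        then show ?thesis by (simp only: pd_scaleR[OF sub_differentiable[OF sub_pd[OF u] x]])
      qed
      then have "laplacian (\<lambda>x. e *\<^sub>R u x) x = e *\<^sub>R laplacian u x" by (simp add: laplacian_2 scaleR_add_right)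
      moreover have "grad p x = 0" using p0[OF x] by (simp add: grad_def vec_eq_iff)
      then have "laplacian u x = - (l *\<^sub>R u x)" using S' x by (simp add: eq_neg_iff_add_eq_0)
      ultimately show ?thesis by simp
    qed
    show "has_trace \<Omega> (\<lambda>x. e *\<^sub>R u x) x 0" if x: "x \<in> frontier \<Omega>"
    proof -
      have "(u \<longlongrightarrow> 0) (at x within \<Omega>)" using S' x unfolding has_trace_def by blast
      from tendsto_scaleR[OF tendsto_const this, of e] show ?thesis unfolding has_trace_def by simp
    qed
  qed
  have gq: "grad (q t) x = - (exp (- \<nu> * l * t) * exp (- \<nu> * l * t)) *\<^sub>R grad q0 x" if "x \<in> \<Omega>" for t x
    unfolding q_def[abs_def] grad_def
    using pd_cmult[OF sub_differentiable[OF q0s that], of _ "- (exp (- \<nu> * l * t) * exp (- \<nu> * l * t))"]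
    by (simp add: vec_eq_iff)
  have qs: "sub \<Omega> (q t)" for t unfolding q_def[abs_def] by (intro sub_cmult[OF \<Omega>] q0s)
  let ?v = "\<lambda>t x. exp (- \<nu> * l * t) *\<^sub>R u x"
  have "navier_stokes \<Omega> \<nu> ?v q"
    unfolding navier_stokes_def
  proof (intro allI impI conjI ballI main qs)
    fix t :: real and x assume x: "x \<in> \<Omega>"
    have "((\<lambda>s. exp (- \<nu> * l * s)) has_real_derivative - \<nu> * l * exp (- \<nu> * l * t)) (at t within {0..})"
      by (auto intro!: derivative_eq_intros)
    then have "((\<lambda>s. ?v s x) has_vector_derivative (- \<nu> * l * exp (- \<nu> * l * t)) *\<^sub>R u x) (at t within {0..})"
      using has_vector_derivative_scaleR[OF _ has_vector_derivative_const[of "u x"]] by fastforce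
    moreover have "(- \<nu> * l * exp (- \<nu> * l * t)) *\<^sub>R u x + convect (?v t) (?v t) x = \<nu> *\<^sub>R laplacian (?v t) x - grad (q t) x"
      unfolding main(2)[OF x] main(3)[OF x] gq[OF x] by (simp add: algebra_simps)
    ultimately show "\<exists>v'. ((\<lambda>s. ?v s x) has_vector_derivative v') (at t within {0..}) \<and>
        v' + convect (?v t) (?v t) x = \<nu> *\<^sub>R laplacian (?v t) x - grad (q t) x" by blast
  qed
  moreover have "purely_inertial_pressure \<Omega> ?v q"
    unfolding purely_inertial_pressure_def
    by (intro allI impI ballI) (simp only: main(2) gq scaleR_minus_left, simp)
  ultimately show ?thesis by blast
qed

text \<open>At time zero the equation shows that the convective derivative of \<open>u\<close> is the gradient of \<open>p - q\<close>.\<close>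

lemma navier_stokes_gives_constant_pressure:
  fixes u :: "real^2 \<Rightarrow> real^2"
  assumes smooth: "smooth_open_set \<Omega>" and con: "connected \<Omega>" and S: "stokes_eigenpair \<Omega> l u p"
    and NS: "navier_stokes \<Omega> 1 (\<lambda>t x. exp (- 1 * l * t) *\<^sub>R u x) q"
  shows "constant_in \<Omega> p"
proof -
  have \<Omega>: "open \<Omega>" using smooth by (simp add: smooth_open_set_def)
  define w where "w k x = u x $ k" for k x
  have w_eq: "w = (\<lambda>k x. u x $ k)" by (simp add: w_def fun_eq_iff)
  note C = stokes_eigenpairD[OF \<Omega> S w_eq]
  note D = stokes_componentsD[OF C(1)]
  note S' = S[unfolded stokes_eigenpair_def]
  have u: "sub \<Omega> u" using S' by blast
  have pdw: "pd i (w k) x = pd i u x $ k" if "x \<in> \<Omega>" for i k x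
    unfolding w_def by (rule pd_nth[OF sub_differentiable[OF u that]])
  have q0: "sub \<Omega> (q 0)" using NS unfolding navier_stokes_def by blast
  define s where "s x = p x - q 0 x" for x
  have ss: "sub \<Omega> s" unfolding s_def[abs_def] by (rule sub_diff[OF \<Omega> D(3) q0])
  have "pd k s x = w 1 x * pd 1 (w k) x + w 2 x * pd 2 (w k) x" if x: "x \<in> \<Omega>" for x k
  proof -
    have v0: "(\<lambda>x. exp (- 1 * l * 0) *\<^sub>R u x) = u" by simp
    obtain v' where v': "((\<lambda>s. exp (- 1 * l * s) *\<^sub>R u x) has_vector_derivative v') (at 0 within {0..})"
      "v' + convect u u x = 1 *\<^sub>R laplacian u x - grad (q 0) x"
      using NS x unfolding navier_stokes_def using v0 by (metis order_refl)
    have "((\<lambda>s. exp (- 1 * l * s)) has_real_derivative - l) (at 0 within {0..})"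
      by (auto intro!: derivative_eq_intros)
    then have "((\<lambda>s. exp (- 1 * l * s) *\<^sub>R u x) has_vector_derivative (- l) *\<^sub>R u x) (at 0 within {0..})"
      using has_vector_derivative_scaleR[OF _ has_vector_derivative_const[of "u x"]] by fastforce
    moreover have "at_right (0::real) \<le> at 0 within {0..}" by (rule at_le) auto
    then have "at (0::real) within {0..} \<noteq> bot"
      using trivial_limit_at_right_real[of 0] by (metis bot_unique)
    ultimately have "v' = (- l) *\<^sub>R u x" using vector_derivative_unique_within v'(1) by blast
    then have "convect u u x = (laplacian u x + l *\<^sub>R u x) - grad (q 0) x" using v'(2) by (simp add: algebra_simps)
    also have "\<dots> = grad p x - grad (q 0) x" using S' x by simp
    finally have "convect u u x $ k = pd k p x - pd k (q 0) x" by (simp add: grad_def)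
    then have "pd k s x = convect u u x $ k"
      unfolding s_def[abs_def] by (simp add: pd_diff sub_differentiable[OF D(3) x] sub_differentiable[OF q0 x])
    then show ?thesis by (simp add: convect_def sum_2 pdw[OF x] w_def)
  qed
  note par = gradient_convection_parallel[OF C(1) ss this]
  have "bgrad \<Omega> p x \<bullet> outward_normal \<Omega> x = 0" if x: "x \<in> frontier \<Omega>" for x
    by (rule gradient_convection_neumann[OF smooth C(1,2) par x])
  then have "neumann_condition \<Omega> p"
    unfolding neumann_condition_def using has_normal_derivative_iff[OF \<Omega> D(3)] by blast
  then show ?thesis using neumann_iff_constant_pressure[OF smooth con S] by blast
qed

theorem proposition2:
  fixes \<Omega> :: "(real^2) set" and l :: real
  assumes "smooth_open_set \<Omega>"
    and "simply_connected \<Omega>"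
    and "emeasure lborel \<Omega> < \<infinity>"
    and "l > 0"
  shows "((\<exists>w. nontrivial_on \<Omega> w \<and> overdetermined_helmholtz \<Omega> l w) \<longleftrightarrow>
           (\<exists>u p. nontrivial_on \<Omega> u \<and> stokes_eigenpair \<Omega> l u p \<and> neumann_condition \<Omega> p)) \<and>
         ((\<exists>\<psi>. nontrivial_on \<Omega> \<psi> \<and> clamped_buckling \<Omega> l \<psi> \<and>
               constant_on_boundary \<Omega> (laplacian \<psi>)) \<longleftrightarrow>
           (\<exists>u p. nontrivial_on \<Omega> u \<and> stokes_eigenpair \<Omega> l u p \<and> neumann_condition \<Omega> p)) \<and>
         (\<forall>u p. stokes_eigenpair \<Omega> l u p \<longrightarrow>
           (neumann_condition \<Omega> p \<longleftrightarrow> constant_in \<Omega> p) \<and>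
           (constant_in \<Omega> p \<longleftrightarrow>
             (\<forall>\<nu>>0. \<exists>q. navier_stokes \<Omega> \<nu> (\<lambda>t x. exp (- \<nu> * l * t) *\<^sub>R u x) q \<and>
                        purely_inertial_pressure \<Omega> (\<lambda>t x. exp (- \<nu> * l * t) *\<^sub>R u x) q)) \<and>
           (constant_in \<Omega> p \<longleftrightarrow>
             (\<forall>\<nu>>0. \<exists>q. navier_stokes \<Omega> \<nu> (\<lambda>t x. exp (- \<nu> * l * t) *\<^sub>R u x) q)))"
proof (intro conjI allI impI)
  have \<Omega>: "open \<Omega>" using assms(1) by (simp add: smooth_open_set_def)
  have con: "connected \<Omega>" using assms(2) by (rule simply_connected_imp_connected)
  note N = neumann_iff_constant_pressure[OF assms(1) con]
  note HB = stokes_gives_helmholtz_and_buckling[OF assms]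
  show "(\<exists>w. nontrivial_on \<Omega> w \<and> overdetermined_helmholtz \<Omega> l w) \<longleftrightarrow>
      (\<exists>u p. nontrivial_on \<Omega> u \<and> stokes_eigenpair \<Omega> l u p \<and> neumann_condition \<Omega> p)"
    using helmholtz_gives_stokes[OF assms(1,4)] HB(1) N by meson
  show "(\<exists>\<psi>. nontrivial_on \<Omega> \<psi> \<and> clamped_buckling \<Omega> l \<psi> \<and> constant_on_boundary \<Omega> (laplacian \<psi>)) \<longleftrightarrow>
      (\<exists>u p. nontrivial_on \<Omega> u \<and> stokes_eigenpair \<Omega> l u p \<and> neumann_condition \<Omega> p)"
    using buckling_gives_stokes[OF assms(1) con assms(3)] HB(2) N by meson
  fix u p assume S: "stokes_eigenpair \<Omega> l u p"
  show "neumann_condition \<Omega> p \<longleftrightarrow> constant_in \<Omega> p" by (rule N[OF S])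
  note to_NS = constant_pressure_gives_navier_stokes[OF \<Omega> con assms(4) S]
  have from_NS: "constant_in \<Omega> p" if "\<forall>\<nu>>0. \<exists>q. navier_stokes \<Omega> \<nu> (\<lambda>t x. exp (- \<nu> * l * t) *\<^sub>R u x) q"
    using that[rule_format, of 1] navier_stokes_gives_constant_pressure[OF assms(1) con S] by auto
  show "constant_in \<Omega> p \<longleftrightarrow> (\<forall>\<nu>>0. \<exists>q. navier_stokes \<Omega> \<nu> (\<lambda>t x. exp (- \<nu> * l * t) *\<^sub>R u x) q \<and>
      purely_inertial_pressure \<Omega> (\<lambda>t x. exp (- \<nu> * l * t) *\<^sub>R u x) q)"
    using to_NS from_NS by meson
  show "constant_in \<Omega> p \<longleftrightarrow> (\<forall>\<nu>>0. \<exists>q. navier_stokes \<Omega> \<nu> (\<lambda>t x. exp (- \<nu> * l * t) *\<^sub>R u x) q)"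
    using to_NS from_NS by meson
qed

end
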